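(* Let $\alpha$ be a set with an involution $\tau$, let $\pi=\pi(\alpha,\tau)$, and let $\varphi:\pi\to\mathbb Z$ be an additive homomorphism such that $\varphi(a)\in\{+1,-1\}$ for all $a\in\alpha$. For any nanoword $w$ over $\alpha$, $$\|w\|_{br}\ \ge\ \tfrac12\,\sigma_\varphi(p_w),$$ where $p_w=p(w)$ is the $\alpha$-pairing associated with $w$, $\sigma_\varphi$ is the $\varphi$-genus and $\|\cdot\|_{br}$ is the bridge norm.
   Context: **Nanowords.** $\alpha$ is a set with an involution $\tau:\alpha\to\alpha$ ($\tau^2=\mathrm{id}$). An $\alpha$-alphabet is a set $\mathcal A$ with a map $\mathcal A\to\alpha$, $A\mapsto|A|$. A nanoword of length $n$ over $\alpha$ is a pair $(\mathcal A,w)$ with $\mathcal A$ an $\alpha$-alphabet and $w:\{1,\dots,n\}\to\mathcal A$ a map (written $w(1)\cdots w(n)$) taking every value in $\mathcal A$ exactly twice; $\emptyset$ is the empty nanoword. Nanowords $(\mathcal A,w),(\mathcal A',w')$ are isomorphic if $w'=fw$ for a bijection $f:\mathcal A\to\mathcal A'$ with $|f(A)|=|A|$. The opposite word is $w^-=w(n)\cdots w(1)$. **Homotopy moves.** (1) $(\mathcal A,xAAy)\mapsto(\mathcal A-\{A\},xy)$; (2) $(\mathcal A,xAByBAz)\mapsto(\mathcal A-\{A,B\},xyz)$ if $|B|=\tau(|A|)$; (3) $(\mathcal A,xAByACzBCt)\mapsto(\mathcal A,xBAyCAzCBt)$ for distinct $A,B,C$ with $|A|=|B|=|C|$. **Bridge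 moves.** A factor of $(\mathcal A,w)$ is a sequence of words $\nabla=(\mathcal B,(v_1|\cdots|v_k))$ in a subset $\mathcal B\subset\mathcal A$, each letter of $\mathcal B$ occurring exactly twice in $v_1\cdots v_k$, such that $w=x_1v_1x_2v_2\cdots x_kv_kx_{k+1}$ with $x_i$ words in $\mathcal A-\mathcal B$. A quasi-bridge in $w$ is a pair $(\nabla,\kappa)$ with $\nabla=(\mathcal B,(v_1|\cdots|v_k))$ a factor of $(\mathcal A,w)$, $k\ge1$, and $\kappa$ an involutive permutation of $\{1,\dots,k\}$ such that (a) $v_r$ has even length whenever $\kappa(r)=r$; (b) there is a map $\iota:\mathcal B\to\mathcal B$ with $\iota v_r=v_{\kappa(r)}^-$ for all $r$. The occurrence of $B\in\mathcal B$ in position $j$ of $v_r$ is symmetric to the occurrence of $\iota(B)$ in position $n_r+1-j$ of $v_{\kappa(r)}$, where $n_r$ is the length of $v_r$. Put $\varepsilon(B)=1$ if the occurrence symmetric to the leftmost occurrence of $B$ in $w$ is the leftmost occurrence of $\iota(B)$ in $w$, and $\varepsilon(B)=0$ otherwise. A quasi-bridge is a bridge if $|\iota(B)|=\tau^{\varepsilon(B)}(|B|)$ for all $B\in\mathcal B$. The corresponding bridge move $m$ transforms $(\mathcal A,w)$ into $(\mathcal A-\mathcal B,x_1x_2\cdots x_{k+1})$; its number of arches $g(m)=g(m^{-1})$ is the number of 2-element orbits of $\kappa$. (A bridge move is always considered together with the bridge defining it.) **Bridge norm.** A metamorphosis $m:v\to w$ is a finite sequence $m=(m_1,\dots,m_n)$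 of isomorphisms, homotopy moves, bridge moves, and inverses of such moves, transforming $v$ into $w$; $g(m)=\sum_ig(m_i)$ where $g(m_i)$ is the number of arches if $m_i$ is a bridge move or the inverse of one, and $g(m_i)=0$ otherwise. $\|w\|_{br}=\min_mg(m)$ over all metamorphoses $m:w\to\emptyset$. **$\alpha$-pairings.** $\pi=\pi(\alpha,\tau)$ is the additive abelian group with generators $a\in\alpha$ and relations $a+\tau(a)=0$. An $\alpha$-pairing is a triple $p=(S,s,e)$: a set $S$ (here finite), $s\in S$, a map $S^\circ=S-\{s\}\to\alpha$, $A\mapsto|A|$, and a map $e:S\times S\to\pi$, extended to a bilinear form $\tilde e:\mathbb ZS\times\mathbb ZS\to\pi$. A vector $x\in\mathbb ZS$ is short if $x=A\in S^\circ$, or $x=A+B$ with $A\ne B\in S^\circ$, $|A|=|B|$, or $x=A-B$ with $A\ne B\in S^\circ$, $|A|=\tau(|B|)$. A filling of $p$ is a finite family $\{\lambda_i\}$ in $\mathbb ZS$ such that one $\lambda_i$ equals $s$, all others are short, and every element of $S^\circ$ occurs with non-zero coefficient in exactly one $\lambda_i$. The $\varphi$-genus is $\sigma_\varphi(p)=\min_\lambda\frac12\operatorname{rk}\big(\varphi\tilde e(\lambda_i,\lambda_j)\big)_{i,j}$, the minimum over all fillings $\lambda$ of $p$ (rank over $\mathbb Q$). **The $\alpha$-pairing of a nanoword $(\mathcal A,w)$.** $p_w=p(w)=(\mathcal A\cup\{s\},s,e_w)$ with the given projection $\mathcal A\to\alpha$. For $A,B\in\mathcal A$ let $n_w(A,B)=1$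 if $w=\cdots A\cdots B\cdots A\cdots B\cdots$, $-1$ if $w=\cdots B\cdots A\cdots B\cdots A\cdots$, $0$ otherwise. Let $i_A<j_A$ be the elements of $w^{-1}(A)$, and $A\circ_wB=\sum|D|\in\pi$ over $D\in\mathcal A$ with $i_A<i_D<j_A$ and $i_B<j_D<j_B$. Then $e_w(A,B)=2(A\circ_wB-B\circ_wA)+n_w(A,B)(|A|+|B|)$, $e_w(A,s)=-e_w(s,A)=\sum_{D\in\mathcal A}n_w(A,D)|D|$, $e_w(s,s)=0$. *)

theory Defs
  imports
    "HOL-Algebra.Free_Abelian_Groups"
    "HOL-Combinatorics.Permutations"
    "HOL-Library.Sublist"
    "HOL-Library.Infinite_Typeclass"
    "Jordan_Normal_Form.DL_Rank"
begin

section \<open>Nanowords\<close>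

record ('a, 'b) nanoword =
  letters :: "'b set"
  proj :: "'b \<Rightarrow> 'a"
  word :: "'b list"

text \<open>The projection is extensional, so that a nanoword carries no information outside its
  alphabet and the empty nanoword is unique. Finiteness of the alphabet follows from the
  condition on the word.\<close>

definition nanoword :: "'a set \<Rightarrow> ('a, 'b) nanoword \<Rightarrow> bool" where
  "nanoword \<alpha> w \<longleftrightarrow>
     proj w \<in> letters w \<rightarrow>\<^sub>E \<alpha> \<and>
     set (word w) \<subseteq> letters w \<and>
     (\<forall>A\<in>letters w. count_list (word w) A = 2)"

definition empty_nanoword :: "('a, 'b) nanoword" where
  "empty_nanoword = \<lparr>letters = {}, proj = (\<lambda>_. undefined), word = []\<rparr>"

definition delete_letters :: "('a, 'b) nanoword \<Rightarrow> 'b set \<Rightarrow> 'b list \<Rightarrow> ('a, 'b) nanoword" where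
  "delete_letters w \<B> u =
     \<lparr>letters = letters w - \<B>, proj = restrict (proj w) (letters w - \<B>), word = u\<rparr>"

definition isomorphism_move :: "('a, 'b) nanoword \<Rightarrow> ('a, 'b) nanoword \<Rightarrow> bool" where
  "isomorphism_move v w \<longleftrightarrow>
     (\<exists>f. bij_betw f (letters v) (letters w) \<and>
          (\<forall>A\<in>letters v. proj w (f A) = proj v A) \<and>
          word w = map f (word v))"

section \<open>Homotopy moves\<close>

text \<open>Only applied to nanowords, for which \<open>A \<noteq> B\<close> in the second move is automatic.\<close>

inductive homotopy_move :: "('a \<Rightarrow> 'a) \<Rightarrow> ('a, 'b) nanoword \<Rightarrow> ('a, 'b) nanoword \<Rightarrow> bool"
  for \<tau> where
  first:
    "word v = x @ [A, A] @ y \<Longrightarrow>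
     homotopy_move \<tau> v (delete_letters v {A} (x @ y))"
| second:
    "word v = x @ [A, B] @ y @ [B, A] @ z \<Longrightarrow> proj v B = \<tau> (proj v A) \<Longrightarrow>
     homotopy_move \<tau> v (delete_letters v {A, B} (x @ y @ z))"
| third:
    "word v = x @ [A, B] @ y @ [A, C] @ z @ [B, C] @ t \<Longrightarrow> distinct [A, B, C] \<Longrightarrow>
     proj v A = proj v B \<Longrightarrow> proj v B = proj v C \<Longrightarrow>
     homotopy_move \<tau> v (v\<lparr>word := x @ [B, A] @ y @ [C, A] @ z @ [C, B] @ t\<rparr>)"

section \<open>Bridge moves\<close>

text \<open>A factor \<open>(v\<^sub>1|\<dots>|v\<^sub>k)\<close> is stored as the list \<open>vs\<close>, indexed from 0, together with the
  list \<open>xs\<close> of the \<open>k + 1\<close> complementary words; the last one is paired with an empty word.\<close>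

definition interleave :: "'b list list \<Rightarrow> 'b list list \<Rightarrow> 'b list" where
  "interleave xs vs = concat (map2 (@) xs (vs @ [[]]))"

definition is_factor ::
  "('a, 'b) nanoword \<Rightarrow> 'b set \<Rightarrow> 'b list list \<Rightarrow> 'b list list \<Rightarrow> bool" where
  "is_factor w \<B> xs vs \<longleftrightarrow>
     \<B> \<subseteq> letters w \<and>
     length xs = Suc (length vs) \<and>
     word w = interleave xs vs \<and>
     (\<forall>v\<in>set vs. set v \<subseteq> \<B>) \<and>
     (\<forall>B\<in>\<B>. count_list (concat vs) B = 2) \<and>
     (\<forall>x\<in>set xs. set x \<subseteq> letters w - \<B>)"

definition quasi_bridge ::
  "('a, 'b) nanoword \<Rightarrow> 'b set \<Rightarrow> 'b list list \<Rightarrow> 'b list list \<Rightarrow>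
   (nat \<Rightarrow> nat) \<Rightarrow> ('b \<Rightarrow> 'b) \<Rightarrow> bool" where
  "quasi_bridge w \<B> xs vs \<kappa> \<iota> \<longleftrightarrow>
     is_factor w \<B> xs vs \<and> length vs \<ge> 1 \<and>
     \<kappa> permutes {..<length vs} \<and> (\<forall>r<length vs. \<kappa> (\<kappa> r) = r) \<and>
     (\<forall>r<length vs. \<kappa> r = r \<longrightarrow> even (length (vs ! r))) \<and>
     \<iota> \<in> \<B> \<rightarrow> \<B> \<and>
     (\<forall>r<length vs. map \<iota> (vs ! r) = rev (vs ! \<kappa> r))"

definition positions :: "'b list \<Rightarrow> 'b \<Rightarrow> nat set" where
  "positions u A = {i. i < length u \<and> u ! i = A}"

definition first_pos :: "'b list \<Rightarrow> 'b \<Rightarrow> nat" where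
  "first_pos u A = Min (positions u A)"

definition last_pos :: "'b list \<Rightarrow> 'b \<Rightarrow> nat" where
  "last_pos u A = Max (positions u A)"

text \<open>The position in \<open>interleave xs vs\<close> of the \<open>j\<close>-th entry of \<open>vs ! r\<close>.\<close>

definition factor_pos :: "'b list list \<Rightarrow> 'b list list \<Rightarrow> nat \<Rightarrow> nat \<Rightarrow> nat" where
  "factor_pos xs vs r j =
     length (concat (map2 (@) (take r xs) (take r vs))) + length (xs ! r) + j"

definition bridge_eps ::
  "'b list list \<Rightarrow> 'b list list \<Rightarrow> (nat \<Rightarrow> nat) \<Rightarrow> ('b \<Rightarrow> 'b) \<Rightarrow> 'b \<Rightarrow> nat" where
  "bridge_eps xs vs \<kappa> \<iota> B =
     (if \<exists>r j. r < length vs \<and> j < length (vs ! r) \<and>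
          factor_pos xs vs r j = first_pos (interleave xs vs) B \<and>
          factor_pos xs vs (\<kappa> r) (length (vs ! r) - 1 - j)
            = first_pos (interleave xs vs) (\<iota> B)
      then 1 else 0)"

definition bridge ::
  "('a \<Rightarrow> 'a) \<Rightarrow> ('a, 'b) nanoword \<Rightarrow> 'b set \<Rightarrow> 'b list list \<Rightarrow> 'b list list \<Rightarrow>
   (nat \<Rightarrow> nat) \<Rightarrow> ('b \<Rightarrow> 'b) \<Rightarrow> bool" where
  "bridge \<tau> w \<B> xs vs \<kappa> \<iota> \<longleftrightarrow>
     quasi_bridge w \<B> xs vs \<kappa> \<iota> \<and>
     (\<forall>B\<in>\<B>. proj w (\<iota> B) = (\<tau> ^^ bridge_eps xs vs \<kappa> \<iota> B) (proj w B))"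

definition arches :: "nat \<Rightarrow> (nat \<Rightarrow> nat) \<Rightarrow> nat" where
  "arches k \<kappa> = card {{r, \<kappa> r} | r. r < k \<and> \<kappa> r \<noteq> r}"

inductive bridge_move ::
  "('a \<Rightarrow> 'a) \<Rightarrow> ('a, 'b) nanoword \<Rightarrow> ('a, 'b) nanoword \<Rightarrow> nat \<Rightarrow> bool" for \<tau> where
  "bridge \<tau> w \<B> xs vs \<kappa> \<iota> \<Longrightarrow>
   bridge_move \<tau> w (delete_letters w \<B> (concat xs)) (arches (length vs) \<kappa>)"

section \<open>Metamorphoses and the bridge norm\<close>

text \<open>The last argument of the next two predicates is the number of arches.\<close>

inductive elementary_move ::
  "'a set \<Rightarrow> ('a \<Rightarrow> 'a) \<Rightarrow> ('a, 'b) nanoword \<Rightarrow> ('a, 'b) nanoword \<Rightarrow> nat \<Rightarrow> bool"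
  for \<alpha> \<tau> where
  isomorphism:
    "nanoword \<alpha> v \<Longrightarrow> nanoword \<alpha> w \<Longrightarrow> isomorphism_move v w \<Longrightarrow> elementary_move \<alpha> \<tau> v w 0"
| homotopy:
    "nanoword \<alpha> v \<Longrightarrow> nanoword \<alpha> w \<Longrightarrow> homotopy_move \<tau> v w \<Longrightarrow> elementary_move \<alpha> \<tau> v w 0"
| bridge:
    "nanoword \<alpha> v \<Longrightarrow> nanoword \<alpha> w \<Longrightarrow> bridge_move \<tau> v w g \<Longrightarrow> elementary_move \<alpha> \<tau> v w g"

inductive metamorphosis ::
  "'a set \<Rightarrow> ('a \<Rightarrow> 'a) \<Rightarrow> ('a, 'b) nanoword \<Rightarrow> ('a, 'b) nanoword \<Rightarrow> nat \<Rightarrow> bool"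
  for \<alpha> \<tau> where
  nil: "nanoword \<alpha> w \<Longrightarrow> metamorphosis \<alpha> \<tau> w w 0"
| move:
    "elementary_move \<alpha> \<tau> u v g \<Longrightarrow> metamorphosis \<alpha> \<tau> v w h \<Longrightarrow>
     metamorphosis \<alpha> \<tau> u w (g + h)"
| inverse_move:
    "elementary_move \<alpha> \<tau> v u g \<Longrightarrow> metamorphosis \<alpha> \<tau> v w h \<Longrightarrow>
     metamorphosis \<alpha> \<tau> u w (g + h)"

text \<open>Inverse moves introduce new letters, so the type of letters has to be infinite.
  Alphabets of nanowords being finite, any infinite type contains all of them up to isomorphism.\<close>

definition bridge_norm :: "'a set \<Rightarrow> ('a \<Rightarrow> 'a) \<Rightarrow> ('a, 'b :: infinite) nanoword \<Rightarrow> nat" where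
  "bridge_norm \<alpha> \<tau> w = (LEAST g. metamorphosis \<alpha> \<tau> w empty_nanoword g)"

section \<open>The group \<open>\<pi>(\<alpha>, \<tau>)\<close>\<close>

text \<open>Groups are written multiplicatively in the library: the sum, negative and multiples in
  \<open>\<pi>\<close> appear as product, inverse and integer powers.\<close>

definition pi_relations :: "'a set \<Rightarrow> ('a \<Rightarrow> 'a) \<Rightarrow> ('a \<Rightarrow>\<^sub>0 int) set" where
  "pi_relations \<alpha> \<tau> =
     generate (free_Abelian_group \<alpha>) ((\<lambda>a. frag_of a + frag_of (\<tau> a)) ` \<alpha>)"

definition pi_group :: "'a set \<Rightarrow> ('a \<Rightarrow> 'a) \<Rightarrow> ('a \<Rightarrow>\<^sub>0 int) set monoid" where
  "pi_group \<alpha> \<tau> = free_Abelian_group \<alpha> Mod pi_relations \<alpha> \<tau>"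

definition pi_gen :: "'a set \<Rightarrow> ('a \<Rightarrow> 'a) \<Rightarrow> 'a \<Rightarrow> ('a \<Rightarrow>\<^sub>0 int) set" where
  "pi_gen \<alpha> \<tau> a = pi_relations \<alpha> \<tau> #>\<^bsub>free_Abelian_group \<alpha>\<^esub> frag_of a"

lemma comm_group_pi_group: "\<tau> \<in> \<alpha> \<rightarrow> \<alpha> \<Longrightarrow> comm_group (pi_group \<alpha> \<tau>)"
proof -
  assume t: "\<tau> \<in> \<alpha> \<rightarrow> \<alpha>"
  interpret F: comm_group "free_Abelian_group \<alpha>" by (rule abelian_free_Abelian_group)
  have sub: "(\<lambda>a. frag_of a + frag_of (\<tau> a)) ` \<alpha> \<subseteq> carrier (free_Abelian_group \<alpha>)"
    using t keys_add by (fastforce simp: free_Abelian_group_def)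
  have "subgroup (pi_relations \<alpha> \<tau>) (free_Abelian_group \<alpha>)"
    unfolding pi_relations_def by (rule F.generate_is_subgroup[OF sub])
  then show ?thesis unfolding pi_group_def by (rule F.abelian_FactGroup)
qed

lemma pi_gen_closed: "a \<in> \<alpha> \<Longrightarrow> pi_gen \<alpha> \<tau> a \<in> carrier (pi_group \<alpha> \<tau>)"
  by (force simp: pi_gen_def pi_group_def FactGroup_def RCOSETS_def free_Abelian_group_def
      intro: exI[of _ "frag_of a"])

lemma pi_gen_inverse:
  assumes t: "\<tau> \<in> \<alpha> \<rightarrow> \<alpha>" and a: "a \<in> \<alpha>"
  shows "pi_gen \<alpha> \<tau> a \<otimes>\<^bsub>pi_group \<alpha> \<tau>\<^esub> pi_gen \<alpha> \<tau> (\<tau> a) = \<one>\<^bsub>pi_group \<alpha> \<tau>\<^esub>"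
proof -
  interpret F: comm_group "free_Abelian_group \<alpha>" by (rule abelian_free_Abelian_group)
  have sub: "(\<lambda>a. frag_of a + frag_of (\<tau> a)) ` \<alpha> \<subseteq> carrier (free_Abelian_group \<alpha>)"
    using t keys_add by (fastforce simp: free_Abelian_group_def)
  have sg: "subgroup (pi_relations \<alpha> \<tau>) (free_Abelian_group \<alpha>)"
    unfolding pi_relations_def by (rule F.generate_is_subgroup[OF sub])
  interpret N: normal "pi_relations \<alpha> \<tau>" "free_Abelian_group \<alpha>"
    using sg by (simp add: F.normal_iff_subgroup)
  have c: "frag_of a \<in> carrier (free_Abelian_group \<alpha>)" "frag_of (\<tau> a) \<in> carrier (free_Abelian_group \<alpha>)"
    using t a by (auto simp: free_Abelian_group_def)
  have mem: "frag_of a \<otimes>\<^bsub>free_Abelian_group \<alpha>\<^esub> frag_of (\<tau> a) \<in> pi_relations \<alpha> \<tau>"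
    using a unfolding pi_relations_def by (auto simp: free_Abelian_group_def intro: generate.incl)
  show ?thesis
    using N.rcos_sum[OF c] mem F.coset_join2[OF F.m_closed[OF c] sg mem] c
    by (simp add: pi_gen_def pi_group_def FactGroup_def)
qed

section \<open>Pairings and the genus\<close>

record ('a, 'c) pairing =
  elems :: "'c set"
  base :: "'c"
  label :: "'c \<Rightarrow> 'a"
  form :: "'c \<Rightarrow> 'c \<Rightarrow> ('a \<Rightarrow>\<^sub>0 int) set"

definition alpha_pairing :: "'a set \<Rightarrow> ('a \<Rightarrow> 'a) \<Rightarrow> ('a, 'c) pairing \<Rightarrow> bool" where
  "alpha_pairing \<alpha> \<tau> p \<longleftrightarrow>
     finite (elems p) \<and> base p \<in> elems p \<and>
     label p \<in> elems p - {base p} \<rightarrow> \<alpha> \<and>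
     (\<forall>A\<in>elems p. \<forall>B\<in>elems p. form p A B \<in> carrier (pi_group \<alpha> \<tau>))"

definition bilinear_form ::
  "'a set \<Rightarrow> ('a \<Rightarrow> 'a) \<Rightarrow> ('a, 'c) pairing \<Rightarrow> ('c \<Rightarrow>\<^sub>0 int) \<Rightarrow> ('c \<Rightarrow>\<^sub>0 int) \<Rightarrow> ('a \<Rightarrow>\<^sub>0 int) set"
  where
  "bilinear_form \<alpha> \<tau> p x y =
     (\<Otimes>\<^bsub>pi_group \<alpha> \<tau>\<^esub>A\<in>elems p. \<Otimes>\<^bsub>pi_group \<alpha> \<tau>\<^esub>B\<in>elems p.
        form p A B [^]\<^bsub>pi_group \<alpha> \<tau>\<^esub> (Poly_Mapping.lookup x A * Poly_Mapping.lookup y B))"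

definition short_vector :: "('a \<Rightarrow> 'a) \<Rightarrow> ('a, 'c) pairing \<Rightarrow> ('c \<Rightarrow>\<^sub>0 int) \<Rightarrow> bool" where
  "short_vector \<tau> p x \<longleftrightarrow>
     (\<exists>A \<in> elems p - {base p}. x = frag_of A) \<or>
     (\<exists>A \<in> elems p - {base p}. \<exists>B \<in> elems p - {base p}.
        A \<noteq> B \<and> label p A = label p B \<and> x = frag_of A + frag_of B) \<or>
     (\<exists>A \<in> elems p - {base p}. \<exists>B \<in> elems p - {base p}.
        A \<noteq> B \<and> label p A = \<tau> (label p B) \<and> x = frag_of A - frag_of B)"

definition filling :: "('a \<Rightarrow> 'a) \<Rightarrow> ('a, 'c) pairing \<Rightarrow> ('c \<Rightarrow>\<^sub>0 int) list \<Rightarrow> bool" where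
  "filling \<tau> p l \<longleftrightarrow>
     (\<exists>i<length l. l ! i = frag_of (base p) \<and>
        (\<forall>j<length l. j \<noteq> i \<longrightarrow> short_vector \<tau> p (l ! j))) \<and>
     (\<forall>A \<in> elems p - {base p}. \<exists>!i. i < length l \<and> Poly_Mapping.lookup (l ! i) A \<noteq> 0)"

definition filling_matrix ::
  "'a set \<Rightarrow> ('a \<Rightarrow> 'a) \<Rightarrow> (('a \<Rightarrow>\<^sub>0 int) set \<Rightarrow> int) \<Rightarrow> ('a, 'c) pairing \<Rightarrow>
   ('c \<Rightarrow>\<^sub>0 int) list \<Rightarrow> rat mat" where
  "filling_matrix \<alpha> \<tau> \<phi> p l =
     mat (length l) (length l) (\<lambda>(i, j). rat_of_int (\<phi> (bilinear_form \<alpha> \<tau> p (l ! i) (l ! j))))"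

text \<open>The infimum is attained, as it is taken over half-integers bounded below by 0, and for
  an \<open>\<alpha>\<close>-pairing there is always a filling, formed by the elements of \<open>S\<close>.\<close>

definition phi_genus ::
  "'a set \<Rightarrow> ('a \<Rightarrow> 'a) \<Rightarrow> (('a \<Rightarrow>\<^sub>0 int) set \<Rightarrow> int) \<Rightarrow> ('a, 'c) pairing \<Rightarrow> real" where
  "phi_genus \<alpha> \<tau> \<phi> p =
     (INF l \<in> {l. filling \<tau> p l}.
        1/2 * real (vec_space.rank (length l) (filling_matrix \<alpha> \<tau> \<phi> p l)))"

section \<open>The pairing of a nanoword\<close>

definition linking :: "('a, 'b) nanoword \<Rightarrow> 'b \<Rightarrow> 'b \<Rightarrow> int" where
  "linking w A B =
     (if subseq [A, B, A, B] (word w) then 1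
      else if subseq [B, A, B, A] (word w) then -1 else 0)"

definition letter_circ ::
  "'a set \<Rightarrow> ('a \<Rightarrow> 'a) \<Rightarrow> ('a, 'b) nanoword \<Rightarrow> 'b \<Rightarrow> 'b \<Rightarrow> ('a \<Rightarrow>\<^sub>0 int) set" where
  "letter_circ \<alpha> \<tau> w A B =
     (\<Otimes>\<^bsub>pi_group \<alpha> \<tau>\<^esub>D \<in> {D \<in> letters w.
           first_pos (word w) A < first_pos (word w) D \<and>
           first_pos (word w) D < last_pos (word w) A \<and>
           first_pos (word w) B < last_pos (word w) D \<and>
           last_pos (word w) D < last_pos (word w) B}.
        pi_gen \<alpha> \<tau> (proj w D))"

text \<open>The distinguished element \<open>s\<close> is \<open>None\<close>.\<close>

fun nanoword_form ::
  "'a set \<Rightarrow> ('a \<Rightarrow> 'a) \<Rightarrow> ('a, 'b) nanoword \<Rightarrow> 'b option \<Rightarrow> 'b option \<Rightarrow> ('a \<Rightarrow>\<^sub>0 int) set"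
  where
  "nanoword_form \<alpha> \<tau> w (Some A) (Some B) =
     (letter_circ \<alpha> \<tau> w A B \<otimes>\<^bsub>pi_group \<alpha> \<tau>\<^esub>
        inv\<^bsub>pi_group \<alpha> \<tau>\<^esub> letter_circ \<alpha> \<tau> w B A) [^]\<^bsub>pi_group \<alpha> \<tau>\<^esub> (2 :: int)
     \<otimes>\<^bsub>pi_group \<alpha> \<tau>\<^esub>
     (pi_gen \<alpha> \<tau> (proj w A) \<otimes>\<^bsub>pi_group \<alpha> \<tau>\<^esub> pi_gen \<alpha> \<tau> (proj w B))
        [^]\<^bsub>pi_group \<alpha> \<tau>\<^esub> linking w A B"
| "nanoword_form \<alpha> \<tau> w (Some A) None =
     (\<Otimes>\<^bsub>pi_group \<alpha> \<tau>\<^esub>D\<in>letters w.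
        pi_gen \<alpha> \<tau> (proj w D) [^]\<^bsub>pi_group \<alpha> \<tau>\<^esub> linking w A D)"
| "nanoword_form \<alpha> \<tau> w None (Some A) =
     inv\<^bsub>pi_group \<alpha> \<tau>\<^esub> (\<Otimes>\<^bsub>pi_group \<alpha> \<tau>\<^esub>D\<in>letters w.
        pi_gen \<alpha> \<tau> (proj w D) [^]\<^bsub>pi_group \<alpha> \<tau>\<^esub> linking w A D)"
| "nanoword_form \<alpha> \<tau> w None None = \<one>\<^bsub>pi_group \<alpha> \<tau>\<^esub>"

definition nanoword_pairing ::
  "'a set \<Rightarrow> ('a \<Rightarrow> 'a) \<Rightarrow> ('a, 'b) nanoword \<Rightarrow> ('a, 'b option) pairing" where
  "nanoword_pairing \<alpha> \<tau> w =
     \<lparr>elems = insert None (Some ` letters w), base = None,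
      label = (\<lambda>A. proj w (the A)), form = nanoword_form \<alpha> \<tau> w\<rparr>"

lemma alpha_pairing_nanoword_pairing:
  assumes t: "\<tau> \<in> \<alpha> \<rightarrow> \<alpha>" and w: "nanoword \<alpha> w"
  shows "alpha_pairing \<alpha> \<tau> (nanoword_pairing \<alpha> \<tau> w)"
proof -
  interpret P: comm_group "pi_group \<alpha> \<tau>" by (rule comm_group_pi_group[OF t])
  have "letters w \<subseteq> set (word w)"
  proof
    fix A assume "A \<in> letters w"
    then have "count_list (word w) A = 2" using w by (simp add: nanoword_def)
    then show "A \<in> set (word w)" using count_notin[of A "word w"] by force
  qed
  then have fin: "finite (letters w)" by (rule finite_subset) simp
  have g: "pi_gen \<alpha> \<tau> (proj w D) \<in> carrier (pi_group \<alpha> \<tau>)" if "D \<in> letters w" for D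
    using w that by (intro pi_gen_closed) (auto simp: nanoword_def)
  have c: "letter_circ \<alpha> \<tau> w A B \<in> carrier (pi_group \<alpha> \<tau>)" for A B
    unfolding letter_circ_def using g by (intro P.finprod_closed) auto
  have s: "(\<Otimes>\<^bsub>pi_group \<alpha> \<tau>\<^esub>D\<in>letters w. pi_gen \<alpha> \<tau> (proj w D) [^]\<^bsub>pi_group \<alpha> \<tau>\<^esub> linking w A D)
      \<in> carrier (pi_group \<alpha> \<tau>)" for A
    using g by (intro P.finprod_closed) auto
  show ?thesis
    using fin w g c s by (auto simp: alpha_pairing_def nanoword_pairing_def nanoword_def)
qed

end

theory Submission
  imports Defs
begin

text \<open>
  Place the arc of a letter $A$ on the positions of the word as the step function that is 1
  strictly between the two occurrences of $A$ and $1/2$ at them, and let $s$ be the constant $1/2$.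
  Then $\varphi e_w(A,B)$ is twice the value on these functions of a skew form in which every
  letter $D$ pairs its two positions with weight $\varphi(|D|)$.

  For a bridge, the symmetry of the factor is an anti-isometry of this form on the positions of the
  bridge, so the functions that live there and are symmetric form an isotropic subspace. Modulo
  that subspace and the span of two functions per arch, the short vectors $B$, $B \pm \iota(B)$
  attached to the bridge vanish and the arcs of the remaining letters are supported outside the
  bridge. Hence deleting the bridge changes the rank of the matrix of a filling by at most 4 for
  each arch, in both directions: to delete letters from a filling, one combines its vectors with
  those attached to the bridge so that the letters cancel.
\<close>

section \<open>Matrices of bounded rank\<close>

text \<open>No minimum over fillings is computed. What travels along a metamorphosis is the
  existence of a filling of rank at most \<open>R\<close>, written as a factorisation through
  \<open>R\<close> coordinates (\<open>rank_le\<close>), which needs no enumeration of rows. It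
  starts with rank 0 at the empty nanoword and runs backwards; since inverse moves occur, every move
  is treated in both directions.

  The constant 4 is 2 times 2: changing the vectors by combinations of g functions changes a
  bilinear form by rank at most 2g, and an arch supplies two functions. The difference of the
  indicators of its two blocks corrects functions that are constant on each block; the difference of
  the steps at its two blocks corrects jumps that are moved from a block to its mirror image. A
  block fixed by \<kappa> costs nothing. So the rank is at most 4 times the norm, and the genus,
  being half a rank, at most twice the norm.

  The first two homotopy moves are bridges without arches; only the third has a computation of its
  own. The value 1/2 of an arc at its ends yields the term n_w(A,B)(|A|+|B|) of the pairing and
  makes a centred step odd under reflection of a block.\<close>

definition rank_le :: "('i \<Rightarrow> 'i \<Rightarrow> rat) \<Rightarrow> 'i set \<Rightarrow> nat \<Rightarrow> bool" where
  "rank_le G I R \<longleftrightarrow> (\<exists>x y. \<forall>i\<in>I. \<forall>j\<in>I. G i j = (\<Sum>k<R. x k i * y k j))"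

lemma rank_leI_finite:
  assumes "finite K" "card K \<le> R"
    and "\<And>i j. i \<in> I \<Longrightarrow> j \<in> I \<Longrightarrow> G i j = (\<Sum>k\<in>K. x k i * y k j)"
  shows "rank_le G I R"
proof -
  obtain h where h: "bij_betw h {..<card K} K"
    using ex_bij_betw_nat_finite[OF assms(1)] by (auto simp: atLeast0LessThan)
  have "(\<Sum>k\<in>K. x k i * y k j) = (\<Sum>k<R. (if k < card K then x (h k) i else 0) * y (h k) j)" for i j
  proof -
    have "(\<Sum>k\<in>K. x k i * y k j) = (\<Sum>k<card K. x (h k) i * y (h k) j)"
      using sum.reindex_bij_betw[OF h, of "\<lambda>k. x k i * y k j"] by simp
    also have "\<dots> = (\<Sum>k<R. (if k < card K then x (h k) i else 0) * y (h k) j)"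
      using assms(2) by (intro sum.mono_neutral_cong_left) auto
    finally show ?thesis .
  qed
  then show ?thesis
    unfolding rank_le_def using assms(3)
    by (intro exI[of _ "\<lambda>k i. if k < card K then x (h k) i else 0"] exI[of _ "\<lambda>k. y (h k)"]) auto
qed

lemma rank_le_add:
  assumes "rank_le G I R" "rank_le H I S"
  shows "rank_le (\<lambda>i j. G i j + H i j) I (R + S)"
proof -
  obtain x y where xy: "\<And>i j. i \<in> I \<Longrightarrow> j \<in> I \<Longrightarrow> G i j = (\<Sum>k<R. x k i * y k j)"
    using assms(1) unfolding rank_le_def by blast
  obtain x' y' where xy': "\<And>i j. i \<in> I \<Longrightarrow> j \<in> I \<Longrightarrow> H i j = (\<Sum>k<S. x' k i * y' k j)"
    using assms(2) unfolding rank_le_def by blast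
  show ?thesis
  proof (rule rank_leI_finite[of "{..<R} <+> {..<S}" _ _ _ "case_sum x x'" "case_sum y y'"])
    fix i j assume "i \<in> I" "j \<in> I"
    then show "G i j + H i j = (\<Sum>k\<in>{..<R} <+> {..<S}. case_sum x x' k i * case_sum y y' k j)"
      by (simp add: xy xy' sum.Plus)
  qed (auto simp: card_Plus)
qed

lemma rank_le_cong:
  "rank_le G I R \<Longrightarrow> (\<And>i j. i \<in> I \<Longrightarrow> j \<in> I \<Longrightarrow> H i j = G i j) \<Longrightarrow> rank_le H I R"
  unfolding rank_le_def by auto

lemma rank_le_pullback:
  "rank_le G I R \<Longrightarrow> (\<And>j. j \<in> J \<Longrightarrow> f j \<in> I) \<Longrightarrow> rank_le (\<lambda>i j. G (f i) (f j)) J R"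
  unfolding rank_le_def by (elim exE, rule_tac x="\<lambda>k i. x k (f i)" in exI,
      rule_tac x="\<lambda>k i. y k (f i)" in exI) auto

text \<open>The new matrix is C G C^T, where C is the coefficient matrix \<open>c\<close>, and C can
  be absorbed into both factors of a factorisation of G.\<close>

lemma rank_le_lincomb:
  assumes "rank_le G I R"
    and "\<And>j j'. j \<in> J \<Longrightarrow> j' \<in> J \<Longrightarrow> H j j' = (\<Sum>i\<in>I. \<Sum>i'\<in>I. c j i * c j' i' * G i i')"
  shows "rank_le H J R"
proof -
  obtain x y where xy: "\<And>i j. i \<in> I \<Longrightarrow> j \<in> I \<Longrightarrow> G i j = (\<Sum>k<R. x k i * y k j)"
    using assms(1) unfolding rank_le_def by blast
  show ?thesis
  proof (rule rank_leI_finite[of "{..<R}" _ _ _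
        "\<lambda>k j. \<Sum>i\<in>I. c j i * x k i" "\<lambda>k j. \<Sum>i\<in>I. c j i * y k i"])
    fix j j' assume "j \<in> J" "j' \<in> J"
    then have "H j j' = (\<Sum>i\<in>I. \<Sum>i'\<in>I. \<Sum>k<R. (c j i * x k i) * (c j' i' * y k i'))"
      using assms(2) by (simp add: xy sum_distrib_left algebra_simps)
    also have "\<dots> = (\<Sum>k<R. \<Sum>i\<in>I. \<Sum>i'\<in>I. (c j i * x k i) * (c j' i' * y k i'))"
      by (rule trans[OF sum.cong[OF refl sum.swap] sum.swap])
    finally show "H j j' = (\<Sum>k<R. (\<Sum>i\<in>I. c j i * x k i) * (\<Sum>i\<in>I. c j' i * y k i))"
      by (simp add: sum_product)
  qed auto
qed

text \<open>Each function \<open>g k\<close> costs 2, once for its effect on the rows and once for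
  its effect on the columns. In the application the \<open>g k\<close> are the functions attached to
  the arches.\<close>

lemma rank_le_perturb:
  fixes b :: "('p \<Rightarrow> rat) \<Rightarrow> ('p \<Rightarrow> rat) \<Rightarrow> rat"
  assumes lin: "\<And>u v w. b (\<lambda>p. u p + v p) w = b u w + b v w" "\<And>u v w. b w (\<lambda>p. u p + v p) = b w u + b w v"
    "\<And>c u w. b (\<lambda>p. c * u p) w = c * b u w" "\<And>c u w. b w (\<lambda>p. c * u p) = c * b w u"
    and fin: "finite K"
    and G: "rank_le (\<lambda>i j. b (\<alpha> i) (\<alpha> j)) I R"
    and \<beta>: "\<And>i. i \<in> I \<Longrightarrow> \<beta> i = (\<lambda>p. \<alpha> i p + (\<Sum>k\<in>K. c k i * g k p))"
  shows "rank_le (\<lambda>i j. b (\<beta> i) (\<beta> j)) I (R + 2 * card K)"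
proof -
  have z: "b (\<lambda>p. 0) w = 0" "b w (\<lambda>p. 0) = 0" for w
    using lin(3)[of 0 "\<lambda>_. 0" w] lin(4)[of w 0 "\<lambda>_. 0"] by auto
  have s1: "b (\<lambda>p. \<Sum>k\<in>K. c k i * g k p) w = (\<Sum>k\<in>K. c k i * b (g k) w)" for i w
    using fin by (induction K rule: finite_induct) (auto simp: z lin)
  have s2: "b w (\<lambda>p. \<Sum>k\<in>K. c k i * g k p) = (\<Sum>k\<in>K. c k i * b w (g k))" for i w
    using fin by (induction K rule: finite_induct) (auto simp: z lin)
  \<comment> \<open>The last sum pairs \<open>g k\<close> with \<beta> i instead of \<alpha> i. This
    absorbs the terms quadratic in \<open>c\<close>, which would otherwise form a third
    summand.\<close>
  have e: "b (\<beta> i) (\<beta> j) = b (\<alpha> i) (\<alpha> j)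
      + (\<Sum>k\<in>K. c k i * b (g k) (\<alpha> j)) + (\<Sum>k\<in>K. b (\<beta> i) (g k) * c k j)"
    if "i \<in> I" "j \<in> I" for i j
  proof -
    have "b (\<beta> i) (\<beta> j) = b (\<beta> i) (\<alpha> j) + (\<Sum>k\<in>K. b (\<beta> i) (g k) * c k j)"
      using that by (subst \<beta>[of j]) (simp_all add: lin s2 mult.commute)
    also have "b (\<beta> i) (\<alpha> j) = b (\<alpha> i) (\<alpha> j) + (\<Sum>k\<in>K. c k i * b (g k) (\<alpha> j))"
      using that by (subst \<beta>[of i]) (simp_all add: lin s1)
    finally show ?thesis .
  qed
  have r: "rank_le (\<lambda>i j. \<Sum>k\<in>K. c k i * b (g k) (\<alpha> j)) I (card K)"
      "rank_le (\<lambda>i j. \<Sum>k\<in>K. b (\<beta> i) (g k) * c k j) I (card K)"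
    by (rule rank_leI_finite[OF fin order_refl], rule refl)+
  show ?thesis
    using rank_le_cong[OF rank_le_add[OF rank_le_add[OF G r(1)] r(2)] e] by (simp add: mult_2 add.assoc)
qed

text \<open>Connects factorisations with the rank of the library, by splitting off one matrix of
  rank at most 1 at a time.\<close>

lemma (in vec_space) rank_le_if_factorization:
  assumes "A = mat n m (\<lambda>(i, j). \<Sum>k<R. x k i * y k j)"
  shows "rank A \<le> R"
  using assms
proof (induction R arbitrary: A)
  case 0
  then have "A = 0\<^sub>m n m" by auto
  then show ?case using rank_0I by simp
next
  case (Suc R)
  define B where "B = mat n m (\<lambda>(i, j). \<Sum>k<R. x k i * y k j)"
  define C where "C = mat n m (\<lambda>(i, j). x R i * y R j)"
  have "A = B + C" unfolding Suc.prems B_def C_def by auto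
  then have "rank A \<le> rank B + rank C" 
    using rank_subadditive[of B m C] by (auto simp: B_def C_def)
  moreover have "rank B \<le> R" by (rule Suc.IH[OF B_def])
  moreover have "rank C \<le> 1" by (rule rank_le_1_product_entries[of C m "x R" "y R"]) (auto simp: C_def)
  ultimately show ?case by simp
qed

section \<open>Elimination of letters from fillings\<close>

text \<open>Integer coefficients suffice, because the elimination of letters multiplies vectors by 1
  and -1 only.\<close>

definition zspan :: "('c \<Rightarrow>\<^sub>0 int) set \<Rightarrow> ('c \<Rightarrow>\<^sub>0 int) set" where
  "zspan F = range (\<lambda>c. \<Sum>x\<in>F. frag_cmul (c x) x)"

lemma zspan_base:
  assumes "finite F" "x \<in> F"
  shows "x \<in> zspan F"
proof -
  have "(\<Sum>y\<in>F. frag_cmul (if y = x then 1 else 0) y) = (\<Sum>y\<in>F. if y = x then y else 0)"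
    by (rule sum.cong) auto
  also have "\<dots> = x" using assms by simp
  finally show ?thesis unfolding zspan_def
    by (intro image_eqI[of _ _ "\<lambda>y. if y = x then 1 else 0"]) auto
qed

lemma zspan_0: "0 \<in> zspan F"
  unfolding zspan_def by (intro image_eqI[of _ _ "\<lambda>_. 0"]) auto

lemma zspan_add:
  assumes "x \<in> zspan F" "y \<in> zspan F"
  shows "x + y \<in> zspan F"
proof -
  obtain c d where "x = (\<Sum>x\<in>F. frag_cmul (c x) x)" "y = (\<Sum>x\<in>F. frag_cmul (d x) x)"
    using assms by (auto simp: zspan_def)
  then have "x + y = (\<Sum>x\<in>F. frag_cmul (c x + d x) x)"
    by (simp add: frag_cmul_distrib sum.distrib)
  then show ?thesis unfolding zspan_def by (intro image_eqI[of _ _ "\<lambda>x. c x + d x"]) auto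
qed

lemma zspan_cmul:
  assumes "x \<in> zspan F"
  shows "frag_cmul k x \<in> zspan F"
proof -
  obtain c where "x = (\<Sum>x\<in>F. frag_cmul (c x) x)" using assms by (auto simp: zspan_def)
  then have "frag_cmul k x = (\<Sum>x\<in>F. frag_cmul (k * c x) x)" by (simp add: frag_cmul_sum)
  then show ?thesis unfolding zspan_def by (intro image_eqI[of _ _ "\<lambda>x. k * c x"]) auto
qed

lemma zspan_minus: "x \<in> zspan F \<Longrightarrow> - x \<in> zspan F"
  using zspan_cmul[of x F "-1"] by simp

lemma zspan_diff: "x \<in> zspan F \<Longrightarrow> y \<in> zspan F \<Longrightarrow> x - y \<in> zspan F"
  using zspan_add[OF _ zspan_minus, of x F y] by simp

lemma zspan_induct [consumes 1, case_names zero add]: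
  assumes "x \<in> zspan F" "P 0"
    and "\<And>k x y. P x \<Longrightarrow> y \<in> F \<Longrightarrow> P (x + frag_cmul k y)"
  shows "P x"
proof (cases "finite F")
  case True
  obtain c where c: "x = (\<Sum>x\<in>F. frag_cmul (c x) x)" using assms(1) by (auto simp: zspan_def)
  have "P (\<Sum>x\<in>G. frag_cmul (c x) x)" if "finite G" "G \<subseteq> F" for G
    using that
  proof (induction G rule: finite_induct)
    case (insert y G)
    then show ?case using assms(3)[of "\<Sum>x\<in>G. frag_cmul (c x) x" y "c y"] by (simp add: add.commute)
  qed (simp add: assms(2))
  then show ?thesis using c True by blast
\<comment> \<open>For infinite \<open>F\<close> the sums are 0 by convention, so \<open>x\<close> is
  0.\<close>
qed (use assms in \<open>auto simp: zspan_def\<close>)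

lemma zspan_subset:
  assumes "finite G" "F \<subseteq> zspan G" "x \<in> zspan F"
  shows "x \<in> zspan G"
  using assms(3) by (induction rule: zspan_induct) (use assms(2) zspan_0 zspan_add zspan_cmul in blast)+

text \<open>Serves to split a vector obtained by elimination into a part from the old filling and a
  part from the vectors attached to the bridge.\<close>

lemma zspan_Un:
  assumes "x \<in> zspan (F \<union> M)" "finite F" "finite M"
  obtains l m where "l \<in> zspan F" "m \<in> zspan M" "x = l + m"
proof -
  have "\<exists>l\<in>zspan F. \<exists>m\<in>zspan M. x = l + m"
    using assms(1)
  proof (induction rule: zspan_induct)
    case zero
    show ?case by (rule bexI[of _ 0], rule bexI[of _ 0]) (simp_all add: zspan_0)
  next
    case (add k x y)
    then obtain l m where lm: "l \<in> zspan F" "m \<in> zspan M" "x = l + m" by blast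
    consider "y \<in> F" | "y \<in> M" using add by blast
    then show ?case
    proof cases
      case 1
      then show ?thesis using lm assms zspan_add[OF lm(1) zspan_cmul[OF zspan_base[OF assms(2) 1], of k]]
        by (intro bexI[of _ "l + frag_cmul k y"] bexI[of _ m]) auto
    next
      case 2
      then show ?thesis using lm assms zspan_add[OF lm(2) zspan_cmul[OF zspan_base[OF assms(3) 2], of k]]
        by (intro bexI[of _ "l"] bexI[of _ "m + frag_cmul k y"]) auto
    qed
  qed
  then show ?thesis using that by blast
qed

lemma rank_le_zspan:
  fixes \<Phi> :: "('c \<Rightarrow>\<^sub>0 int) \<Rightarrow> ('c \<Rightarrow>\<^sub>0 int) \<Rightarrow> rat"
  assumes add: "\<And>x y z. \<Phi> (x + y) z = \<Phi> x z + \<Phi> y z" "\<And>x y z. \<Phi> z (x + y) = \<Phi> z x + \<Phi> z y"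
    and cmul: "\<And>k x y. \<Phi> (frag_cmul k x) y = of_int k * \<Phi> x y" "\<And>k x y. \<Phi> y (frag_cmul k x) = of_int k * \<Phi> y x"
    and F: "finite F" and G: "G \<subseteq> zspan F" and R: "rank_le \<Phi> F R"
  shows "rank_le \<Phi> G R"
proof -
  obtain c where c: "\<And>x. x \<in> G \<Longrightarrow> x = (\<Sum>y\<in>F. frag_cmul (c x y) y)"
  proof -
    have "\<forall>x\<in>G. \<exists>c. x = (\<Sum>y\<in>F. frag_cmul (c y) y)" using G by (auto simp: zspan_def)
    from bchoice[OF this] show thesis using that by blast
  qed
  have z: "\<Phi> 0 y = 0" "\<Phi> y 0 = 0" for y using cmul(1)[of 0 0 y] cmul(2)[of y 0 0] by auto
  have s1: "\<Phi> (\<Sum>y\<in>H. g y) x = (\<Sum>y\<in>H. \<Phi> (g y) x)" if "finite H" for g x and H :: "('c \<Rightarrow>\<^sub>0 int) set"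
    using that by (induction H rule: finite_induct) (auto simp: z add)
  have s2: "\<Phi> x (\<Sum>y\<in>H. g y) = (\<Sum>y\<in>H. \<Phi> x (g y))" if "finite H" for g x and H :: "('c \<Rightarrow>\<^sub>0 int) set"
    using that by (induction H rule: finite_induct) (auto simp: z add)
  show ?thesis
  proof (rule rank_le_lincomb[OF R])
    fix x x' assume x: "x \<in> G" "x' \<in> G"
    have "\<Phi> x x' = \<Phi> (\<Sum>y\<in>F. frag_cmul (c x y) y) (\<Sum>y\<in>F. frag_cmul (c x' y) y)"
      by (rule arg_cong2[where f = \<Phi>, OF c[OF x(1)] c[OF x(2)]])
    also have "\<dots> = (\<Sum>y\<in>F. \<Sum>y'\<in>F. \<Phi> (frag_cmul (c x y) y) (frag_cmul (c x' y') y'))"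
      by (subst s1[OF F], subst s2[OF F]) (rule refl)
    finally have "\<Phi> x x' = (\<Sum>y\<in>F. \<Sum>y'\<in>F. \<Phi> (frag_cmul (c x y) y) (frag_cmul (c x' y') y'))" .
    then show "\<Phi> x x' = (\<Sum>y\<in>F. \<Sum>y'\<in>F. of_int (c x y) * of_int (c x' y') * \<Phi> y y')"
      by (simp add: cmul ac_simps)
  qed
qed

text \<open>Joins the two kinds of short vectors with two letters: A + c B is short exactly if the
  labels of A and B are related with sign c. As a relation it can be reversed and composed, which is
  what the elimination of letters rests on.\<close>

definition tau_rel :: "('a \<Rightarrow> 'a) \<Rightarrow> int \<Rightarrow> 'a \<Rightarrow> 'a \<Rightarrow> bool" where
  "tau_rel \<tau> c a b \<longleftrightarrow> c = 1 \<and> a = b \<or> c = - 1 \<and> a = \<tau> b"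

definition short :: "('a \<Rightarrow> 'a) \<Rightarrow> ('c \<Rightarrow> 'a) \<Rightarrow> ('c \<Rightarrow>\<^sub>0 int) \<Rightarrow> bool" where
  "short \<tau> lab x \<longleftrightarrow> (\<exists>A. x = frag_of A) \<or>
     (\<exists>A B c. A \<noteq> B \<and> tau_rel \<tau> c (lab A) (lab B) \<and> x = frag_of A + frag_cmul c (frag_of B))"

text \<open>The members of a filling other than \<open>s\<close>. Disjoint supports express that
  every letter occurs in exactly one vector, and the union of the supports confines the letters to
  \<open>U\<close>, on which \<open>short\<close> imposes nothing. \<open>U\<close> is a parameter
  because it shrinks during the elimination.\<close>

definition partial_filling ::
  "('a \<Rightarrow> 'a) \<Rightarrow> ('c \<Rightarrow> 'a) \<Rightarrow> 'c set \<Rightarrow> ('c \<Rightarrow>\<^sub>0 int) set \<Rightarrow> bool" where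
  "partial_filling \<tau> lab U F \<longleftrightarrow> finite F \<and> (\<forall>x\<in>F. short \<tau> lab x) \<and>
     \<Union> (Poly_Mapping.keys ` F) = U \<and> disjoint_family_on Poly_Mapping.keys F"

lemma keys_frag_pair:
  "A \<noteq> B \<Longrightarrow> c \<noteq> 0 \<Longrightarrow> Poly_Mapping.keys (frag_of A + frag_cmul c (frag_of B)) = {A, B}"
  by (auto simp: in_keys_iff lookup_add split: if_splits)

lemma tau_rel_nonzero: "tau_rel \<tau> c a b \<Longrightarrow> c \<noteq> 0"
  by (auto simp: tau_rel_def)

lemma short_nonzero:
  assumes "short \<tau> lab x"
  shows "x \<noteq> 0"
  using assms unfolding short_def
proof (elim disjE exE conjE)
  fix A B c assume *: "A \<noteq> B" "tau_rel \<tau> c (lab A) (lab B)" "x = frag_of A + frag_cmul c (frag_of B)"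
  have "Poly_Mapping.keys x = {A, B}" using keys_frag_pair[OF *(1) tau_rel_nonzero[OF *(2)]] *(3) by simp
  then show "x \<noteq> 0" by auto
qed simp

text \<open>\<open>X\<close> consists of the vectors that meet the letters \<open>T\<close> to be
  removed, \<open>N\<close> of their replacement. As a set with at most one element,
  \<open>N\<close> covers both a new short vector and the case that no letter is left over.\<close>

lemma partial_filling_replace:
  assumes F: "partial_filling \<tau> lab U F" and X: "X \<subseteq> F" "T \<subseteq> \<Union> (Poly_Mapping.keys ` X)"
    and N: "\<And>x. x \<in> N \<Longrightarrow> short \<tau> lab x" "\<And>x y. x \<in> N \<Longrightarrow> y \<in> N \<Longrightarrow> x = y"
    and NX: "\<Union> (Poly_Mapping.keys ` N) = \<Union> (Poly_Mapping.keys ` X) - T"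
  shows "partial_filling \<tau> lab (U - T) (F - X \<union> N)"
proof -
  have fN: "finite N"
  proof (cases "N = {}")
    case False
    then obtain x where "x \<in> N" by blast
    then have "N = {x}" using N(2) by blast
    then show ?thesis by simp
  qed simp
  have dis: "Poly_Mapping.keys x \<inter> Poly_Mapping.keys y = {}" if "x \<in> F - X" "y \<in> X" for x y
  proof -
    have "x \<in> F" "y \<in> F" "x \<noteq> y" using X(1) that by auto
    then show ?thesis using F by (simp add: partial_filling_def disjoint_family_on_def)
  qed
  have disN: "Poly_Mapping.keys x \<inter> Poly_Mapping.keys y = {}" if "x \<in> F - X" "y \<in> N" for x y
  proof -
    have "Poly_Mapping.keys y \<subseteq> \<Union> (Poly_Mapping.keys ` X)" using NX that by blast
    then show ?thesis using dis that by fast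
  qed
  have U: "\<Union> (Poly_Mapping.keys ` F) = U" using F by (simp add: partial_filling_def)
  have "\<Union> (Poly_Mapping.keys ` (F - X \<union> N)) = U - T"
  proof -
    have "\<Union> (Poly_Mapping.keys ` (F - X)) \<inter> T = {}" using dis X(2) by fast
    moreover have "\<Union> (Poly_Mapping.keys ` F) = \<Union> (Poly_Mapping.keys ` (F - X)) \<union> \<Union> (Poly_Mapping.keys ` X)"
      using X(1) by blast
    ultimately show ?thesis using U NX by (auto simp: image_Un)
  qed
  moreover have "disjoint_family_on Poly_Mapping.keys (F - X \<union> N)"
    using disN N(2) F unfolding disjoint_family_on_def partial_filling_def by blast
  ultimately show ?thesis using F N(1) fN by (auto simp: partial_filling_def)
qed

locale labelled_set =
  fixes \<alpha> :: "'a set" and \<tau> :: "'a \<Rightarrow> 'a" and lab :: "'c \<Rightarrow> 'a" and U :: "'c set"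
  assumes inv: "\<And>a. a \<in> \<alpha> \<Longrightarrow> \<tau> (\<tau> a) = a" and lab: "\<And>A. A \<in> U \<Longrightarrow> lab A \<in> \<alpha>"
begin

lemma tau_rel_sym:
  assumes "B \<in> U" "tau_rel \<tau> c (lab A) (lab B)"
  shows "tau_rel \<tau> c (lab B) (lab A)"
  using assms(2) inv[OF lab[OF assms(1)]] unfolding tau_rel_def by (elim disjE conjE) simp_all

text \<open>Signs multiply because two applications of \<tau> cancel on a label.\<close>

lemma tau_rel_trans:
  assumes "C \<in> U" "tau_rel \<tau> c (lab A) (lab B)" "tau_rel \<tau> d (lab B) (lab C)"
  shows "tau_rel \<tau> (c * d) (lab A) (lab C)"
  using assms(2,3) inv[OF lab[OF assms(1)]] unfolding tau_rel_def by (elim disjE conjE) simp_all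

text \<open>A normal form with coefficient 1 at the prescribed letter \<open>B\<close>. The sign
  \<open>e\<close> is needed when \<open>B\<close> is the second letter of the vector and carries
  the coefficient -1.\<close>

lemma short_cases:
  assumes "short \<tau> lab x" "B \<in> Poly_Mapping.keys x" "Poly_Mapping.keys x \<subseteq> U"
  obtains "x = frag_of B"
  | A c e where "A \<in> U" "A \<noteq> B" "Poly_Mapping.keys x = {A, B}" "c \<in> {1, - 1}" "e \<in> {1, - 1}" "tau_rel \<tau> c (lab B) (lab A)"
      "frag_cmul e x = frag_of B + frag_cmul c (frag_of A)"
  using assms(1) unfolding short_def
proof (elim disjE exE conjE)
  fix A assume "x = frag_of A"
  then show thesis using that(1) assms(2) by simp
next
  fix A A' c assume *: "A \<noteq> A'" "tau_rel \<tau> c (lab A) (lab A')" "x = frag_of A + frag_cmul c (frag_of A')"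
  have k: "Poly_Mapping.keys x = {A, A'}" using * keys_frag_pair tau_rel_nonzero by metis
  have c: "c \<in> {1, - 1}" using *(2) by (auto simp: tau_rel_def)
  consider "B = A" | "B = A'" using k assms(2) by blast
  then show thesis
  proof cases
    case 1
    then show ?thesis using * k c assms(3) by (intro that(2)[of A' c 1]) auto
  next
    case 2
    then show ?thesis using * k c assms(3) tau_rel_sym[of A' c A]
      by (intro that(2)[of A c c]) (auto simp: frag_cmul_distrib2)
  qed
qed

text \<open>At most two vectors of \<open>F\<close> meet the support of \<mu>. Combined with \<mu>
  they lose the letters of \<mu> and keep at most two others; composing the label relations through
  \<mu> shows that the remainder is again short.\<close>

lemma eliminate_short:
  assumes F: "partial_filling \<tau> lab U F" and \<mu>: "short \<tau> lab \<mu>" "Poly_Mapping.keys \<mu> \<subseteq> U"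
  obtains F' where "partial_filling \<tau> lab (U - Poly_Mapping.keys \<mu>) F'" "F' \<subseteq> zspan (insert \<mu> F)"
proof -
  let ?S = "zspan (insert \<mu> F)" and ?T = "Poly_Mapping.keys \<mu>"
  have fin: "finite (insert \<mu> F)" using F by (simp add: partial_filling_def)
  have S: "\<mu> \<in> ?S" "F \<subseteq> ?S" using zspan_base[OF fin] by auto
  note filled = that
  have key: thesis if "X \<subseteq> F" "?T \<subseteq> \<Union> (Poly_Mapping.keys ` X)"
     "\<And>x. x \<in> N \<Longrightarrow> short \<tau> lab x" "\<And>x y. x \<in> N \<Longrightarrow> y \<in> N \<Longrightarrow> x = y" 
     "\<Union> (Poly_Mapping.keys ` N) = \<Union> (Poly_Mapping.keys ` X) - ?T" "N \<subseteq> ?S" for X N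
  proof (rule filled)
    show "partial_filling \<tau> lab (U - ?T) (F - X \<union> N)"
      by (rule partial_filling_replace[OF F that(1,2) that(3) that(4) that(5)])
    show "F - X \<union> N \<subseteq> ?S" using that(6) S(2) by blast
  qed
  have find: "\<exists>x\<in>F. B \<in> Poly_Mapping.keys x" if "B \<in> U" for B
    using F that by (auto simp: partial_filling_def)
  have kU: "Poly_Mapping.keys x \<subseteq> U" "short \<tau> lab x" if "x \<in> F" for x
    using F that by (auto simp: partial_filling_def)
  obtain B where B: "B \<in> ?T" using short_nonzero[OF \<mu>(1)] keys_eq_empty by blast
  obtain x where x: "x \<in> F" "B \<in> Poly_Mapping.keys x" using find B \<mu>(2) by blast
  show thesis
  proof (cases rule: short_cases[OF \<mu>(1) B \<mu>(2)])
    case 1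
    show thesis
    proof (cases rule: short_cases[OF kU(2)[OF x(1)] x(2) kU(1)[OF x(1)]])
      case x1: 1
      show thesis by (rule key[of "{x}" "{}"]) (use x x1 1 in auto)
    next
      case (2 A c e)
      have "frag_of A = frag_cmul c (frag_cmul e x - \<mu>)"
        using 2 1 by auto
      then have "frag_of A \<in> ?S" using x(1) S by (auto intro!: zspan_cmul zspan_diff)
      then show thesis by (intro key[of "{x}" "{frag_of A}"]) (use x 1 2 in \<open>auto simp: short_def\<close>)
    qed
  next
    case (2 B' \<delta> \<epsilon>)
    obtain x' where x': "x' \<in> F" "B' \<in> Poly_Mapping.keys x'" using find 2 by blast
    have BU: "B \<in> U" using B \<mu> by blast
    define \<mu>' where "\<mu>' = frag_cmul \<epsilon> \<mu>"
    have \<mu>': "\<mu>' \<in> ?S" unfolding \<mu>'_def using S by (intro zspan_cmul)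
    have \<mu>'e: "\<mu>' = frag_of B + frag_cmul \<delta> (frag_of B')" using 2 by (simp add: \<mu>'_def)
    have xS: "x \<in> ?S" "x' \<in> ?S" using x x' S by auto
    show thesis
    proof (cases "x = x'")
      case True
      \<comment> \<open>Here \<open>x\<close> has the same two letters as \<mu>, possibly with
        another relative sign, and is simply dropped.\<close>
      have "Poly_Mapping.keys x = {B, B'}"
        by (rule short_cases[OF kU(2)[OF x(1)] x(2) kU(1)[OF x(1)]]) (use True x' 2 in auto)
      then show thesis by (intro key[of "{x}" "{}"]) (use x 2 in auto)
    next
      case False
      have dis: "Poly_Mapping.keys x \<inter> Poly_Mapping.keys x' = {}"
        using F x(1) x'(1) False by (auto simp: partial_filling_def disjoint_family_on_def)
      show thesis
      proof (cases rule: short_cases[OF kU(2)[OF x(1)] x(2) kU(1)[OF x(1)]])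
        case x1: 1
        show thesis
        proof (cases rule: short_cases[OF kU(2)[OF x'(1)] x'(2) kU(1)[OF x'(1)]])
          case 1
          show thesis by (rule key[of "{x, x'}" "{}"]) (use x x' x1 1 2 in auto)
        next
          case x2: (2 A c e)
          have "frag_of A = frag_cmul c (frag_cmul e x' - frag_cmul \<delta> (\<mu>' - x))"
            using x2 x1 2 \<mu>'e by auto
          then have "frag_of A \<in> ?S" using xS \<mu>' by (auto intro!: zspan_cmul zspan_diff)
          then show thesis by (intro key[of "{x, x'}" "{frag_of A}"]) (use x x' x1 2 x2 dis in \<open>auto simp: short_def\<close>)
        qed
      next
        case x1: (2 A c e)
        show thesis
        proof (cases rule: short_cases[OF kU(2)[OF x'(1)] x'(2) kU(1)[OF x'(1)]])
          case 1
          have "frag_of A = frag_cmul c (frag_cmul e x - (\<mu>' - frag_cmul \<delta> x'))"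
            using x1 1 2 \<mu>'e by auto
          then have "frag_of A \<in> ?S" using xS \<mu>' by (auto intro!: zspan_cmul zspan_diff)
          then show thesis by (intro key[of "{x, x'}" "{frag_of A}"]) (use x x' x1 1 2 dis in \<open>auto simp: short_def\<close>)
        next
          case x2: (2 A' c' e')
          have AA: "A \<noteq> A'" using dis x1 x2 by auto
          define y where "y = frag_of A + frag_cmul (c * \<delta> * c') (frag_of A')"
          have cc: "c * \<delta> * c' \<noteq> 0" using x1 x2 2 by auto
          \<comment> \<open>The relations are composed along the chain A, B, B', A'; the product of
            the three signs is the coefficient of A' in \<open>y\<close>.\<close>
          have "tau_rel \<tau> (c * \<delta> * c') (lab A) (lab A')"
            using tau_rel_trans[of A' "c * \<delta>" A B' c'] tau_rel_trans[of B' c A B \<delta>]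
              tau_rel_sym[of A c B] x1 x2 2 BU by blast
          then have sy: "short \<tau> lab y" using AA unfolding short_def y_def by blast
          have "y = frag_cmul c (frag_cmul e x - \<mu>' + frag_cmul \<delta> (frag_cmul e' x'))"
            unfolding y_def x1(7) x2(7) \<mu>'e
            using x1(4) x2(4) 2(4)
            by (auto simp: algebra_simps frag_cmul_distrib2)
          then have yS: "y \<in> ?S"
            using xS \<mu>' by (auto intro!: zspan_cmul zspan_diff zspan_add)
          have ky: "Poly_Mapping.keys y = {A, A'}" unfolding y_def by (rule keys_frag_pair[OF AA cc])
          have "{A, B} \<inter> {A', B'} = {}" using dis x1 x2 by auto
          then show thesis by (intro key[of "{x, x'}" "{y}"]) (use x x' x1 x2 2 sy yS ky in \<open>auto\<close>)
        qed
      qed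
    qed
  qed
qed

end

lemma labelled_set_mono: "labelled_set \<alpha> \<tau> lab U \<Longrightarrow> V \<subseteq> U \<Longrightarrow> labelled_set \<alpha> \<tau> lab V"
  unfolding labelled_set_def by blast

text \<open>The vectors of \<open>M\<close> are used one at a time. Disjointness of their supports
  ensures that the letters of the next vector have not been removed yet.\<close>

lemma eliminate_filling:
  assumes "labelled_set \<alpha> \<tau> lab U" and F: "partial_filling \<tau> lab U F"
    and M: "partial_filling \<tau> lab V M" and "V \<subseteq> U"
  obtains F' where "partial_filling \<tau> lab (U - V) F'" "F' \<subseteq> zspan (F \<union> M)"
proof -
  have "finite M" using M by (simp add: partial_filling_def)
  then have "\<exists>F'. partial_filling \<tau> lab (U - V) F' \<and> F' \<subseteq> zspan (F \<union> M)"
    using M \<open>V \<subseteq> U\<close>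
  proof (induction M arbitrary: V rule: finite_induct)
    case empty
    then show ?case using F zspan_base[of F] by (auto simp: partial_filling_def)
  next
    case (insert \<mu> M)
    let ?V = "\<Union> (Poly_Mapping.keys ` M)"
    have V: "V = Poly_Mapping.keys \<mu> \<union> ?V" "Poly_Mapping.keys \<mu> \<inter> ?V = {}"
      using insert.prems(1) insert.hyps by (fastforce simp: partial_filling_def disjoint_family_on_def)+
    have "partial_filling \<tau> lab ?V M"
      using insert.prems(1) by (auto simp: partial_filling_def disjoint_family_on_def)
    then obtain F' where F': "partial_filling \<tau> lab (U - ?V) F'" "F' \<subseteq> zspan (F \<union> M)"
      using insert.IH[of ?V] V(1) insert.prems(2) by auto
    have "labelled_set \<alpha> \<tau> lab (U - ?V)" by (rule labelled_set_mono[OF assms(1)]) auto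
    moreover have "short \<tau> lab \<mu>" using insert.prems by (auto simp: partial_filling_def)
    moreover have "Poly_Mapping.keys \<mu> \<subseteq> U - ?V" using V insert.prems(2) by blast
    ultimately obtain F'' where F'': "partial_filling \<tau> lab (U - ?V - Poly_Mapping.keys \<mu>) F''"
        "F'' \<subseteq> zspan (insert \<mu> F')"
      using labelled_set.eliminate_short[OF _ F'(1)] by metis
    have fin: "finite (F \<union> insert \<mu> M)" using F insert.hyps by (auto simp: partial_filling_def)
    have "F' \<subseteq> zspan (F \<union> insert \<mu> M)"
      using F'(2) zspan_subset[OF fin, of "F \<union> M"] zspan_base[OF fin] by blast
    then have "F'' \<subseteq> zspan (F \<union> insert \<mu> M)"
      using F''(2) zspan_subset[OF fin, of "insert \<mu> F'"] zspan_base[OF fin] by blast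
    moreover have "U - ?V - Poly_Mapping.keys \<mu> = U - V" using V by blast
    ultimately show ?case using F''(1) by auto
  qed
  then show ?thesis using that by blast
qed

section \<open>The pairing of a nanoword as a crossing form\<close>

lemma positions_eq:
  assumes "count_list u A = 2"
  shows "positions u A = {first_pos u A, last_pos u A}" "first_pos u A < last_pos u A"
proof -
  have fin: "finite (positions u A)" by (simp add: positions_def)
  have "positions u A = {i. i < length u \<and> A = u ! i}" by (auto simp: positions_def)
  then have "card (positions u A) = 2"
    using assms by (simp add: count_list_eq_length_filter length_filter_conv_card)
  then obtain p q where "positions u A = {p, q}" "p \<noteq> q"
    by (auto simp: card_2_iff)
  then obtain p q where pq: "positions u A = {p, q}" "p < q"
    using that[of p q] that[of q p] by (metis insert_commute linorder_neqE_nat)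
  then show "positions u A = {first_pos u A, last_pos u A}" "first_pos u A < last_pos u A"
    by (auto simp: first_pos_def last_pos_def)
qed

lemma
  assumes "count_list u A = 2"
  shows nth_first_pos: "u ! first_pos u A = A" and nth_last_pos: "u ! last_pos u A = A"
    and last_pos_less: "last_pos u A < length u"
  using positions_eq[OF assms] unfolding positions_def by blast+

lemma position_cases:
  assumes "count_list u A = 2" "p < length u" "u ! p = A"
  shows "p = first_pos u A \<or> p = last_pos u A"
  using positions_eq[OF assms(1)] assms(2,3) unfolding positions_def by blast

lemma first_last_posI:
  assumes "count_list u A = 2" "p < q" "q < length u" "u ! p = A" "u ! q = A"
  shows "first_pos u A = p" "last_pos u A = q"
  using position_cases[OF assms(1), of p] position_cases[OF assms(1), of q] assms
    positions_eq(2)[OF assms(1)] by auto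

text \<open>Iterated, this turns a pattern such as ABAB into a chain of increasing positions, which
  can be compared with \<open>first_pos\<close> and \<open>last_pos\<close>.\<close>

lemma subseq_Cons_drop:
  "subseq (x # xs) (drop m u) \<longleftrightarrow> (\<exists>p\<ge>m. p < length u \<and> u ! p = x \<and> subseq xs (drop (Suc p) u))"
proof
  assume "subseq (x # xs) (drop m u)"
  from list_emb_ConsD[OF this] obtain us vs where *: "drop m u = us @ x # vs" "subseq xs vs" by auto
  have "m \<le> length u" using *(1) by (cases "m \<le> length u") auto
  then have u: "u = take m u @ us @ x # vs" "length (take m u) = m" using *(1) append_take_drop_id[of m u] by auto
  then have "u ! (m + length us) = x" by (metis nth_append_length_plus nth_append_length)
  moreover have "drop (Suc (m + length us)) u = vs" 
    using \<open>m \<le> length u\<close> by (subst u(1)) (simp add: min_def)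
  moreover have "m + length us < length u" 
    using \<open>m \<le> length u\<close> by (subst u(1)) (simp add: min_def)
  ultimately show "\<exists>p\<ge>m. p < length u \<and> u ! p = x \<and> subseq xs (drop (Suc p) u)"
    using *(2) by (intro exI[of _ "m + length us"]) auto
next
  assume "\<exists>p\<ge>m. p < length u \<and> u ! p = x \<and> subseq xs (drop (Suc p) u)"
  then obtain p where p: "m \<le> p" "p < length u" "u ! p = x" "subseq xs (drop (Suc p) u)" by blast
  have *: "drop m u = take (p - m) (drop m u) @ drop p u"
    using p(1) append_take_drop_id[of "p - m" "drop m u"] by (simp del: append_take_drop_id)
  have "drop p u = x # drop (Suc p) u"
    using Cons_nth_drop_Suc[OF p(2)] p(3) by simp
  then have "drop m u = take (p - m) (drop m u) @ x # drop (Suc p) u"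
    using * by simp
  then show "subseq (x # xs) (drop m u)"
    using p(4) by (metis list_emb_append2 subseq_Cons2)
qed

text \<open>Both letters occur exactly twice, so the four positions of the pattern are forced to be
  their first and last occurrences.\<close>

lemma subseq_alternating_iff:
  assumes "count_list u A = 2" "count_list u B = 2"
  shows "subseq [A, B, A, B] u \<longleftrightarrow>
    first_pos u A < first_pos u B \<and> first_pos u B < last_pos u A \<and> last_pos u A < last_pos u B"
    (is "_ \<longleftrightarrow> ?R")
proof -
  have "subseq [A, B, A, B] u \<longleftrightarrow>
      (\<exists>p. p < length u \<and> u ! p = A \<and> (\<exists>q>p. q < length u \<and> u ! q = B \<and>
        (\<exists>r>q. r < length u \<and> u ! r = A \<and> (\<exists>s>r. s < length u \<and> u ! s = B))))"
    using subseq_Cons_drop[of A "[B, A, B]" 0 u] by (simp add: subseq_Cons_drop Suc_le_eq)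
  also have "\<dots> \<longleftrightarrow> ?R"
  proof
    assume "\<exists>p. p < length u \<and> u ! p = A \<and> (\<exists>q>p. q < length u \<and> u ! q = B \<and>
        (\<exists>r>q. r < length u \<and> u ! r = A \<and> (\<exists>s>r. s < length u \<and> u ! s = B)))"
    then obtain p q r s where *: "p < q" "q < r" "r < s" "s < length u" "u ! p = A" "u ! q = B" "u ! r = A" "u ! s = B"
      by blast
    have "first_pos u A = p \<and> last_pos u A = r" "first_pos u B = q \<and> last_pos u B = s"
      using first_last_posI[OF assms(1), of p r] first_last_posI[OF assms(2), of q s] * by auto
    then show ?R using * by simp
  next
    assume R: ?R
    note l = last_pos_less[OF assms(1)] last_pos_less[OF assms(2)]
    show "\<exists>p. p < length u \<and> u ! p = A \<and> (\<exists>q>p. q < length u \<and> u ! q = B \<and>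
        (\<exists>r>q. r < length u \<and> u ! r = A \<and> (\<exists>s>r. s < length u \<and> u ! s = B)))"
      by (rule exI[of _ "first_pos u A"], intro conjI, use R l in simp, simp add: nth_first_pos assms,
          rule exI[of _ "first_pos u B"], intro conjI, use R in simp, use R l in simp, simp add: nth_first_pos assms,
          rule exI[of _ "last_pos u A"], intro conjI, use R in simp, use R l in simp, simp add: nth_last_pos assms,
          rule exI[of _ "last_pos u B"], use R l in \<open>simp add: nth_last_pos assms\<close>)
  qed
  finally show ?thesis .
qed

text \<open>The Heaviside function with its mean value at the jump. An arc is a difference of two
  such steps, and it is the single steps, not the arcs, that the symmetry of a bridge matches
  up.\<close>

definition half_step :: "nat \<Rightarrow> nat \<Rightarrow> rat" where
  "half_step q p = (if q < p then 1 else if q = p then 1/2 else 0)"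

text \<open>The constant for \<open>s\<close> compensates the factor 2 in front of the form: an arc
  paired with the constant 1 gives the weighted sum of the n_w(A,D).\<close>

definition arc :: "'b list \<Rightarrow> 'b option \<Rightarrow> nat \<Rightarrow> rat" where
  "arc u a p = (case a of None \<Rightarrow> 1/2
     | Some A \<Rightarrow> half_step (first_pos u A) p - half_step (last_pos u A) p)"

definition arc_vec :: "'b set \<Rightarrow> 'b list \<Rightarrow> ('b option \<Rightarrow>\<^sub>0 int) \<Rightarrow> nat \<Rightarrow> rat" where
  "arc_vec L u x p = (\<Sum>a\<in>insert None (Some ` L). of_int (Poly_Mapping.lookup x a) * arc u a p)"

text \<open>The set \<open>L\<close> is independent of the word \<open>u\<close>, so that the form
  can be split into the contribution of the letters of a bridge and that of the others while the
  positions stay fixed.\<close>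

definition crossing :: "('b \<Rightarrow> rat) \<Rightarrow> 'b set \<Rightarrow> 'b list \<Rightarrow> (nat \<Rightarrow> rat) \<Rightarrow> (nat \<Rightarrow> rat) \<Rightarrow> rat" where
  "crossing f L u x y =
     (\<Sum>D\<in>L. f D * (x (first_pos u D) * y (last_pos u D) - x (last_pos u D) * y (first_pos u D)))"

lemma crossing_add:
  "crossing f L u (\<lambda>p. x p + y p) z = crossing f L u x z + crossing f L u y z"
  "crossing f L u z (\<lambda>p. x p + y p) = crossing f L u z x + crossing f L u z y"
  by (simp_all add: crossing_def sum.distrib[symmetric] algebra_simps)

lemma crossing_scale:
  "crossing f L u (\<lambda>p. c * x p) z = c * crossing f L u x z"
  "crossing f L u z (\<lambda>p. c * x p) = c * crossing f L u z x"
  by (simp_all add: crossing_def sum_distrib_left algebra_simps)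

lemma crossing_zero: "crossing f L u (\<lambda>p. 0) z = 0" "crossing f L u z (\<lambda>p. 0) = 0"
  by (simp_all add: crossing_def)

lemma crossing_sum:
  assumes "finite K"
  shows "crossing f L u (\<lambda>p. \<Sum>k\<in>K. c k * g k p) z = (\<Sum>k\<in>K. c k * crossing f L u (g k) z)"
    "crossing f L u z (\<lambda>p. \<Sum>k\<in>K. c k * g k p) = (\<Sum>k\<in>K. c k * crossing f L u z (g k))"
  using assms by (induction K rule: finite_induct) (simp_all add: crossing_zero crossing_add crossing_scale)

lemma arc_vec_add: "arc_vec L u (x + y) = (\<lambda>p. arc_vec L u x p + arc_vec L u y p)"
  by (rule ext) (simp add: arc_vec_def lookup_add algebra_simps sum.distrib)

lemma arc_vec_cmul: "arc_vec L u (frag_cmul k x) = (\<lambda>p. of_int k * arc_vec L u x p)"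
  by (rule ext) (simp add: arc_vec_def sum_distrib_left algebra_simps)

lemma arc_vec_frag_of:
  assumes "finite L" "a \<in> insert None (Some ` L)"
  shows "arc_vec L u (frag_of a) = arc u a"
proof
  fix p
  have "arc_vec L u (frag_of a) p = (\<Sum>b\<in>insert None (Some ` L). if b = a then arc u b p else 0)"
    unfolding arc_vec_def by (rule sum.cong) auto
  also have "\<dots> = arc u a p" using assms by (subst sum.delta) auto
  finally show "arc_vec L u (frag_of a) p = arc u a p" .
qed

section \<open>Weights of labels, and the form of a nanoword with rational values\<close>

locale weight_hom =
  fixes \<alpha> :: "'a set" and \<tau> :: "'a \<Rightarrow> 'a" and \<phi> :: "('a \<Rightarrow>\<^sub>0 int) set \<Rightarrow> int"
  assumes tau_closed: "\<tau> \<in> \<alpha> \<rightarrow> \<alpha>" and tau_tau: "\<And>a. a \<in> \<alpha> \<Longrightarrow> \<tau> (\<tau> a) = a"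
    and hom: "\<phi> \<in> hom (pi_group \<alpha> \<tau>) integer_group"
    and unit: "\<And>a. a \<in> \<alpha> \<Longrightarrow> \<phi> (pi_gen \<alpha> \<tau> a) \<in> {1, -1}"
begin

sublocale P: comm_group "pi_group \<alpha> \<tau>" by (rule comm_group_pi_group[OF tau_closed])

abbreviation G where "G \<equiv> pi_group \<alpha> \<tau>"

definition wt :: "'a \<Rightarrow> rat" where "wt a = of_int (\<phi> (pi_gen \<alpha> \<tau> a))"

lemma phi_mult: "x \<in> carrier G \<Longrightarrow> y \<in> carrier G \<Longrightarrow> \<phi> (x \<otimes>\<^bsub>G\<^esub> y) = \<phi> x + \<phi> y"
  using hom_mult[OF hom] by simp

lemma phi_one: "\<phi> \<one>\<^bsub>G\<^esub> = 0"
  using phi_mult[of "\<one>\<^bsub>G\<^esub>" "\<one>\<^bsub>G\<^esub>"] by simp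

lemma phi_inv: "x \<in> carrier G \<Longrightarrow> \<phi> (inv\<^bsub>G\<^esub> x) = - \<phi> x"
  using phi_mult[of x "inv\<^bsub>G\<^esub> x"] phi_one by simp

lemma phi_pow: "x \<in> carrier G \<Longrightarrow> \<phi> (x [^]\<^bsub>G\<^esub> (k :: int)) = k * \<phi> x"
  using hom_int_pow[OF hom _ P.is_group group_integer_group] by simp

lemma phi_finprod:
  assumes "\<And>a. a \<in> A \<Longrightarrow> g a \<in> carrier G" "finite A"
  shows "\<phi> (\<Otimes>\<^bsub>G\<^esub>a\<in>A. g a) = (\<Sum>a\<in>A. \<phi> (g a))"
  using assms(2,1)
proof (induction A rule: finite_induct)
  case (insert a A)
  then show ?case using phi_mult[of "g a" "\<Otimes>\<^bsub>G\<^esub>a\<in>A. g a"] by (simp add: P.finprod_insert Pi_def)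
qed (simp add: phi_one)

lemma wt_tau: "a \<in> \<alpha> \<Longrightarrow> wt (\<tau> a) = - wt a"
  using phi_mult[of "pi_gen \<alpha> \<tau> a" "pi_gen \<alpha> \<tau> (\<tau> a)"] pi_gen_inverse[OF tau_closed, of a]
    funcset_mem[OF tau_closed, of a]
  by (simp add: wt_def pi_gen_closed phi_one add_eq_0_iff)

lemma wt_nonzero: "a \<in> \<alpha> \<Longrightarrow> wt a \<noteq> 0"
  using unit[of a] by (auto simp: wt_def)

definition phi_form :: "('a, 'b) nanoword \<Rightarrow> ('b option \<Rightarrow>\<^sub>0 int) \<Rightarrow> ('b option \<Rightarrow>\<^sub>0 int) \<Rightarrow> rat" where
  "phi_form w x y = of_int (\<phi> (bilinear_form \<alpha> \<tau> (nanoword_pairing \<alpha> \<tau> w) x y))"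

end

lemma nanowordD:
  assumes "nanoword \<alpha> w"
  shows "A \<in> letters w \<Longrightarrow> count_list (word w) A = 2" "A \<in> letters w \<Longrightarrow> proj w A \<in> \<alpha>"
    "finite (letters w)" "letters w = set (word w)" "proj w \<in> extensional (letters w)"
proof -
  show c: "count_list (word w) A = 2" if "A \<in> letters w" for A using assms that by (simp add: nanoword_def)
  show "letters w = set (word w)"
    using assms c count_list_0_iff[of "word w"] by (force simp: nanoword_def)
  then show "finite (letters w)" by simp
  show "A \<in> letters w \<Longrightarrow> proj w A \<in> \<alpha>" "proj w \<in> extensional (letters w)"
    using assms by (auto simp: nanoword_def PiE_def)
qed

lemma first_last_pos_neq:
  assumes "count_list u A = 2" "count_list u B = 2" "A \<noteq> B"
  shows "first_pos u A \<noteq> first_pos u B" "first_pos u A \<noteq> last_pos u B"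
    "last_pos u A \<noteq> first_pos u B" "last_pos u A \<noteq> last_pos u B"
  using assms nth_first_pos nth_last_pos by metis+

text \<open>At the occurrences of a letter D other than A and B both arcs take only the values 0 and
  1, which gives the summands of the two circle products. At the occurrences of A its own arc is 1/2
  twice, so half of the linking number is left; likewise for B.\<close>

lemma arc_products:
  fixes u :: "'b list"
  assumes cA: "count_list u A = 2" and cB: "count_list u B = 2" and cD: "count_list u D = 2"
  defines "i \<equiv> first_pos u" and "j \<equiv> last_pos u"
  defines "n \<equiv> (\<lambda>A B. if i A < i B \<and> i B < j A \<and> j A < j B then 1
      else if i B < i A \<and> i A < j B \<and> j B < j A then - 1 else 0 :: rat)"
  shows "arc u (Some A) (i D) * arc u (Some B) (j D) - arc u (Some A) (j D) * arc u (Some B) (i D) =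
     (if i A < i D \<and> i D < j A \<and> i B < j D \<and> j D < j B then 1 else 0) -
     (if i B < i D \<and> i D < j B \<and> i A < j D \<and> j D < j A then 1 else 0) +
     (if D = A then n A B / 2 else 0) + (if D = B then n A B / 2 else 0)"
    and "arc u (Some A) (i D) - arc u (Some A) (j D) = n A D"
proof -
  have lt: "i A < j A" "i B < j B" "i D < j D"
    using positions_eq(2)[OF cA] positions_eq(2)[OF cB] positions_eq(2)[OF cD] by (simp_all add: i_def j_def)
  have ne: "i X \<noteq> i Y" "i X \<noteq> j Y" "j X \<noteq> i Y" "j X \<noteq> j Y" if "X \<noteq> Y" "X \<in> {A, B, D}" "Y \<in> {A, B, D}" for X Y
    using first_last_pos_neq[of u X Y] that cA cB cD by (auto simp: i_def j_def)
  have arc: "arc u (Some X) p = half_step (i X) p - half_step (j X) p" for X p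
    by (simp add: arc_def i_def j_def)
  show "arc u (Some A) (i D) - arc u (Some A) (j D) = n A D"
    using lt ne[of A D] by (cases "A = D") (auto simp: arc half_step_def n_def)
  show "arc u (Some A) (i D) * arc u (Some B) (j D) - arc u (Some A) (j D) * arc u (Some B) (i D) =
     (if i A < i D \<and> i D < j A \<and> i B < j D \<and> j D < j B then 1 else 0) -
     (if i B < i D \<and> i D < j B \<and> i A < j D \<and> j D < j A then 1 else 0) +
     (if D = A then n A B / 2 else 0) + (if D = B then n A B / 2 else 0)"
  proof (cases "A = B")
    case True
    then show ?thesis by (simp add: n_def)
  next
    case AB: False
    consider "D = A" | "D = B" | "D \<noteq> A" "D \<noteq> B" by blast
    then show ?thesis
    proof cases
      case 1
      then show ?thesis using lt ne[of A B] AB by (simp add: arc half_step_def n_def)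
    next
      case 2
      then show ?thesis using lt ne[of A B] AB by (simp add: arc half_step_def n_def)
    next
      case 3
      have ind: "arc u (Some X) p = (if i X < p \<and> p < j X then 1 else 0)" if "X \<in> {A, B}" "p \<in> {i D, j D}" for X p
        using that lt ne[of X D] 3 by (auto simp: arc half_step_def)
      show ?thesis using 3 by (simp add: ind)
    qed
  qed
qed

context weight_hom
begin

lemma linking_eq:
  assumes "count_list (word w) A = 2" "count_list (word w) B = 2"
  shows "of_int (linking w A B) = arc (word w) (Some A) (first_pos (word w) B) - arc (word w) (Some A) (last_pos (word w) B)"
  unfolding linking_def arc_products(2)[OF assms(1,2,2)]
    subseq_alternating_iff[OF assms] subseq_alternating_iff[OF assms(2,1)] by auto

text \<open>For two letters, the first identity of \<open>arc_products\<close> is weighted and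
  summed over D, where D = A and D = B supply the linking term. For \<open>s\<close> and a letter
  the second identity suffices, and e(s,s) vanishes by skew symmetry.\<close>

lemma phi_nanoword_form:
  assumes w: "nanoword \<alpha> w" and ab: "a \<in> insert None (Some ` letters w)" "b \<in> insert None (Some ` letters w)"
  shows "of_int (\<phi> (nanoword_form \<alpha> \<tau> w a b)) =
     2 * crossing (\<lambda>D. wt (proj w D)) (letters w) (word w) (arc (word w) a) (arc (word w) b)"
proof -
  let ?u = "word w" and ?L = "letters w" and ?f = "\<lambda>D. wt (proj w D)"
  have fin: "finite ?L" and c2: "\<And>A. A \<in> ?L \<Longrightarrow> count_list ?u A = 2" using nanowordD[OF w] by auto
  have g: "pi_gen \<alpha> \<tau> (proj w D) \<in> carrier G" if "D \<in> ?L" for D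
    using nanowordD(2)[OF w that] by (rule pi_gen_closed)
  have cc: "letter_circ \<alpha> \<tau> w A B \<in> carrier G" for A B
    unfolding letter_circ_def using g by (intro P.finprod_closed) auto
  have circ: "of_int (\<phi> (letter_circ \<alpha> \<tau> w A B)) = (\<Sum>D\<in>?L. ?f D *
     (if first_pos ?u A < first_pos ?u D \<and> first_pos ?u D < last_pos ?u A \<and>
         first_pos ?u B < last_pos ?u D \<and> last_pos ?u D < last_pos ?u B then 1 else 0))" for A B
    unfolding letter_circ_def
    by (subst phi_finprod) (use g fin in \<open>auto simp: wt_def sum.If_cases Int_def if_distrib cong: if_cong\<close>)
  have s: "(\<Otimes>\<^bsub>G\<^esub>D\<in>?L. pi_gen \<alpha> \<tau> (proj w D) [^]\<^bsub>G\<^esub> linking w A D) \<in> carrier G" for A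
    using g by (intro P.finprod_closed) auto
  have ps: "of_int (\<phi> (\<Otimes>\<^bsub>G\<^esub>D\<in>?L. pi_gen \<alpha> \<tau> (proj w D) [^]\<^bsub>G\<^esub> linking w A D)) =
     2 * crossing ?f ?L ?u (arc ?u (Some A)) (arc ?u None)" if A: "A \<in> ?L" for A
  proof -
    have "of_int (\<phi> (\<Otimes>\<^bsub>G\<^esub>D\<in>?L. pi_gen \<alpha> \<tau> (proj w D) [^]\<^bsub>G\<^esub> linking w A D)) =
      (\<Sum>D\<in>?L. of_int (linking w A D) * ?f D)"
      using g fin by (subst phi_finprod) (auto simp: phi_pow wt_def)
    also have "\<dots> = 2 * crossing ?f ?L ?u (arc ?u (Some A)) (\<lambda>_. 1/2)"
      unfolding crossing_def sum_distrib_left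
      by (rule sum.cong) (use c2 A in \<open>auto simp: linking_eq algebra_simps\<close>)
    finally show ?thesis by (simp add: arc_def[abs_def])
  qed
  have skew: "crossing ?f ?L ?u x y = - crossing ?f ?L ?u y x" for x y
    by (simp add: crossing_def sum_negf[symmetric] algebra_simps)
  consider "a = None" "b = None" | A where "a = Some A" "b = None" "A \<in> ?L" | A where "a = None" "b = Some A" "A \<in> ?L"
    | A B where "a = Some A" "b = Some B" "A \<in> ?L" "B \<in> ?L" using ab by auto
  then show ?thesis
  proof cases
    case 1
    have "crossing ?f ?L ?u (arc ?u None) (arc ?u None) = 0" using skew by (metis neg_equal_zero)
    then show ?thesis using 1 by (simp add: phi_one)
  next
    case 2
    then show ?thesis using ps by simp
  next
    case (3 A)
    then show ?thesis using ps[of A] s[of A] skew[of "arc ?u None" "arc ?u (Some A)"] by (simp add: phi_inv)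
  next
    case (4 A B)
    let ?i = "first_pos ?u" and ?j = "last_pos ?u"
    have "of_int (\<phi> (nanoword_form \<alpha> \<tau> w a b)) =
        2 * (of_int (\<phi> (letter_circ \<alpha> \<tau> w A B)) - of_int (\<phi> (letter_circ \<alpha> \<tau> w B A)))
        + of_int (linking w A B) * (?f A + ?f B)"
      using 4 cc g by (simp add: phi_mult phi_inv phi_pow wt_def)
    also have "\<dots> = 2 * (\<Sum>D\<in>?L. ?f D * ((if ?i A < ?i D \<and> ?i D < ?j A \<and> ?i B < ?j D \<and> ?j D < ?j B then 1 else 0) -
     (if ?i B < ?i D \<and> ?i D < ?j B \<and> ?i A < ?j D \<and> ?j D < ?j A then 1 else 0) +
     (if D = A then of_int (linking w A B) / 2 else 0) + (if D = B then of_int (linking w A B) / 2 else 0)))"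
    proof -
      have d: "(\<Sum>D\<in>?L. ?f D * (if D = X then c else 0)) = ?f X * c" if "X \<in> ?L" for X c
      proof -
        have "(\<Sum>D\<in>?L. ?f D * (if D = X then c else 0)) = (\<Sum>D\<in>?L. if D = X then ?f D * c else 0)"
          by (rule sum.cong) auto
        then show ?thesis using that fin by simp
      qed
      show ?thesis
        unfolding circ distrib_left right_diff_distrib sum.distrib sum_subtractf d[OF 4(3)] d[OF 4(4)]
        by (simp add: algebra_simps)
    qed
    also have "\<dots> = 2 * crossing ?f ?L ?u (arc ?u a) (arc ?u b)"
      unfolding crossing_def
    proof (intro arg_cong[of _ _ "\<lambda>x. 2 * x"] sum.cong refl arg_cong2[where f = "(*)"])
      fix D assume D: "D \<in> ?L"
      have l: "of_int (linking w A B) = (if ?i A < ?i B \<and> ?i B < ?j A \<and> ?j A < ?j B then 1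
      else if ?i B < ?i A \<and> ?i A < ?j B \<and> ?j B < ?j A then - 1 else 0 :: rat)"
        unfolding linking_def subseq_alternating_iff[OF c2[OF 4(3)] c2[OF 4(4)]]
          subseq_alternating_iff[OF c2[OF 4(4)] c2[OF 4(3)]] by simp
      show "(if ?i A < ?i D \<and> ?i D < ?j A \<and> ?i B < ?j D \<and> ?j D < ?j B then 1 else 0) -
     (if ?i B < ?i D \<and> ?i D < ?j B \<and> ?i A < ?j D \<and> ?j D < ?j A then 1 else 0) +
     (if D = A then of_int (linking w A B) / 2 else 0) + (if D = B then of_int (linking w A B) / 2 else 0) =
       arc ?u a (?i D) * arc ?u b (?j D) - arc ?u a (?j D) * arc ?u b (?i D)"
        unfolding 4(1,2) arc_products(1)[OF c2[OF 4(3)] c2[OF 4(4)] c2[OF D]] l ..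
    qed
    finally show ?thesis .
  qed
qed

lemma phi_form_eq:
  assumes w: "nanoword \<alpha> w"
  shows "phi_form w x y = 2 * crossing (\<lambda>D. wt (proj w D)) (letters w) (word w)
    (arc_vec (letters w) (word w) x) (arc_vec (letters w) (word w) y)"
proof -
  let ?S = "insert None (Some ` letters w)" and ?F = "nanoword_form \<alpha> \<tau> w"
  let ?b = "crossing (\<lambda>D. wt (proj w D)) (letters w) (word w)"
  have fin: "finite ?S" using nanowordD(3)[OF w] by simp
  have F: "?F a b \<in> carrier G" if "a \<in> ?S" "b \<in> ?S" for a b
    using alpha_pairing_nanoword_pairing[OF tau_closed w] that
    unfolding alpha_pairing_def nanoword_pairing_def pairing.simps by blast
  have "phi_form w x y = (\<Sum>a\<in>?S. \<Sum>b\<in>?S. of_int (Poly_Mapping.lookup x a * Poly_Mapping.lookup y b) * of_int (\<phi> (?F a b)))"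
  proof -
    let ?T = "\<lambda>a b. ?F a b [^]\<^bsub>G\<^esub> (Poly_Mapping.lookup x a * Poly_Mapping.lookup y b)"
    have c: "?T a b \<in> carrier G" if "a \<in> ?S" "b \<in> ?S" for a b
      by (rule P.int_pow_closed[OF F[OF that]])
    have "\<phi> (\<Otimes>\<^bsub>G\<^esub>a\<in>?S. \<Otimes>\<^bsub>G\<^esub>b\<in>?S. ?T a b) = (\<Sum>a\<in>?S. \<phi> (\<Otimes>\<^bsub>G\<^esub>b\<in>?S. ?T a b))"
      by (rule phi_finprod[OF _ fin], rule P.finprod_closed) (use c in blast)
    also have "\<dots> = (\<Sum>a\<in>?S. \<Sum>b\<in>?S. \<phi> (?T a b))"
      by (rule sum.cong[OF refl], rule phi_finprod[OF _ fin], rule c)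
    also have "\<dots> = (\<Sum>a\<in>?S. \<Sum>b\<in>?S. Poly_Mapping.lookup x a * Poly_Mapping.lookup y b * \<phi> (?F a b))"
      by (intro sum.cong refl phi_pow F)
    finally show ?thesis
      unfolding phi_form_def bilinear_form_def nanoword_pairing_def pairing.simps by simp
  qed
  also have "\<dots> = (\<Sum>a\<in>?S. \<Sum>b\<in>?S. of_int (Poly_Mapping.lookup x a) * of_int (Poly_Mapping.lookup y b) *
      (2 * ?b (arc (word w) a) (arc (word w) b)))"
    by (intro sum.cong refl) (simp only: phi_nanoword_form[OF w] of_int_mult)
  also have "\<dots> = 2 * ?b (arc_vec (letters w) (word w) x) (arc_vec (letters w) (word w) y)"
    unfolding arc_vec_def[abs_def] crossing_sum[OF fin] by (simp add: sum_distrib_left algebra_simps)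
  finally show ?thesis .
qed

lemma phi_form_add:
  assumes "nanoword \<alpha> w"
  shows "phi_form w (x + y) z = phi_form w x z + phi_form w y z"
    "phi_form w z (x + y) = phi_form w z x + phi_form w z y"
  by (simp_all add: phi_form_eq[OF assms] arc_vec_add crossing_add)

lemma phi_form_cmul:
  assumes "nanoword \<alpha> w"
  shows "phi_form w (frag_cmul k x) z = of_int k * phi_form w x z"
    "phi_form w z (frag_cmul k x) = of_int k * phi_form w z x"
  by (simp_all add: phi_form_eq[OF assms] arc_vec_cmul crossing_scale)

end

section \<open>Isomorphisms and the third homotopy move\<close>

lemma filter_position:
  assumes "p < length u" "P (u ! p)"
  defines "m \<equiv> (\<lambda>p. length (filter P (take p u)))"
  shows "m p < length (filter P u)" "filter P u ! m p = u ! p" "p < q \<Longrightarrow> m p < m q"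
proof -
  have u: "u = take p u @ u ! p # drop (Suc p) u" using assms(1) by (rule id_take_nth_drop)
  have f: "filter P u = filter P (take p u) @ u ! p # filter P (drop (Suc p) u)"
    using assms(2) by (subst u) simp
  show "m p < length (filter P u)" "filter P u ! m p = u ! p"
    unfolding f m_def by simp_all
  assume "p < q"
  then have "take q u = take p u @ u ! p # take (q - Suc p) (drop (Suc p) u)"
    using assms(1) by (subst u) (simp add: take_Cons')
  then show "m p < m q" using assms(2) by (simp add: m_def)
qed

lemma first_last_pos_filter:
  assumes c: "count_list u A = 2" and P: "P A"
  shows "first_pos (filter P u) A = length (filter P (take (first_pos u A) u))"
    "last_pos (filter P u) A = length (filter P (take (last_pos u A) u))"
    "count_list (filter P u) A = 2"
proof -
  have "filter ((=) A) (filter P u) = filter ((=) A) u"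
    using P by (auto simp: filter_filter intro!: filter_cong)
  then show c': "count_list (filter P u) A = 2" using c by (simp add: count_list_eq_length_filter)
  note l = last_pos_less[OF c] positions_eq(2)[OF c] nth_first_pos[OF c] nth_last_pos[OF c]
  have fl: "first_pos u A < length u" using l by simp
  note f = filter_position[of "first_pos u A" u P, OF fl] and g = filter_position[of "last_pos u A" u P, OF l(1)]
  show "first_pos (filter P u) A = length (filter P (take (first_pos u A) u))"
    "last_pos (filter P u) A = length (filter P (take (last_pos u A) u))"
    using first_last_posI[OF c', of "length (filter P (take (first_pos u A) u))" "length (filter P (take (last_pos u A) u))"]
      f g l P by auto
qed

lemma half_step_filter:
  assumes "p < length u" "q < length u" "P (u ! p)" "P (u ! q)"
  shows "half_step (length (filter P (take p u))) (length (filter P (take q u))) = half_step p q"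
  using filter_position(3)[where u = u and P = P and p = p and q = q]
    filter_position(3)[where u = u and P = P and p = q and q = p] assms
  by (cases p q rule: linorder_cases) (auto simp: half_step_def)

lemma crossing_cong:
  assumes "\<And>D. D \<in> L \<Longrightarrow> f D = f' D"
    and "\<And>D. D \<in> L \<Longrightarrow> x (first_pos u D) = x' (first_pos u' D) \<and> x (last_pos u D) = x' (last_pos u' D)"
    and "\<And>D. D \<in> L \<Longrightarrow> y (first_pos u D) = y' (first_pos u' D) \<and> y (last_pos u D) = y' (last_pos u' D)"
  shows "crossing f L u x y = crossing f' L u' x' y'"
  unfolding crossing_def by (rule sum.cong) (use assms in auto)

text \<open>The value of an arc at an occurrence of a letter depends only on the order of the
  positions involved, and filtering preserves the order of the positions that are kept.\<close>

lemma crossing_arc_vec_filter: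
  assumes c: "\<And>A. A \<in> L \<Longrightarrow> count_list u A = 2 \<and> P A"
  shows "crossing f L (filter P u) (arc_vec L (filter P u) x) (arc_vec L (filter P u) y) =
    crossing f L u (arc_vec L u x) (arc_vec L u y)"
proof -
  have a: "arc (filter P u) (Some A) (first_pos (filter P u) D) = arc u (Some A) (first_pos u D)"
    "arc (filter P u) (Some A) (last_pos (filter P u) D) = arc u (Some A) (last_pos u D)"
    if "A \<in> L" "D \<in> L" for A D
  proof -
    have l: "first_pos u X < length u" "last_pos u X < length u" "P (u ! first_pos u X)" "P (u ! last_pos u X)"
      if "X \<in> L" for X
      using c[OF that] positions_eq(2)[of u X] last_pos_less[of u X] nth_first_pos[of u X] nth_last_pos[of u X]
      by auto
    show "arc (filter P u) (Some A) (first_pos (filter P u) D) = arc u (Some A) (first_pos u D)"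
      "arc (filter P u) (Some A) (last_pos (filter P u) D) = arc u (Some A) (last_pos u D)"
      using that c l by (simp_all add: arc_def first_last_pos_filter half_step_filter)
  qed
  have s: "arc_vec L (filter P u) z (first_pos (filter P u) D) = arc_vec L u z (first_pos u D) \<and>
     arc_vec L (filter P u) z (last_pos (filter P u) D) = arc_vec L u z (last_pos u D)" if "D \<in> L" for z D
    unfolding arc_vec_def
    by (intro conjI sum.cong refl arg_cong2[where f = "(*)"]) (use that a in \<open>auto simp: arc_def[of _ None]\<close>)
  show ?thesis by (rule crossing_cong) (use s in auto)
qed

lemma arc_vec_diff: "arc_vec L u (x - y) = (\<lambda>p. arc_vec L u x p - arc_vec L u y p)"
  by (rule ext) (simp add: arc_vec_def lookup_minus algebra_simps sum_subtractf)

section \<open>Fillings with a bound on the rank, and isomorphisms\<close>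

context weight_hom
begin

text \<open>An upper bound for some filling, rather than the minimum over all of them, is a property
  that can be carried through a single move. The vector of \<open>s\<close> is adjoined separately,
  since it is not short in the pairing.\<close>

definition has_fill :: "('a, 'b) nanoword \<Rightarrow> nat \<Rightarrow> bool" where
  "has_fill w R \<longleftrightarrow> (\<exists>F. partial_filling \<tau> (\<lambda>a. proj w (the a)) (Some ` letters w) F \<and>
     rank_le (phi_form w) (insert (frag_of None) F) R)"

text \<open>Renaming letters leaves every occurrence in its place, so a vector and its image under
  \<open>h\<close> have the same function on positions.\<close>

lemma has_fill_isomorphic:
  assumes v: "nanoword \<alpha> v" and w: "nanoword \<alpha> w" and iso: "isomorphism_move v w"
    and fill: "has_fill v R"
  shows "has_fill w R"
proof -
  obtain f where f: "bij_betw f (letters v) (letters w)" "\<And>A. A \<in> letters v \<Longrightarrow> proj w (f A) = proj v A"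
      "word w = map f (word v)"
    using iso unfolding isomorphism_move_def by blast
  obtain F where F: "partial_filling \<tau> (\<lambda>a. proj v (the a)) (Some ` letters v) F"
      "rank_le (phi_form v) (insert (frag_of None) F) R"
    using fill unfolding has_fill_def by blast
  let ?S = "insert None (Some ` letters v)"
  let ?I = "insert (frag_of None) F"
  define h :: "('b option \<Rightarrow>\<^sub>0 int) \<Rightarrow> ('b option \<Rightarrow>\<^sub>0 int)" where
    "h = frag_extend (\<lambda>a. frag_of (map_option f a))"
  have Lw: "letters w = f ` letters v" and inj: "inj_on f (letters v)" using f(1) by (auto simp: bij_betw_def)
  have injo: "inj_on (map_option f) ?S" using inj by (auto simp: inj_on_def)
  have c: "count_list (word v) A = 2" if "A \<in> letters v" for A using nanowordD(1)[OF v that] .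
  have pos: "first_pos (word w) (f A) = first_pos (word v) A" "last_pos (word w) (f A) = last_pos (word v) A"
    if "A \<in> letters v" for A
  proof -
    have "positions (word w) (f A) = positions (word v) A"
      using inj that nanowordD(4)[OF v] unfolding positions_def f(3) inj_on_def by force
    then show "first_pos (word w) (f A) = first_pos (word v) A" "last_pos (word w) (f A) = last_pos (word v) A"
      by (simp_all add: first_pos_def last_pos_def)
  qed
  have arc: "arc (word w) (map_option f a) = arc (word v) a" if "a \<in> ?S" for a
    using that pos by (auto simp: arc_def fun_eq_iff)
  have vec: "arc_vec (letters w) (word w) (h x) = arc_vec (letters v) (word v) x" if "Poly_Mapping.keys x \<subseteq> ?S" for x
    using that
  proof (induction rule: frag_induction)
    case zero
    show ?case by (simp add: h_def arc_vec_def)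
  next
    case (one a)
    then have "map_option f a \<in> insert None (Some ` letters w)" by (auto simp: Lw)
    then show ?case
      using one nanowordD(3)[OF v] nanowordD(3)[OF w] by (simp add: h_def arc_vec_frag_of arc)
  next
    case (diff a b)
    then show ?case by (simp add: h_def frag_extend_diff arc_vec_diff)
  qed
  have form: "phi_form w (h x) (h y) = phi_form v x y" if "Poly_Mapping.keys x \<subseteq> ?S" "Poly_Mapping.keys y \<subseteq> ?S" for x y
    unfolding phi_form_eq[OF v] phi_form_eq[OF w] vec[OF that(1)] vec[OF that(2)]
    unfolding crossing_def Lw
    by (subst sum.reindex[OF inj]) (simp add: pos f(2))
  have IS: "Poly_Mapping.keys x \<subseteq> ?S" if "x \<in> ?I" for x
    using that F(1) by (auto simp: partial_filling_def)
  have sh: "short \<tau> (\<lambda>a. proj w (the a)) (h x) \<and> Poly_Mapping.keys (h x) = map_option f ` Poly_Mapping.keys x"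
    if "x \<in> F" for x
  proof -
    have s: "short \<tau> (\<lambda>a. proj v (the a)) x" and k: "Poly_Mapping.keys x \<subseteq> Some ` letters v"
      using that F(1) by (auto simp: partial_filling_def)
    from s show ?thesis unfolding short_def[of _ _ x]
    proof (elim disjE exE conjE)
      fix a assume "x = frag_of a"
      then show ?thesis by (auto simp: h_def short_def)
    next
      fix a b c assume *: "a \<noteq> b" "tau_rel \<tau> c (proj v (the a)) (proj v (the b))"
        "x = frag_of a + frag_cmul c (frag_of b)"
      have c: "c \<noteq> 0" using *(2) by (rule tau_rel_nonzero)
      have kx: "Poly_Mapping.keys x = {a, b}" unfolding *(3) by (rule keys_frag_pair[OF *(1) c])
      then obtain A B where ab: "a = Some A" "b = Some B" "A \<in> letters v" "B \<in> letters v" using k by auto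
      have hx: "h x = frag_of (Some (f A)) + frag_cmul c (frag_of (Some (f B)))"
        unfolding *(3) h_def ab by (simp add: frag_extend_add frag_extend_cmul)
      have ne: "Some (f A) \<noteq> Some (f B)" using *(1) ab inj by (auto simp: inj_on_def)
      have "tau_rel \<tau> c (proj w (the (Some (f A)))) (proj w (the (Some (f B))))"
        using *(2) ab f(2) by simp
      then have "short \<tau> (\<lambda>a. proj w (the a)) (h x)" unfolding short_def hx using ne by blast
      moreover have "Poly_Mapping.keys (h x) = map_option f ` Poly_Mapping.keys x"
        unfolding hx kx keys_frag_pair[OF ne c] ab by simp
      ultimately show ?thesis by blast
    qed
  qed
  have pf: "partial_filling \<tau> (\<lambda>a. proj w (the a)) (Some ` letters w) (h ` F)"
    unfolding partial_filling_def
  proof (intro conjI ballI)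
    show "finite (h ` F)" using F(1) by (simp add: partial_filling_def)
    show "short \<tau> (\<lambda>a. proj w (the a)) y" if "y \<in> h ` F" for y using that sh by blast
    have "\<Union> (Poly_Mapping.keys ` h ` F) = map_option f ` \<Union> (Poly_Mapping.keys ` F)"
      using sh by (auto simp: image_UN)
    also have "\<dots> = Some ` letters w" using F(1) by (auto simp: partial_filling_def Lw image_image)
    finally show "\<Union> (Poly_Mapping.keys ` h ` F) = Some ` letters w" .
    show "disjoint_family_on Poly_Mapping.keys (h ` F)"
      unfolding disjoint_family_on_def
    proof (intro ballI impI)
      fix y y' assume "y \<in> h ` F" "y' \<in> h ` F" "y \<noteq> y'"
      then obtain x x' where x: "x \<in> F" "x' \<in> F" "y = h x" "y' = h x'" "x \<noteq> x'" by blast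
      have "Poly_Mapping.keys x \<inter> Poly_Mapping.keys x' = {}"
        using F(1) x by (auto simp: partial_filling_def disjoint_family_on_def)
      then show "Poly_Mapping.keys y \<inter> Poly_Mapping.keys y' = {}"
        using x sh inj_on_image_Int[OF injo, of "Poly_Mapping.keys x" "Poly_Mapping.keys x'"] IS by auto
    qed
  qed
  \<comment> \<open>Any choice of preimages works for the pullback, because \<open>form\<close>
    compares the two forms for arbitrary vectors with the right support.\<close>
  have "rank_le (phi_form w) (h ` ?I) R"
  proof (rule rank_le_cong[OF rank_le_pullback[OF F(2), of "h ` ?I" "inv_into ?I h"]])
    show "inv_into ?I h j \<in> ?I" if "j \<in> h ` ?I" for j using that by (rule inv_into_into)
    show "phi_form w i j = phi_form v (inv_into ?I h i) (inv_into ?I h j)" if "i \<in> h ` ?I" "j \<in> h ` ?I" for i j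
      using form[of "inv_into ?I h i" "inv_into ?I h j"] IS inv_into_into[OF that(1)] inv_into_into[OF that(2)]
        f_inv_into_f[OF that(1)] f_inv_into_f[OF that(2)] by metis
  qed
  moreover have "h ` ?I = insert (frag_of None) (h ` F)" by (simp add: h_def)
  ultimately show ?thesis using pf unfolding has_fill_def by auto
qed

end

lemma isomorphism_move_sym:
  assumes v: "nanoword \<alpha> v" and iso: "isomorphism_move v w"
  shows "isomorphism_move w v"
proof -
  obtain f where f: "bij_betw f (letters v) (letters w)" "\<And>A. A \<in> letters v \<Longrightarrow> proj w (f A) = proj v A"
      "word w = map f (word v)"
    using iso unfolding isomorphism_move_def by blast
  let ?g = "inv_into (letters v) f"
  have "word v = map ?g (word w)"
    unfolding f(3) using bij_betw_imp_inj_on[OF f(1)] nanowordD(4)[OF v] by (simp add: map_idI)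
  moreover have "proj v (?g A) = proj w A" if "A \<in> letters w" for A
    using f(2)[of "?g A"] that f(1) bij_betw_inv_into_right[OF f(1) that]
    by (metis bij_betw_imp_surj_on inv_into_into)
  ultimately show ?thesis
    unfolding isomorphism_move_def using bij_betw_inv_into[OF f(1)] by blast
qed

section \<open>Invariance of the form under the third homotopy move\<close>

lemma nth_append_pair:
  assumes "i \<noteq> length a \<and> i \<noteq> Suc (length a)"
    and "length a + 2 \<le> i \<Longrightarrow> b ! (i - length a - 2) = b' ! (i - length a - 2)"
  shows "(a @ [c, d] @ b) ! i = (a @ [c', d'] @ b') ! i"
  using assms by (auto simp: nth_append nth_Cons' numeral_2_eq_2 not_less_eq_eq le_Suc_eq)

text \<open>The numbers \<open>p\<close>, \<open>q\<close>, \<open>r\<close> are the left positions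
  of the three neighbouring pairs that the move reverses.\<close>

lemma third_move_positions:
  assumes u: "u = x @ [A, B] @ y @ [A, C] @ z @ [B, C] @ t" and d: "distinct [A, B, C]"
    and c: "count_list u A = 2" "count_list u B = 2" "count_list u C = 2"
  defines "p \<equiv> length x" and "q \<equiv> length x + 2 + length y" and "r \<equiv> length x + 4 + length y + length z"
  shows "first_pos u A = p" "last_pos u A = q" "first_pos u B = Suc p" "last_pos u B = r"
    "first_pos u C = Suc q" "last_pos u C = Suc r"
proof -
  have l: "Suc r < length u" by (simp add: u r_def)
  have n: "u ! p = A" "u ! Suc p = B" "u ! q = A" "u ! Suc q = C" "u ! r = B" "u ! Suc r = C"
    by (simp_all add: u p_def q_def r_def nth_append)
  have o: "Suc p < q" "Suc q < r" by (simp_all add: p_def q_def r_def)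
  show "first_pos u A = p" "last_pos u A = q" "first_pos u B = Suc p" "last_pos u B = r"
    "first_pos u C = Suc q" "last_pos u C = Suc r"
    using first_last_posI[OF c(1), of p q] first_last_posI[OF c(2), of "Suc p" r]
      first_last_posI[OF c(3), of "Suc q" "Suc r"] n o l by auto
qed

text \<open>The values of an arc at the six positions involved in the third move, before (\<open>a\<close>) and after
  (\<open>b\<close>) the move: the first three cases are the arcs of \<open>A\<close>, \<open>B\<close>, \<open>C\<close>, the last one is that of
  any other letter or of \<open>s\<close>.\<close>

definition third_move_values ::
  "rat \<Rightarrow> rat \<Rightarrow> rat \<Rightarrow> rat \<Rightarrow> rat \<Rightarrow> rat \<Rightarrow> rat \<Rightarrow> rat \<Rightarrow> rat \<Rightarrow> rat \<Rightarrow> rat \<Rightarrow> rat \<Rightarrow> bool" where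
  "third_move_values a1 a2 a3 a4 a5 a6 b1 b2 b3 b4 b5 b6 \<longleftrightarrow>
     a1 = 1/2 \<and> a2 = 1 \<and> a3 = 1/2 \<and> a4 = 0 \<and> a5 = 0 \<and> a6 = 0 \<and>
       b1 = 0 \<and> b2 = 1/2 \<and> b3 = 1 \<and> b4 = 1/2 \<and> b5 = 0 \<and> b6 = 0 \<or>
     a1 = 0 \<and> a2 = 1/2 \<and> a3 = 1 \<and> a4 = 1 \<and> a5 = 1/2 \<and> a6 = 0 \<and>
       b1 = 1/2 \<and> b2 = 1 \<and> b3 = 1 \<and> b4 = 1 \<and> b5 = 1 \<and> b6 = 1/2 \<or>
     a1 = 0 \<and> a2 = 0 \<and> a3 = 0 \<and> a4 = 1/2 \<and> a5 = 1 \<and> a6 = 1/2 \<and>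
       b1 = 0 \<and> b2 = 0 \<and> b3 = 1/2 \<and> b4 = 1 \<and> b5 = 1/2 \<and> b6 = 0 \<or>
     a2 = a1 \<and> a4 = a3 \<and> a6 = a5 \<and> b1 = a1 \<and> b2 = a1 \<and> b3 = a3 \<and> b4 = a3 \<and> b5 = a5 \<and> b6 = a5"

text \<open>Index 1 to 6 stands for p, p+1, q, q+1, r, r+1. The letters A, B, C occupy (1,3), (2,5),
  (4,6) before the move and (2,4), (1,6), (3,5) after it. For two functions constant on each of the
  three pairs, both sides run over the same brackets; the remaining combinations are finitely many
  checks.\<close>

lemma third_move_identity:
  assumes "third_move_values a1 a2 a3 a4 a5 a6 a1' a2' a3' a4' a5' a6'"
    and "third_move_values b1 b2 b3 b4 b5 b6 b1' b2' b3' b4' b5' b6'"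
  shows "(a1 * b3 - a3 * b1) + (a2 * b5 - a5 * b2) + (a4 * b6 - a6 * b4) =
    (a2' * b4' - a4' * b2') + (a1' * b6' - a6' * b1') + (a3' * b5' - a5' * b3')"
  using assms unfolding third_move_values_def
  by (elim disjE; elim conjE; simp only:; simp add: algebra_simps)

lemma crossing_third_move:
  assumes u: "u = x @ [A, B] @ y @ [A, C] @ z @ [B, C] @ t"
    and u': "u' = x @ [B, A] @ y @ [C, A] @ z @ [C, B] @ t" and d: "distinct [A, B, C]"
    and f: "f A = f B" "f B = f C" and fin: "finite L" and ABC: "{A, B, C} \<subseteq> L"
    and c: "\<And>D. D \<in> L \<Longrightarrow> count_list u D = 2" and c': "\<And>D. D \<in> L \<Longrightarrow> count_list u' D = 2"
    and ab: "a \<in> insert None (Some ` L)" "b \<in> insert None (Some ` L)"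
  shows "crossing f L u (arc u a) (arc u b) = crossing f L u' (arc u' a) (arc u' b)"
proof -
  define p q r where "p = length x" and "q = length x + 2 + length y" and "r = length x + 4 + length y + length z"
  have cABC: "count_list u A = 2" "count_list u B = 2" "count_list u C = 2"
    "count_list u' A = 2" "count_list u' B = 2" "count_list u' C = 2" using c c' ABC by auto
  have P: "first_pos u A = p" "last_pos u A = q" "first_pos u B = Suc p" "last_pos u B = r"
    "first_pos u C = Suc q" "last_pos u C = Suc r"
    using third_move_positions[OF u d] cABC by (simp_all add: p_def q_def r_def)
  have l': "Suc r < length u'" by (simp add: u' r_def)
  have n': "u' ! p = B" "u' ! Suc p = A" "u' ! q = C" "u' ! Suc q = A" "u' ! r = C" "u' ! Suc r = B"
    by (simp_all add: u' p_def q_def r_def nth_append)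
  have n: "u ! p = A" "u ! Suc p = B" "u ! q = A" "u ! Suc q = C" "u ! r = B" "u ! Suc r = C"
    by (simp_all add: u p_def q_def r_def nth_append)
  have o: "Suc p < q" "Suc q < r" by (simp_all add: p_def q_def r_def)
  have P': "first_pos u' A = Suc p" "last_pos u' A = Suc q" "first_pos u' B = p" "last_pos u' B = Suc r"
    "first_pos u' C = q" "last_pos u' C = r"
    using first_last_posI[OF cABC(4), of "Suc p" "Suc q"] first_last_posI[OF cABC(5), of p "Suc r"]
      first_last_posI[OF cABC(6), of q r] n' o l' by auto
  let ?Q = "{p, Suc p, q, Suc q, r, Suc r}"
  have len: "length u = length u'" by (simp add: u u')
  have same: "u ! i = u' ! i" if "i \<notin> ?Q" for i
    unfolding u u'
  proof (rule nth_append_pair)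
    show "i \<noteq> length x \<and> i \<noteq> Suc (length x)" using that by (simp add: p_def)
    assume i: "length x + 2 \<le> i"
    show "(y @ [A, C] @ z @ [B, C] @ t) ! (i - length x - 2) = (y @ [C, A] @ z @ [C, B] @ t) ! (i - length x - 2)"
    proof (rule nth_append_pair)
      show "i - length x - 2 \<noteq> length y \<and> i - length x - 2 \<noteq> Suc (length y)"
      proof -
        have "i \<noteq> q" "i \<noteq> Suc q" using that by auto
        then show ?thesis using i unfolding q_def by arith
      qed
      assume "length y + 2 \<le> i - length x - 2"
      moreover have "i \<noteq> r" "i \<noteq> Suc r" using that by auto
      ultimately have "i - length x - 2 - length y - 2 \<noteq> length z \<and> i - length x - 2 - length y - 2 \<noteq> Suc (length z)"
        using i unfolding r_def by arith
      then show "(z @ [B, C] @ t) ! (i - length x - 2 - length y - 2) = (z @ [C, B] @ t) ! (i - length x - 2 - length y - 2)"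
        by (rule nth_append_pair) simp
    qed
  qed
  have other: "first_pos u D = first_pos u' D" "last_pos u D = last_pos u' D" "first_pos u D \<notin> ?Q" "last_pos u D \<notin> ?Q"
    if "D \<in> L" "D \<notin> {A, B, C}" for D
  proof -
    have "i \<notin> ?Q" if "u ! i = D" for i using that \<open>D \<notin> {A, B, C}\<close> n by auto
    then show "first_pos u D \<notin> ?Q" "last_pos u D \<notin> ?Q"
      using nth_first_pos[OF c[OF that(1)]] nth_last_pos[OF c[OF that(1)]] by auto
    have "u ! i = D \<longleftrightarrow> u' ! i = D" for i
    proof (cases "i \<in> ?Q")
      case True
      then show ?thesis using that(2) n n' by auto
    qed (simp add: same)
    then have "positions u D = positions u' D" by (simp add: positions_def len)
    then show "first_pos u D = first_pos u' D" "last_pos u D = last_pos u' D"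
      by (simp_all add: first_pos_def last_pos_def)
  qed
  \<comment> \<open>A step is constant on a neighbouring pair that does not contain its jump
    (\<open>hs\<close>), and moving a jump within a pair is not visible outside that pair
    (\<open>hs'\<close>).\<close>
  have hs: "half_step s p' = half_step s (Suc p')" if "s \<noteq> p'" "s \<noteq> Suc p'" for s p' using that by (auto simp: half_step_def)
  have hs': "half_step (Suc p') s = half_step p' s" if "s \<noteq> p'" "s \<noteq> Suc p'" for s p' using that by (auto simp: half_step_def)
  have arc_other: "arc u e i = arc u' e i" if "e \<in> insert None (Some ` L)" "i \<notin> ?Q" for e i
  proof (cases "e \<in> {Some A, Some B, Some C}")
    case True
    then show ?thesis using that(2) by (auto simp: arc_def P P' hs')
  next
    case False
    then show ?thesis using that(1) other(1,2) by (cases e) (simp_all add: arc_def image_iff)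
  qed
  have "third_move_values (arc u e p) (arc u e (Suc p)) (arc u e q) (arc u e (Suc q)) (arc u e r) (arc u e (Suc r))
      (arc u' e p) (arc u' e (Suc p)) (arc u' e q) (arc u' e (Suc q)) (arc u' e r) (arc u' e (Suc r))"
    if e: "e \<in> insert None (Some ` L)" for e
  proof -
    consider "e = Some A" | "e = Some B" | "e = Some C" | "e = None" | D where "e = Some D" "D \<in> L" "D \<notin> {A, B, C}"
      using e by (cases e) auto
    then show ?thesis
    proof cases
      case 4
      show ?thesis
        unfolding third_move_values_def
        by (simp add: arc_def 4)
    next
      case (5 D)
      note D = other[OF 5(2,3)]
      show ?thesis using D(3,4) unfolding 5(1) third_move_values_def
        by (simp add: arc_def D(1,2)[symmetric] hs)
    qed (use o in \<open>simp_all add: third_move_values_def arc_def P P' half_step_def\<close>)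
  qed
  note vals = this[OF ab(1)] this[OF ab(2)]
  \<comment> \<open>The common weight of A, B, C is factored out because only the sum of their three
    brackets is preserved; the single brackets need not be.\<close>
  have split: "crossing f L v g h = (\<Sum>D\<in>L - {A, B, C}. f D * (g (first_pos v D) * h (last_pos v D) - g (last_pos v D) * h (first_pos v D)))
     + f A * ((g (first_pos v A) * h (last_pos v A) - g (last_pos v A) * h (first_pos v A)) +
     (g (first_pos v B) * h (last_pos v B) - g (last_pos v B) * h (first_pos v B)) +
     (g (first_pos v C) * h (last_pos v C) - g (last_pos v C) * h (first_pos v C)))" for v g h
  proof -
    have "crossing f L v g h = (\<Sum>D\<in>L - {A, B, C}. f D * (g (first_pos v D) * h (last_pos v D) - g (last_pos v D) * h (first_pos v D)))
     + (\<Sum>D\<in>{A, B, C}. f D * (g (first_pos v D) * h (last_pos v D) - g (last_pos v D) * h (first_pos v D)))"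
      unfolding crossing_def by (rule sum.subset_diff[OF ABC fin])
    then show ?thesis using d f by (simp add: algebra_simps)
  qed
  have "(arc u a p * arc u b q - arc u a q * arc u b p) + (arc u a (Suc p) * arc u b r - arc u a r * arc u b (Suc p))
      + (arc u a (Suc q) * arc u b (Suc r) - arc u a (Suc r) * arc u b (Suc q)) =
    (arc u' a (Suc p) * arc u' b (Suc q) - arc u' a (Suc q) * arc u' b (Suc p)) + (arc u' a p * arc u' b (Suc r) - arc u' a (Suc r) * arc u' b p)
      + (arc u' a q * arc u' b r - arc u' a r * arc u' b q)"
    by (rule third_move_identity[OF vals])
  moreover have "arc u e (first_pos u D) = arc u' e (first_pos u' D)" "arc u e (last_pos u D) = arc u' e (last_pos u' D)"
    if "e \<in> insert None (Some ` L)" "D \<in> L - {A, B, C}" for e D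
    using arc_other[OF that(1) other(3)[of D]] arc_other[OF that(1) other(4)[of D]] other(1,2)[of D] that(2) by simp_all
  note out = this
  have "(\<Sum>D\<in>L - {A, B, C}. f D * (arc u a (first_pos u D) * arc u b (last_pos u D) - arc u a (last_pos u D) * arc u b (first_pos u D)))
    = (\<Sum>D\<in>L - {A, B, C}. f D * (arc u' a (first_pos u' D) * arc u' b (last_pos u' D) - arc u' a (last_pos u' D) * arc u' b (first_pos u' D)))"
    by (rule sum.cong[OF refl]) (simp only: out[OF ab(1)] out[OF ab(2)])
  ultimately show ?thesis unfolding split P P' by (simp only:)
qed

context weight_hom
begin

text \<open>The alphabet and the labels do not change either, so the same fillings serve both words,
  with the same matrices.\<close>

lemma phi_form_third_move:
  assumes v: "nanoword \<alpha> v" and w: "nanoword \<alpha> w"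
    and u: "word v = x @ [A, B] @ y @ [A, C] @ z @ [B, C] @ t" and d: "distinct [A, B, C]"
    and pr: "proj v A = proj v B" "proj v B = proj v C"
    and wv: "w = v\<lparr>word := x @ [B, A] @ y @ [C, A] @ z @ [C, B] @ t\<rparr>"
  shows "phi_form w = phi_form v"
proof (intro ext)
  fix X Y
  let ?L = "letters v"
  let ?S = "insert None (Some ` ?L)"
  have fin: "finite ?S" "finite ?L" using nanowordD(3)[OF v] by auto
  have Lw: "letters w = ?L" "proj w = proj v" "word w = x @ [B, A] @ y @ [C, A] @ z @ [C, B] @ t" by (simp_all add: wv)
  have "{A, B, C} \<subseteq> ?L" using nanowordD(4)[OF v] by (simp add: u)
  then have "crossing (\<lambda>D. wt (proj v D)) ?L (word v) (arc (word v) a) (arc (word v) b) =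
     crossing (\<lambda>D. wt (proj v D)) ?L (word w) (arc (word w) a) (arc (word w) b)" if "a \<in> ?S" "b \<in> ?S" for a b
    using nanowordD(1)[OF v] nanowordD(1)[OF w] Lw(1) fin pr that
    by (intro crossing_third_move[OF u Lw(3) d]) auto
  then show "phi_form w X Y = phi_form v X Y"
    unfolding phi_form_eq[OF v] phi_form_eq[OF w] Lw(1,2) arc_vec_def[abs_def] crossing_sum[OF fin(1)]
    by (auto intro!: sum.cong)
qed

text \<open>The set is listed without repetition behind the vector of \<open>s\<close>; distinctness
  then turns disjointness of the supports into uniqueness of the index in a filling.\<close>

lemma phi_genus_le_if_has_fill:
  assumes w: "nanoword \<alpha> w" and fill: "has_fill w R"
  shows "phi_genus \<alpha> \<tau> \<phi> (nanoword_pairing \<alpha> \<tau> w) \<le> R / 2"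
proof -
  let ?p = "nanoword_pairing \<alpha> \<tau> w"
  obtain F where F: "partial_filling \<tau> (\<lambda>a. proj w (the a)) (Some ` letters w) F"
      "rank_le (phi_form w) (insert (frag_of None) F) R"
    using fill unfolding has_fill_def by blast
  have "finite F" using F(1) by (simp add: partial_filling_def)
  then obtain xs where xs: "set xs = F" "distinct xs" using finite_distinct_list by blast
  define l where "l = frag_of None # xs"
  have p: "elems ?p = insert None (Some ` letters w)" "base ?p = None" "label ?p = (\<lambda>a. proj w (the a))"
    by (auto simp: nanoword_pairing_def)
  have sv: "short_vector \<tau> ?p x" if "x \<in> F" for x
  proof -
    have s: "short \<tau> (\<lambda>a. proj w (the a)) x" and k: "Poly_Mapping.keys x \<subseteq> Some ` letters w"
      using that F(1) by (auto simp: partial_filling_def)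
    from s show ?thesis unfolding short_def
    proof (elim disjE exE conjE)
      fix a assume "x = frag_of a"
      then show ?thesis using k unfolding short_vector_def p by (intro disjI1 bexI[of _ a]) auto
    next
      fix a b c assume *: "a \<noteq> b" "tau_rel \<tau> c (proj w (the a)) (proj w (the b))"
        "x = frag_of a + frag_cmul c (frag_of b)"
      have "Poly_Mapping.keys x = {a, b}" unfolding *(3) by (rule keys_frag_pair[OF *(1) tau_rel_nonzero[OF *(2)]])
      then have ab: "a \<in> Some ` letters w" "b \<in> Some ` letters w" using k by auto
      show ?thesis using *(2) unfolding tau_rel_def
      proof (elim disjE conjE)
        assume "c = 1" "proj w (the a) = proj w (the b)"
        then show ?thesis unfolding short_vector_def p using ab *(1,3)
          by (intro disjI2[OF disjI1] bexI[of _ a] bexI[of _ b] conjI) auto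
      next
        assume "c = - 1" "proj w (the a) = \<tau> (proj w (the b))"
        then show ?thesis unfolding short_vector_def p using ab *(1,3)
          by (intro disjI2[OF disjI2] bexI[of _ a] bexI[of _ b] conjI) auto
      qed
    qed
  qed
  have "filling \<tau> ?p l"
    unfolding filling_def p
  proof (intro conjI ballI exI[of _ 0] allI impI)
    show "0 < length l" "l ! 0 = frag_of None" by (simp_all add: l_def)
    fix j assume "j < length l" "j \<noteq> 0"
    then have "l ! j \<in> F" using xs(1) by (cases j) (auto simp: l_def)
    then show "short_vector \<tau> ?p (l ! j)" by (rule sv)
  next
    fix a assume "a \<in> insert None (Some ` letters w) - {None}"
    then have a: "a \<in> Some ` letters w" by blast
    then have "a \<in> \<Union> (Poly_Mapping.keys ` F)" using F(1) by (simp add: partial_filling_def)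
    then obtain x where x: "x \<in> F" "a \<in> Poly_Mapping.keys x" by blast
    then obtain i where i: "i < length xs" "xs ! i = x" using xs(1) by (auto simp: in_set_conv_nth)
    show "\<exists>!i. i < length l \<and> Poly_Mapping.lookup (l ! i) a \<noteq> 0"
    proof (rule ex1I[of _ "Suc i"])
      show "Suc i < length l \<and> Poly_Mapping.lookup (l ! Suc i) a \<noteq> 0"
        using i x(2) by (simp add: l_def in_keys_iff)
      fix j assume j: "j < length l \<and> Poly_Mapping.lookup (l ! j) a \<noteq> 0"
      show "j = Suc i"
      proof (cases j)
        case 0
        then show ?thesis using j a by (auto simp: l_def)
      next
        case (Suc j')
        then have j': "j' < length xs" "a \<in> Poly_Mapping.keys (xs ! j')" using j by (auto simp: l_def in_keys_iff)
        have "xs ! j' \<in> F" using j'(1) xs(1) by auto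
        then have "xs ! j' = x" using F(1) x j'(2) unfolding partial_filling_def disjoint_family_on_def by blast
        then show ?thesis using i Suc nth_eq_iff_index_eq[OF xs(2) j'(1) i(1)] by simp
      qed
    qed
  qed
  moreover have "vec_space.rank (length l) (filling_matrix \<alpha> \<tau> \<phi> ?p l) \<le> R"
  proof -
    obtain x y where xy: "\<forall>i\<in>insert (frag_of None) F. \<forall>j\<in>insert (frag_of None) F. phi_form w i j = (\<Sum>k<R. x k i * y k j)"
      using F(2) unfolding rank_le_def by blast
    have "set l = insert (frag_of None) F" by (simp add: l_def xs(1))
    then have "l ! i \<in> insert (frag_of None) F" if "i < length l" for i using that nth_mem by metis
    then have "phi_form w (l ! i) (l ! j) = (\<Sum>k<R. x k (l ! i) * y k (l ! j))" if "i < length l" "j < length l" for i j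
      using xy that by blast
    then have "filling_matrix \<alpha> \<tau> \<phi> ?p l = mat (length l) (length l) (\<lambda>(i, j). \<Sum>k<R. x k (l ! i) * y k (l ! j))"
      unfolding filling_matrix_def by (intro cong_mat refl) (simp add: phi_form_def[symmetric])
    then show ?thesis by (rule vec_space.rank_le_if_factorization)
  qed
  moreover have "bdd_below ((\<lambda>l. 1/2 * real (vec_space.rank (length l) (filling_matrix \<alpha> \<tau> \<phi> ?p l))) ` {l. filling \<tau> ?p l})"
    by (rule bdd_belowI[of _ 0]) auto
  ultimately have "phi_genus \<alpha> \<tau> \<phi> ?p \<le> 1/2 * real (vec_space.rank (length l) (filling_matrix \<alpha> \<tau> \<phi> ?p l))"
    unfolding phi_genus_def by (intro cINF_lower) auto
  also have "\<dots> \<le> R / 2"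
    using \<open>vec_space.rank (length l) (filling_matrix \<alpha> \<tau> \<phi> ?p l) \<le> R\<close> by simp
  finally show ?thesis .
qed

lemma has_fill_empty: "has_fill empty_nanoword 0"
proof -
  have e: "nanoword \<alpha> empty_nanoword" by (simp add: nanoword_def empty_nanoword_def)
  have "partial_filling \<tau> (\<lambda>a. proj empty_nanoword (the a)) (Some ` letters empty_nanoword) {}"
    by (simp add: partial_filling_def empty_nanoword_def disjoint_family_on_def)
  moreover have "phi_form empty_nanoword x y = 0" for x y
    unfolding phi_form_eq[OF e] by (simp add: crossing_def empty_nanoword_def)
  then have "rank_le (phi_form empty_nanoword) (insert (frag_of None) {}) 0"
    by (simp add: rank_le_def)
  ultimately show ?thesis unfolding has_fill_def by blast
qed

end

section \<open>Bridge moves\<close>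

lemma interleave_simps:
  "interleave (x # xs) (v # vs) = x @ v @ interleave xs vs"
  "interleave [x] [] = x"
  by (simp_all add: interleave_def)

lemma factor_pos_simps:
  "factor_pos (x # xs) (v # vs) 0 j = length x + j"
  "factor_pos (x # xs) (v # vs) (Suc r) j = length x + length v + factor_pos xs vs r j"
  by (simp_all add: factor_pos_def)

lemma factor_pos_shift: "factor_pos xs vs r j = factor_pos xs vs r 0 + j"
  by (simp add: factor_pos_def)

lemma interleave_filter:
  assumes "length xs = Suc (length vs)" "\<And>x a. x \<in> set xs \<Longrightarrow> a \<in> set x \<Longrightarrow> P a"
    "\<And>v a. v \<in> set vs \<Longrightarrow> a \<in> set v \<Longrightarrow> \<not> P a"
  shows "filter P (interleave xs vs) = concat xs"
  using assms
proof (induction vs arbitrary: xs)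
  case Nil
  then obtain x where "xs = [x]" by (auto simp: length_Suc_conv)
  then show ?case using Nil.prems(2) by (simp add: interleave_simps)
next
  case (Cons v vs)
  then obtain x xs' where xs: "xs = x # xs'" "length xs' = Suc (length vs)" by (auto simp: length_Suc_conv)
  have "filter P (interleave xs' vs) = concat xs'"
    using Cons.prems xs by (intro Cons.IH) auto
  moreover have "filter P x = x" using Cons.prems(2)[of x] xs(1) by (simp add: filter_id_conv)
  moreover have "filter P v = []" using Cons.prems(3)[of v] by (simp add: filter_empty_conv)
  ultimately show ?case by (simp add: xs(1) interleave_simps)
qed

lemma interleave_nth:
  assumes "length xs = Suc (length vs)" "r < length vs" "j < length (vs ! r)"
  shows "factor_pos xs vs r j < length (interleave xs vs)" "interleave xs vs ! factor_pos xs vs r j = vs ! r ! j"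
proof -
  have "factor_pos xs vs r j < length (interleave xs vs) \<and> interleave xs vs ! factor_pos xs vs r j = vs ! r ! j"
    using assms
  proof (induction vs arbitrary: xs r)
    case (Cons v vs)
    then obtain x xs' where xs: "xs = x # xs'" "length xs' = Suc (length vs)" by (auto simp: length_Suc_conv)
    show ?case
    proof (cases r)
      case 0
      then show ?thesis using Cons.prems xs by (simp add: interleave_simps factor_pos_simps nth_append)
    next
      case (Suc r')
      then show ?thesis using Cons.IH[of xs' r'] Cons.prems xs
        by (simp add: interleave_simps factor_pos_simps nth_append)
    qed
  qed simp
  then show "factor_pos xs vs r j < length (interleave xs vs)" "interleave xs vs ! factor_pos xs vs r j = vs ! r ! j"
    by auto
qed

lemma factor_pos_mono:
  assumes "length xs = Suc (length vs)" "r < r'" "r' < length vs"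
  shows "factor_pos xs vs r 0 + length (vs ! r) \<le> factor_pos xs vs r' 0"
  using assms
proof (induction vs arbitrary: xs r r')
  case (Cons v vs)
  then obtain x xs' where xs: "xs = x # xs'" "length xs' = Suc (length vs)" by (auto simp: length_Suc_conv)
  obtain r'' where r'': "r' = Suc r''" using Cons.prems(2) by (cases r') auto
  show ?case
    using Cons.IH[of xs' "r - 1" r''] Cons.prems xs r''
    by (cases r) (simp_all add: factor_pos_simps)
qed simp

lemma interleave_position_cases:
  assumes "length xs = Suc (length vs)" "p < length (interleave xs vs)"
  shows "(\<exists>r<length vs. \<exists>j<length (vs ! r). p = factor_pos xs vs r j) \<or> (\<exists>x\<in>set xs. interleave xs vs ! p \<in> set x)"
  using assms
proof (induction vs arbitrary: xs p)
  case Nil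
  then obtain x where "xs = [x]" by (auto simp: length_Suc_conv)
  then show ?case using Nil.prems(2) by (simp add: interleave_simps)
next
  case (Cons v vs)
  then obtain x xs' where xs: "xs = x # xs'" "length xs' = Suc (length vs)" by (auto simp: length_Suc_conv)
  consider "p < length x" | "length x \<le> p" "p < length x + length v" | "length x + length v \<le> p" by linarith
  then show ?case
  proof cases
    case 1
    then show ?thesis by (simp add: xs(1) interleave_simps nth_append)
  next
    case 2
    then have "p = factor_pos xs (v # vs) 0 (p - length x)" "p - length x < length ((v # vs) ! 0)"
      by (simp_all add: xs(1) factor_pos_simps)
    then show ?thesis by blast
  next
    case 3
    define p' where "p' = p - length x - length v"
    have p: "p = length x + length v + p'" using 3 by (simp add: p'_def)
    have "p' < length (interleave xs' vs)" using Cons.prems(2) by (simp add: p xs(1) interleave_simps)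
    from Cons.IH[OF xs(2) this] show ?thesis
    proof (elim disjE exE conjE bexE)
      fix r j assume r: "r < length vs" "j < length (vs ! r)" "p' = factor_pos xs' vs r j"
      then have "p = factor_pos xs (v # vs) (Suc r) j" "Suc r < length (v # vs)" "j < length ((v # vs) ! Suc r)"
        by (simp_all add: p xs(1) factor_pos_simps)
      then show ?thesis by blast
    next
      fix y assume "y \<in> set xs'" "interleave xs' vs ! p' \<in> set y"
      then show ?thesis by (auto simp: p xs(1) interleave_simps nth_append)
    qed
  qed
qed

section \<open>The symmetry of a bridge, acting on positions\<close>

locale bridge_data = weight_hom \<alpha> \<tau> \<phi>
  for \<alpha> :: "'a set" and \<tau> and \<phi> +
  fixes w :: "('a, 'b) nanoword" and \<B> :: "'b set" and xs vs :: "'b list list"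
    and \<kappa> :: "nat \<Rightarrow> nat" and \<iota> :: "'b \<Rightarrow> 'b"
  assumes w: "nanoword \<alpha> w" and bridge: "bridge \<tau> w \<B> xs vs \<kappa> \<iota>"
begin

abbreviation "k \<equiv> length vs"
abbreviation "n r \<equiv> length (vs ! r)"
abbreviation "u \<equiv> word w"
abbreviation "L \<equiv> letters w"
abbreviation "\<epsilon> B \<equiv> bridge_eps xs vs \<kappa> \<iota> B"
abbreviation "f D \<equiv> wt (proj w D)"
abbreviation "i B \<equiv> first_pos u B"
abbreviation "j B \<equiv> last_pos u B"

definition start :: "nat \<Rightarrow> nat" where "start r = factor_pos xs vs r 0"

definition in_block :: "nat \<Rightarrow> nat \<Rightarrow> bool" where
  "in_block r p \<longleftrightarrow> start r \<le> p \<and> p < start r + n r"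

text \<open>The position symmetric to \<open>start r + l\<close>. Block and offset are the
  arguments, so that no block has to be recovered from a position; counting offsets from 0 turns n_r
  + 1 - j into \<open>n r - 1 - l\<close>.\<close>

definition mirror :: "nat \<Rightarrow> nat \<Rightarrow> nat" where
  "mirror r l = start (\<kappa> r) + (n r - 1 - l)"

lemma factor: "\<B> \<subseteq> L" "length xs = Suc k" "u = interleave xs vs" "\<And>v. v \<in> set vs \<Longrightarrow> set v \<subseteq> \<B>"
    "\<And>x. x \<in> set xs \<Longrightarrow> set x \<subseteq> L - \<B>"
  using bridge by (auto simp: bridge_def quasi_bridge_def is_factor_def)

lemma kappa: "r < k \<Longrightarrow> \<kappa> r < k" "r < k \<Longrightarrow> \<kappa> (\<kappa> r) = r" "r < k \<Longrightarrow> map \<iota> (vs ! r) = rev (vs ! \<kappa> r)"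
  using bridge permutes_in_image[of \<kappa> "{..<k}" r] by (auto simp: bridge_def quasi_bridge_def)

lemma n_kappa: "r < k \<Longrightarrow> n (\<kappa> r) = n r"
  using arg_cong[OF kappa(3), of r length] by simp

lemma iota_in: "B \<in> \<B> \<Longrightarrow> \<iota> B \<in> \<B>"
  using bridge by (auto simp: bridge_def quasi_bridge_def)

lemma proj_iota: "B \<in> \<B> \<Longrightarrow> proj w (\<iota> B) = (\<tau> ^^ \<epsilon> B) (proj w B)"
  using bridge by (auto simp: bridge_def)

lemma eps_01: "\<epsilon> B = 0 \<or> \<epsilon> B = 1" by (simp add: bridge_eps_def)

lemma count2: "D \<in> L \<Longrightarrow> count_list u D = 2" using nanowordD(1)[OF w] .

lemma B_in_L: "B \<in> \<B> \<Longrightarrow> B \<in> L" using factor(1) by blast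

lemma finL: "finite L" using nanowordD(3)[OF w] .

lemma factor_pos_start: "factor_pos xs vs r l = start r + l"
  unfolding start_def by (rule factor_pos_shift)

lemma u_block: "r < k \<Longrightarrow> l < n r \<Longrightarrow> start r + l < length u" "r < k \<Longrightarrow> l < n r \<Longrightarrow> u ! (start r + l) = vs ! r ! l"
  using interleave_nth[OF factor(2), of r l] by (simp_all add: factor_pos_start factor(3))

lemma start_mono: "r < r' \<Longrightarrow> r' < k \<Longrightarrow> start r + n r \<le> start r'"
  using factor_pos_mono[OF factor(2)] by (simp add: start_def)

lemma in_block_unique: "in_block r p \<Longrightarrow> in_block r' p \<Longrightarrow> r < k \<Longrightarrow> r' < k \<Longrightarrow> r = r'"
  using start_mono[of r r'] start_mono[of r' r] unfolding in_block_def
  by (metis leD le_less_trans less_le_trans linorder_neqE_nat)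

lemma in_blockE:
  assumes "in_block r p"
  obtains l where "l < n r" "p = start r + l"
  using assms that[of "p - start r"] by (auto simp: in_block_def)

lemma in_blockI: "l < n r \<Longrightarrow> in_block r (start r + l)" by (simp add: in_block_def)

lemma block_letter: "r < k \<Longrightarrow> in_block r p \<Longrightarrow> u ! p \<in> \<B>"
  by (elim in_blockE) (use u_block(2) factor(4) nth_mem in fastforce)

lemma B_position:
  assumes "p < length u" "u ! p \<in> \<B>"
  obtains r l where "r < k" "l < n r" "p = start r + l"
  using interleave_position_cases[OF factor(2), of p] assms factor(5) unfolding factor(3) factor_pos_start by blast

lemma not_in_block:
  assumes "D \<in> L" "D \<notin> \<B>" "r < k"
  shows "\<not> in_block r (i D)" "\<not> in_block r (j D)"
  using block_letter[OF assms(3)] nth_first_pos[OF count2[OF assms(1)]] nth_last_pos[OF count2[OF assms(1)]] assms(2)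
  by metis+

lemma mirror_block: "r < k \<Longrightarrow> l < n r \<Longrightarrow> in_block (\<kappa> r) (mirror r l)"
  using n_kappa[of r] by (auto simp: in_block_def mirror_def)

lemma mirror_letter:
  assumes "r < k" "l < n r"
  shows "u ! mirror r l = \<iota> (vs ! r ! l)"
proof -
  have "\<iota> (vs ! r ! l) = rev (vs ! \<kappa> r) ! l" using kappa(3)[OF assms(1)] assms(2) nth_map[of l "vs ! r" \<iota>] by simp
  also have "\<dots> = vs ! \<kappa> r ! (n r - 1 - l)" using assms by (simp add: rev_nth n_kappa)
  also have "\<dots> = u ! mirror r l"
    unfolding mirror_def using u_block(2)[of "\<kappa> r" "n r - 1 - l"] assms by (simp add: kappa n_kappa)
  finally show ?thesis by simp
qed

lemma mirror_inj:
  assumes "r < k" "l < n r" "r' < k" "l' < n r'" "mirror r l = mirror r' l'"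
  shows "start r + l = start r' + l'"
proof -
  have "\<kappa> r = \<kappa> r'"
    by (rule in_block_unique[OF mirror_block[OF assms(1,2)]])
      (use assms mirror_block[of r' l'] kappa(1) in auto)
  then have "r = r'" using kappa(2) assms by metis
  then show ?thesis using assms by (simp add: mirror_def)
qed

definition sym_at :: "(nat \<Rightarrow> rat) \<Rightarrow> bool" where
  "sym_at x \<longleftrightarrow> (\<forall>r<k. \<forall>l<n r. x (mirror r l) = x (start r + l))"

definition off_block :: "nat \<Rightarrow> bool" where "off_block p \<longleftrightarrow> (\<forall>r<k. \<not> in_block r p)"

definition isotropic :: "(nat \<Rightarrow> rat) set" where
  "isotropic = {x. sym_at x \<and> (\<forall>p. off_block p \<longrightarrow> x p = 0)}"

text \<open>The positions symmetric to the two occurrences of \<open>B\<close> are distinct and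
  carry \<iota> B, hence they are its two occurrences. The value of \<epsilon> tells whether their
  order is kept or reversed.\<close>

lemma first_last_mirror:
  assumes B: "B \<in> \<B>"
  obtains r l r' l' where "r < k" "l < n r" "i B = start r + l" "r' < k" "l' < n r'" "j B = start r' + l'"
    "mirror r l = (if \<epsilon> B = 1 then i (\<iota> B) else j (\<iota> B))"
    "mirror r' l' = (if \<epsilon> B = 1 then j (\<iota> B) else i (\<iota> B))"
proof -
  have c: "count_list u B = 2" "count_list u (\<iota> B) = 2" using count2 B B_in_L iota_in by auto
  have p: "i B < length u" "u ! i B = B" "j B < length u" "u ! j B = B" "i B < j B"
    using c positions_eq(2)[OF c(1)] last_pos_less[OF c(1)] nth_first_pos nth_last_pos by auto
  obtain r l where rl: "r < k" "l < n r" "i B = start r + l" using B_position[of "i B"] p B by auto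
  obtain r' l' where rl': "r' < k" "l' < n r'" "j B = start r' + l'" using B_position[of "j B"] p B by auto
  have m: "mirror r l < length u" "mirror r' l' < length u"
    using u_block(1)[of "\<kappa> r" "n r - 1 - l"] u_block(1)[of "\<kappa> r'" "n r' - 1 - l'"] rl rl'
    by (simp_all add: mirror_def kappa n_kappa)
  have ml: "u ! mirror r l = \<iota> B" "u ! mirror r' l' = \<iota> B"
    using mirror_letter[OF rl(1,2)] mirror_letter[OF rl'(1,2)] u_block(2)[OF rl(1,2)] u_block(2)[OF rl'(1,2)]
      rl(3) rl'(3) p by auto
  have ne: "mirror r l \<noteq> mirror r' l'" using mirror_inj[OF rl(1,2) rl'(1,2)] p rl(3) rl'(3) by auto
  have c1: "mirror r l = i (\<iota> B) \<or> mirror r l = j (\<iota> B)" "mirror r' l' = i (\<iota> B) \<or> mirror r' l' = j (\<iota> B)"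
    using position_cases[OF c(2)] m ml by auto
  \<comment> \<open>\<open>bridge_eps\<close> asks for some block and offset at the first occurrence
    of \<open>B\<close>; disjointness of the blocks identifies them with \<open>r\<close> and
    \<open>l\<close>.\<close>
  have eps: "\<epsilon> B = 1 \<longleftrightarrow> mirror r l = i (\<iota> B)"
  proof
    assume "\<epsilon> B = 1"
    then obtain s m where s: "s < k" "m < n s" "start s + m = i B" "mirror s m = i (\<iota> B)"
      unfolding bridge_eps_def factor_pos_start factor(3)[symmetric] mirror_def by (auto split: if_splits)
    have "in_block r (i B)" "in_block s (i B)" using rl s by (auto simp: in_block_def)
    then have "s = r" using in_block_unique rl(1) s(1) by blast
    then show "mirror r l = i (\<iota> B)" using s rl by auto
  next
    assume "mirror r l = i (\<iota> B)"
    then have "\<exists>r l. r < k \<and> l < n r \<and> start r + l = i B \<and> start (\<kappa> r) + (n r - 1 - l) = i (\<iota> B)"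
      using rl unfolding mirror_def by metis
    then show "\<epsilon> B = 1"
      unfolding bridge_eps_def factor_pos_start factor(3)[symmetric] by simp
  qed
  show thesis
    by (rule that[OF rl rl']) (use eps c1 ne in auto)
qed

text \<open>Applying \<iota> twice to a block reverses it twice, and every letter of the bridge
  occurs in some block.\<close>

lemma iota_iota: "B \<in> \<B> \<Longrightarrow> \<iota> (\<iota> B) = B"
proof -
  assume B: "B \<in> \<B>"
  obtain r l where rl: "r < k" "l < n r" "i B = start r + l" using first_last_mirror[OF B] by metis
  have "vs ! r ! l = B" using u_block(2)[OF rl(1,2)] rl(3) nth_first_pos[OF count2[OF B_in_L[OF B]]] by simp
  moreover have "map \<iota> (map \<iota> (vs ! r)) = vs ! r"
    using kappa[OF rl(1)] kappa(3)[of "\<kappa> r"] by (metis rev_map rev_rev_ident)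
  then have "\<iota> (\<iota> (vs ! r ! l)) = vs ! r ! l" using rl(2) by (metis length_map nth_map)
  ultimately show ?thesis by simp
qed

lemma weight_iota: "B \<in> \<B> \<Longrightarrow> f (\<iota> B) = (if \<epsilon> B = 1 then - f B else f B)"
  using proj_iota[of B] eps_01[of B] wt_tau[of "proj w B"] nanowordD(2)[OF w] B_in_L by auto

lemma sym_first_last:
  assumes "sym_at x" "B \<in> \<B>"
  shows "x (i (\<iota> B)) = (if \<epsilon> B = 1 then x (i B) else x (j B))"
    "x (j (\<iota> B)) = (if \<epsilon> B = 1 then x (j B) else x (i B))"
proof -
  obtain r l r' l' where *: "r < k" "l < n r" "i B = start r + l" "r' < k" "l' < n r'" "j B = start r' + l'"
    "mirror r l = (if \<epsilon> B = 1 then i (\<iota> B) else j (\<iota> B))"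
    "mirror r' l' = (if \<epsilon> B = 1 then j (\<iota> B) else i (\<iota> B))"
    using first_last_mirror[OF assms(2)] .
  have "x (mirror r l) = x (i B)" "x (mirror r' l') = x (j B)"
    using assms(1) *(1,2,4,5) unfolding *(3,6) sym_at_def by blast+
  then show "x (i (\<iota> B)) = (if \<epsilon> B = 1 then x (i B) else x (j B))"
    "x (j (\<iota> B)) = (if \<epsilon> B = 1 then x (j B) else x (i B))"
    using *(7,8) by (simp_all split: if_splits)
qed

lemma bij_iota: "bij_betw \<iota> \<B> \<B>"
  by (rule bij_betw_byWitness[of _ \<iota>]) (auto simp: iota_iota iota_in)

text \<open>Replacing D by \<iota> D negates each summand: for \<epsilon> = 1 the weight changes
  sign and the order of the two occurrences is kept, for \<epsilon> = 0 the weight is kept and the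
  order is reversed. So the sum equals its negative.\<close>

lemma crossing_sym_zero:
  assumes "sym_at x" "sym_at y"
  shows "crossing f \<B> u x y = 0"
proof -
  let ?t = "\<lambda>D. f D * (x (i D) * y (j D) - x (j D) * y (i D))"
  have "(\<Sum>D\<in>\<B>. ?t D) = (\<Sum>D\<in>\<B>. ?t (\<iota> D))" by (rule sum.reindex_bij_betw[OF bij_iota, symmetric])
  also have "\<dots> = (\<Sum>D\<in>\<B>. - ?t D)"
    by (rule sum.cong[OF refl])
      (simp add: weight_iota sym_first_last[OF assms(1)] sym_first_last[OF assms(2)] algebra_simps)
  finally show ?thesis by (simp add: crossing_def sum_negf)
qed

lemma crossing_split: "crossing f L u x y = crossing f (L - \<B>) u x y + crossing f \<B> u x y"
  unfolding crossing_def by (rule sum.subset_diff[OF factor(1) finL])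

lemma off_block_first_last:
  assumes "D \<in> L - \<B>"
  shows "off_block (i D)" "off_block (j D)"
  using not_in_block assms by (auto simp: off_block_def)

lemma block_first_last:
  assumes "B \<in> \<B>"
  shows "\<not> off_block (i B)" "\<not> off_block (j B)"
  using first_last_mirror[OF assms] in_blockI unfolding off_block_def by metis+

definition rest :: "(nat \<Rightarrow> rat) \<Rightarrow> nat \<Rightarrow> rat" where
  "rest x p = (if off_block p then x p else 0)"

lemma crossing_rest: "crossing f L u (rest x) (rest y) = crossing f (L - \<B>) u x y"
  unfolding crossing_split
  by (simp add: crossing_def rest_def off_block_first_last block_first_last)

text \<open>Both occurrences of a letter lie in blocks or both lie outside them, so mixed terms
  vanish; the term of the two isotropic functions vanishes by symmetry.\<close>

lemma crossing_rest_isotropic: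
  assumes "z \<in> isotropic" "z' \<in> isotropic"
  shows "crossing f L u (\<lambda>p. rest x p + z p) (\<lambda>p. rest y p + z' p) = crossing f L u (rest x) (rest y)"
proof -
  have "crossing f L u (rest x) z' = 0" "crossing f L u z (rest y) = 0"
    using assms unfolding crossing_split isotropic_def
    by (simp_all add: crossing_def rest_def off_block_first_last block_first_last)
  moreover have "crossing f L u z z' = 0"
    using assms crossing_sym_zero[of z z'] unfolding crossing_split isotropic_def
    by (simp add: crossing_def off_block_first_last)
  ultimately show ?thesis by (simp add: crossing_add)
qed

section \<open>Functions attached to the arches\<close>

definition arch_reps :: "nat set" where "arch_reps = {r. r < k \<and> r < \<kappa> r}"

lemma card_arch_reps: "card arch_reps = arches k \<kappa>"
proof -
  have "{{r, \<kappa> r} | r. r < k \<and> \<kappa> r \<noteq> r} = (\<lambda>r. {r, \<kappa> r}) ` arch_reps"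
  proof (intro equalityI subsetI)
    fix a assume "a \<in> {{r, \<kappa> r} | r. r < k \<and> \<kappa> r \<noteq> r}"
    then obtain r where r: "a = {r, \<kappa> r}" "r < k" "\<kappa> r \<noteq> r" by blast
    show "a \<in> (\<lambda>r. {r, \<kappa> r}) ` arch_reps"
    proof (cases "r < \<kappa> r")
      case True
      then show ?thesis using r by (auto simp: arch_reps_def)
    next
      case False
      then have "\<kappa> r \<in> arch_reps" "a = {\<kappa> r, \<kappa> (\<kappa> r)}" using r kappa by (auto simp: arch_reps_def)
      then show ?thesis by blast
    qed
  qed (auto simp: arch_reps_def)
  moreover have "inj_on (\<lambda>r. {r, \<kappa> r}) arch_reps"
    by (rule inj_onI) (auto simp: arch_reps_def doubleton_eq_iff)
  ultimately show ?thesis by (simp add: arches_def card_image)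
qed

definition block_ind :: "nat \<Rightarrow> nat \<Rightarrow> rat" where
  "block_ind r p = (if in_block r p then 1 else 0)"

text \<open>A step whose jump is spread over the whole block: 0 before it, 1/2 on it, 1 after it. It
  is what remains of a jump in the block when its place inside the block is forgotten.\<close>

definition block_step :: "nat \<Rightarrow> nat \<Rightarrow> rat" where
  "block_step r p = (if in_block r p then 1/2 else if start r \<le> p then 1 else 0)"

text \<open>Only differences between the two ends of an arch are needed, and they vanish for a block
  fixed by \<kappa>; hence the count involves the arches alone.\<close>

definition arch_fun :: "nat + nat \<Rightarrow> nat \<Rightarrow> rat" where
  "arch_fun a p = (case a of Inl r \<Rightarrow> block_ind r p - block_ind (\<kappa> r) p
     | Inr r \<Rightarrow> block_step r p - block_step (\<kappa> r) p)"

definition arch_ix :: "(nat + nat) set" where "arch_ix = arch_reps <+> arch_reps"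

lemma finite_arch_ix: "finite arch_ix" and card_arch_ix: "card arch_ix = 2 * arches k \<kappa>"
proof -
  have "finite arch_reps" by (auto simp: arch_reps_def)
  then show "finite arch_ix" "card arch_ix = 2 * arches k \<kappa>"
    by (auto simp: arch_ix_def card_Plus card_arch_reps)
qed

definition near_isotropic :: "(nat \<Rightarrow> rat) set" where
  "near_isotropic = {x. \<exists>z c. z \<in> isotropic \<and> x = (\<lambda>p. z p + (\<Sum>a\<in>arch_ix. c a * arch_fun a p))}"

lemma isotropic_add: "x \<in> isotropic \<Longrightarrow> y \<in> isotropic \<Longrightarrow> (\<lambda>p. x p + y p) \<in> isotropic"
  by (simp add: isotropic_def sym_at_def)

lemma isotropic_scale: "x \<in> isotropic \<Longrightarrow> (\<lambda>p. c * x p) \<in> isotropic"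
  by (simp add: isotropic_def sym_at_def)

lemma isotropic_zero: "(\<lambda>p. 0) \<in> isotropic" by (simp add: isotropic_def sym_at_def)

lemma near_isotropic_add:
  assumes "x \<in> near_isotropic" "y \<in> near_isotropic"
  shows "(\<lambda>p. x p + y p) \<in> near_isotropic"
proof -
  obtain z c z' c' where *: "z \<in> isotropic" "x = (\<lambda>p. z p + (\<Sum>a\<in>arch_ix. c a * arch_fun a p))"
    "z' \<in> isotropic" "y = (\<lambda>p. z' p + (\<Sum>a\<in>arch_ix. c' a * arch_fun a p))"
    using assms unfolding near_isotropic_def by blast
  then have "(\<lambda>p. x p + y p) = (\<lambda>p. (z p + z' p) + (\<Sum>a\<in>arch_ix. (c a + c' a) * arch_fun a p))"
    by (simp add: distrib_right sum.distrib fun_eq_iff)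
  then show ?thesis 
    unfolding near_isotropic_def using isotropic_add[OF *(1,3)]
    by (intro CollectI exI[of _ "\<lambda>p. z p + z' p"] exI[of _ "\<lambda>a. c a + c' a"] conjI)
qed

lemma near_isotropic_scale:
  assumes "x \<in> near_isotropic"
  shows "(\<lambda>p. c * x p) \<in> near_isotropic"
proof -
  obtain z d where "z \<in> isotropic" "x = (\<lambda>p. z p + (\<Sum>a\<in>arch_ix. d a * arch_fun a p))"
    using assms unfolding near_isotropic_def by blast
  then show ?thesis unfolding near_isotropic_def
    by (intro CollectI exI[of _ "\<lambda>p. c * z p"] exI[of _ "\<lambda>a. c * d a"])
      (auto simp: isotropic_scale sum_distrib_left algebra_simps)
qed

lemma near_isotropic_diff: "x \<in> near_isotropic \<Longrightarrow> y \<in> near_isotropic \<Longrightarrow> (\<lambda>p. x p - y p) \<in> near_isotropic"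
  using near_isotropic_add[OF _ near_isotropic_scale, of x y "-1"] by simp

lemma isotropic_near_isotropic: "x \<in> isotropic \<Longrightarrow> x \<in> near_isotropic"
  unfolding near_isotropic_def by (intro CollectI exI[of _ x] exI[of _ "\<lambda>_. 0"]) simp

lemma near_isotropic_sum: "finite R \<Longrightarrow> (\<And>r. r \<in> R \<Longrightarrow> g r \<in> near_isotropic) \<Longrightarrow> (\<lambda>p. \<Sum>r\<in>R. c r * g r p) \<in> near_isotropic"
  by (induction R rule: finite_induct) (auto simp: isotropic_near_isotropic[OF isotropic_zero] intro!: near_isotropic_add near_isotropic_scale)

text \<open>Extends the defining functions from the smaller index of an arch to all blocks: the
  larger index gives the negative, a fixed block gives 0.\<close>

lemma arch_fun_near_isotropic:
  assumes r: "r < k"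
  shows "(\<lambda>p. block_ind r p - block_ind (\<kappa> r) p) \<in> near_isotropic" "(\<lambda>p. block_step r p - block_step (\<kappa> r) p) \<in> near_isotropic"
proof -
  have base: "arch_fun a \<in> near_isotropic" if "a \<in> arch_ix" for a
  proof -
    have "(\<Sum>b\<in>arch_ix. (if b = a then 1 else 0) * arch_fun b p) = arch_fun a p" for p
    proof -
      have "(\<Sum>b\<in>arch_ix. (if b = a then 1 else 0) * arch_fun b p) = (\<Sum>b\<in>arch_ix. if b = a then arch_fun b p else 0)"
        by (rule sum.cong) auto
      then show ?thesis using that finite_arch_ix by simp
    qed
    then show ?thesis
      unfolding near_isotropic_def by (intro CollectI exI[of _ "\<lambda>_. 0"] exI[of _ "\<lambda>b. if b = a then 1 else 0"])
        (simp add: isotropic_zero)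
  qed
  have *: "(\<lambda>p. h r p - h (\<kappa> r) p) \<in> near_isotropic"
    if h: "\<And>r. r \<in> arch_reps \<Longrightarrow> (\<lambda>p. h r p - h (\<kappa> r) p) \<in> near_isotropic" for h :: "nat \<Rightarrow> nat \<Rightarrow> rat"
  proof (cases r "\<kappa> r" rule: linorder_cases)
    case less
    then show ?thesis using h[of r] r by (simp add: arch_reps_def)
  next
    case equal
    then show ?thesis by (simp add: isotropic_near_isotropic[OF isotropic_zero])
  next
    case greater
    then have "\<kappa> r \<in> arch_reps" using r kappa by (simp add: arch_reps_def)
    then show ?thesis using near_isotropic_scale[OF h, of "\<kappa> r" "-1"] kappa(2)[OF r] by simp
  qed
  show "(\<lambda>p. block_ind r p - block_ind (\<kappa> r) p) \<in> near_isotropic"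
    by (rule *, drule InlI[of _ arch_reps arch_reps, folded arch_ix_def], drule base)
      (simp add: arch_fun_def[abs_def])
  show "(\<lambda>p. block_step r p - block_step (\<kappa> r) p) \<in> near_isotropic"
    by (rule *, drule InrI[of _ arch_reps arch_reps, folded arch_ix_def], drule base)
      (simp add: arch_fun_def[abs_def])
qed

lemma block_ind_pos: "r < k \<Longrightarrow> r' < k \<Longrightarrow> l < n r' \<Longrightarrow> block_ind r (start r' + l) = (if r = r' then 1 else 0)"
  unfolding block_ind_def using in_block_unique in_blockI by metis

lemma block_ind_mirror: "r < k \<Longrightarrow> r' < k \<Longrightarrow> l < n r' \<Longrightarrow> block_ind r (mirror r' l) = (if \<kappa> r = r' then 1 else 0)"
  unfolding block_ind_def using in_block_unique mirror_block kappa(1,2) by metis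

text \<open>Half the sum of the indicators of a block and its mirror block is symmetric, half their
  difference is a multiple of a function of the arch or 0.\<close>

lemma block_ind_near_isotropic:
  assumes r: "r < k"
  shows "block_ind r \<in> near_isotropic"
proof -
  have "(\<lambda>p. block_ind r p + block_ind (\<kappa> r) p) \<in> isotropic"
    unfolding isotropic_def sym_at_def
    using r kappa by (auto simp: block_ind_pos block_ind_mirror) (auto simp: block_ind_def off_block_def)
  then have "(\<lambda>p. 1/2 * (block_ind r p + block_ind (\<kappa> r) p) + 1/2 * (block_ind r p - block_ind (\<kappa> r) p)) \<in> near_isotropic"
    by (intro near_isotropic_add near_isotropic_scale arch_fun_near_isotropic[OF r] isotropic_near_isotropic)
  moreover have "(\<lambda>p. 1/2 * (block_ind r p + block_ind (\<kappa> r) p) + 1/2 * (block_ind r p - block_ind (\<kappa> r) p)) = block_ind r"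
    by (rule ext) (simp add: field_simps)
  ultimately show ?thesis by simp
qed

text \<open>The arcs of letters outside the bridge jump nowhere inside a block, so they are constant
  on blocks, and cutting them off there subtracts a combination of indicators of blocks.\<close>

lemma arc_vec_rest_near_isotropic:
  assumes x: "Poly_Mapping.keys x \<subseteq> insert None (Some ` (L - \<B>))"
  shows "(\<lambda>p. arc_vec L u x p - rest (arc_vec L u x) p) \<in> near_isotropic"
proof -
  have c: "arc u a (start r + l) = arc u a (start r)" if "a \<in> insert None (Some ` (L - \<B>))" "r < k" "l < n r" for a r l
  proof (cases a)
    case (Some D)
    then have D: "D \<in> L" "D \<notin> \<B>" using that by auto
    have "half_step q (start r + l) = half_step q (start r)" if "\<not> in_block r q" for q
      using that \<open>l < n r\<close> by (auto simp: half_step_def in_block_def)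
    then show ?thesis using not_in_block[OF D that(2)] by (simp add: Some arc_def)
  qed (simp add: arc_def)
  have cx: "arc_vec L u x (start r + l) = arc_vec L u x (start r)" if "r < k" "l < n r" for r l
    unfolding arc_vec_def
  proof (rule sum.cong[OF refl])
    fix a
    show "of_int (Poly_Mapping.lookup x a) * arc u a (start r + l) = of_int (Poly_Mapping.lookup x a) * arc u a (start r)"
      using c[OF _ that, of a] x by (cases "a \<in> Poly_Mapping.keys x") (auto simp: in_keys_iff)
  qed
  have "arc_vec L u x p - rest (arc_vec L u x) p = (\<Sum>r<k. arc_vec L u x (start r) * block_ind r p)" for p
  proof (cases "off_block p")
    case True
    then show ?thesis by (simp add: rest_def block_ind_def off_block_def)
  next
    case False
    then obtain r where r: "r < k" "in_block r p" by (auto simp: off_block_def)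
    then obtain l where l: "l < n r" "p = start r + l" by (auto elim: in_blockE)
    have "(\<Sum>r'<k. arc_vec L u x (start r') * block_ind r' p) = (\<Sum>r'<k. if r' = r then arc_vec L u x (start r') else 0)"
      using r l by (intro sum.cong) (auto simp: block_ind_pos)
    also have "\<dots> = arc_vec L u x p" using r cx[OF r(1) l(1)] l by simp
    finally show ?thesis using False by (simp add: rest_def)
  qed
  then show ?thesis using near_isotropic_sum[of "{..<k}" block_ind "\<lambda>r. arc_vec L u x (start r)"] block_ind_near_isotropic by simp
qed

text \<open>The part of a step inside the block of its jump, centred at 0 by subtracting 1/2 so that
  reflection changes its sign.\<close>

definition local_step :: "nat \<Rightarrow> nat \<Rightarrow> nat \<Rightarrow> rat" where
  "local_step r l p = (if in_block r p then half_step (start r + l) p - 1/2 else 0)"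

lemma half_step_split:
  assumes "r < k" "l < n r"
  shows "half_step (start r + l) p = local_step r l p + block_step r p"
  using assms by (auto simp: local_step_def block_step_def half_step_def in_block_def)

text \<open>Reflection exchanges the two sides of the jump, where the centred step has opposite
  values, and fixes the value 0 at the jump itself.\<close>

lemma local_step_mirror:
  assumes r: "r < k" "l < n r" and r': "r' < k" "l' < n r'"
  shows "local_step r l (mirror r' l') = - local_step (\<kappa> r) (n r - 1 - l) (start r' + l')"
proof (cases "\<kappa> r = r'")
  case True
  have b: "in_block r (mirror r' l')" "in_block (\<kappa> r) (start r' + l')"
    using mirror_block[OF r'] in_blockI[OF r'(2)] True kappa(2)[OF r(1)] by auto
  have e: "\<kappa> r' = r" "n r' = n r" using True kappa(2)[OF r(1)] n_kappa[OF r(1)] by auto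
  have "half_step (start r + l) (start r + (n r - 1 - l')) - 1/2 =
      - (half_step (start (\<kappa> r) + (n r - 1 - l)) (start (\<kappa> r) + l') - 1/2)"
    using r(2) r'(2) e by (auto simp: half_step_def)
  then show ?thesis using b e True by (simp add: local_step_def mirror_def)
next
  case False
  have "\<not> in_block r (mirror r' l')"
    using in_block_unique[OF _ mirror_block[OF r'], of r] r r' kappa False by metis
  moreover have "\<not> in_block (\<kappa> r) (start r' + l')"
    using in_block_unique[OF _ in_blockI[OF r'(2)], of "\<kappa> r"] r r' kappa False by metis
  ultimately show ?thesis by (simp add: local_step_def)
qed

text \<open>By \<open>local_step_mirror\<close>, reflection sends each local part to the negative of
  the other, so their difference is symmetric. What is left is the difference of the block
  steps.\<close>

lemma half_step_mirror_near_isotropic: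
  assumes r: "r < k" "l < n r"
  shows "(\<lambda>p. half_step (start r + l) p - half_step (mirror r l) p) \<in> near_isotropic"
proof -
  let ?l = "n r - 1 - l"
  have l: "\<kappa> r < k" "?l < n (\<kappa> r)" "n (\<kappa> r) - 1 - ?l = l" using r kappa n_kappa by auto
  let ?z = "\<lambda>p. local_step r l p - local_step (\<kappa> r) ?l p"
  have "?z \<in> isotropic"
    unfolding isotropic_def sym_at_def
  proof (intro CollectI conjI allI impI)
    fix r' l' assume "r' < k" "l' < n r'"
    then show "?z (mirror r' l') = ?z (start r' + l')"
      using local_step_mirror[OF r] local_step_mirror[OF l(1,2)] l(3) kappa(2)[OF r(1)] by simp
  next
    fix p assume "off_block p"
    then show "?z p = 0" using r kappa(1) by (auto simp: local_step_def off_block_def)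
  qed
  then have "(\<lambda>p. ?z p + (block_step r p - block_step (\<kappa> r) p)) \<in> near_isotropic"
    by (intro near_isotropic_add isotropic_near_isotropic arch_fun_near_isotropic(2)[OF r(1)])
  moreover have "(\<lambda>p. ?z p + (block_step r p - block_step (\<kappa> r) p)) = (\<lambda>p. half_step (start r + l) p - half_step (mirror r l) p)"
    using half_step_split[OF r] half_step_split[OF l(1,2)] by (simp add: mirror_def fun_eq_iff)
  ultimately show ?thesis by simp
qed

section \<open>The short vectors attached to a bridge\<close>

definition bridge_vec :: "'b \<Rightarrow> 'b option \<Rightarrow>\<^sub>0 int" where
  "bridge_vec B = (if \<iota> B = B then frag_of (Some B)
     else frag_of (Some B) + frag_cmul (if \<epsilon> B = 1 then - 1 else 1) (frag_of (Some (\<iota> B))))"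

text \<open>The inequality selects from each orbit of \<iota> the letter that appears first, so that
  every letter of the bridge is covered only once.\<close>

definition bridge_filling :: "('b option \<Rightarrow>\<^sub>0 int) set" where
  "bridge_filling = bridge_vec ` {B \<in> \<B>. i B \<le> i (\<iota> B)}"

lemma keys_bridge_vec: "Poly_Mapping.keys (bridge_vec B) = {Some B, Some (\<iota> B)}"
  unfolding bridge_vec_def by (auto simp: keys_frag_pair)

lemma first_pos_inj: "A \<in> L \<Longrightarrow> B \<in> L \<Longrightarrow> i A = i B \<Longrightarrow> A = B"
  using nth_first_pos count2 by metis

lemma bridge_filling:
  "partial_filling \<tau> (\<lambda>a. proj w (the a)) (Some ` \<B>) bridge_filling"
  unfolding partial_filling_def
proof (intro conjI ballI)
  show "finite bridge_filling" using finite_subset[OF factor(1) finL] by (simp add: bridge_filling_def)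
  show "short \<tau> (\<lambda>a. proj w (the a)) x" if "x \<in> bridge_filling" for x
  proof -
    obtain B where B: "B \<in> \<B>" "x = bridge_vec B" using \<open>x \<in> bridge_filling\<close> by (auto simp: bridge_filling_def)
    show ?thesis
    proof (cases "\<iota> B = B")
      case True
      then show ?thesis unfolding B(2) short_def bridge_vec_def by auto
    next
      case False
      have "tau_rel \<tau> (if \<epsilon> B = 1 then - 1 else 1) (proj w (the (Some B))) (proj w (the (Some (\<iota> B))))"
        using proj_iota[OF B(1)] eps_01[of B] tau_tau[OF nanowordD(2)[OF w B_in_L[OF B(1)]]]
        by (auto simp: tau_rel_def)
      then show ?thesis unfolding B(2) short_def bridge_vec_def using False
        by (intro disjI2 exI[of _ "Some B"] exI[of _ "Some (\<iota> B)"] exI[of _ "if \<epsilon> B = 1 then - 1 else 1"]) auto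
    qed
  qed
  show "\<Union> (Poly_Mapping.keys ` bridge_filling) = Some ` \<B>"
  proof (intro equalityI subsetI)
    fix a assume "a \<in> \<Union> (Poly_Mapping.keys ` bridge_filling)"
    then show "a \<in> Some ` \<B>" by (auto simp: bridge_filling_def keys_bridge_vec iota_in)
  next
    fix a assume "a \<in> Some ` \<B>"
    then obtain B where B: "a = Some B" "B \<in> \<B>" by blast
    show "a \<in> \<Union> (Poly_Mapping.keys ` bridge_filling)"
    proof (cases "i B \<le> i (\<iota> B)")
      case True
      then show ?thesis using B by (auto simp: bridge_filling_def keys_bridge_vec)
    next
      case False
      then show ?thesis using B iota_in[OF B(2)] iota_iota[OF B(2)]
        by (auto simp: bridge_filling_def keys_bridge_vec intro!: bexI[of _ "\<iota> B"])
    qed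
  qed
  show "disjoint_family_on Poly_Mapping.keys bridge_filling"
    unfolding disjoint_family_on_def
  proof (intro ballI impI, rule ccontr)
    fix x y assume xy: "x \<in> bridge_filling" "y \<in> bridge_filling" "x \<noteq> y"
      "Poly_Mapping.keys x \<inter> Poly_Mapping.keys y \<noteq> {}"
    obtain B where B: "B \<in> \<B>" "x = bridge_vec B" "i B \<le> i (\<iota> B)" using xy(1) by (auto simp: bridge_filling_def)
    obtain B' where B': "B' \<in> \<B>" "y = bridge_vec B'" "i B' \<le> i (\<iota> B')" using xy(2) by (auto simp: bridge_filling_def)
    have "B \<noteq> B'" using xy(3) B B' by auto
    then have "B = \<iota> B' \<or> B' = \<iota> B"
      using xy(4) unfolding B(2) B'(2) keys_bridge_vec using iota_iota B(1) B'(1) by auto metis+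
    \<comment> \<open>The two letters form one orbit, and each of them was selected as the earlier
      one.\<close>
    then have "i B = i B'" using B B' iota_iota by auto
    then show False using first_pos_inj[of B B'] B_in_L B B' \<open>B \<noteq> B'\<close> by auto
  qed
qed

text \<open>The sign in \<open>bridge_vec\<close> is chosen so that the four steps of the two arcs
  group into differences of steps at symmetric positions, whether \<iota> keeps or reverses the
  order of the occurrences.\<close>

lemma arc_vec_bridge_vec_near_isotropic:
  assumes B: "B \<in> \<B>"
  shows "arc_vec L u (bridge_vec B) \<in> near_isotropic"
proof -
  obtain r l r' l' where *: "r < k" "l < n r" "i B = start r + l" "r' < k" "l' < n r'" "j B = start r' + l'"
    "mirror r l = (if \<epsilon> B = 1 then i (\<iota> B) else j (\<iota> B))"
    "mirror r' l' = (if \<epsilon> B = 1 then j (\<iota> B) else i (\<iota> B))"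
    using first_last_mirror[OF B] .
  note S = half_step_mirror_near_isotropic[OF *(1,2)] half_step_mirror_near_isotropic[OF *(4,5)]
  have s: "Some B \<in> insert None (Some ` L)" "Some (\<iota> B) \<in> insert None (Some ` L)" using B B_in_L iota_in by auto
  note arc = arc_vec_frag_of[OF finL s(1)] arc_vec_frag_of[OF finL s(2)]
  show ?thesis
  proof (cases "\<iota> B = B")
    case True
    \<comment> \<open>Otherwise the weight of \<open>B\<close> would be its own negative, contrary
      to its being 1 or -1. Hence the two occurrences of \<open>B\<close> are symmetric to each
      other.\<close>
    have "\<epsilon> B \<noteq> 1"
      using weight_iota[OF B] True wt_nonzero[OF nanowordD(2)[OF w B_in_L[OF B]]] by auto
    then have "arc_vec L u (bridge_vec B) = (\<lambda>p. half_step (start r + l) p - half_step (mirror r l) p)"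
      using True * by (simp add: bridge_vec_def arc arc_def[abs_def])
    then show ?thesis using S(1) by simp
  next
    case False
    have "arc_vec L u (bridge_vec B) = (\<lambda>p. (half_step (start r + l) p - half_step (mirror r l) p)
       - (half_step (start r' + l') p - half_step (mirror r' l') p))"
      using False * by (auto simp: bridge_vec_def arc_vec_add arc_vec_cmul arc arc_def fun_eq_iff)
    then show ?thesis using near_isotropic_diff[OF S] by simp
  qed
qed

lemma arc_vec_zspan_near_isotropic:
  assumes "m \<in> zspan bridge_filling"
  shows "arc_vec L u m \<in> near_isotropic"
  using assms
proof (induction rule: zspan_induct)
  case zero
  show ?case using isotropic_near_isotropic[OF isotropic_zero] by (simp add: arc_vec_def[abs_def])
next
  case (add c x y)
  then have "arc_vec L u y \<in> near_isotropic" using arc_vec_bridge_vec_near_isotropic by (auto simp: bridge_filling_def)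
  then show ?case using add by (simp add: arc_vec_add arc_vec_cmul near_isotropic_add near_isotropic_scale)
qed

section \<open>Fillings before and after the bridge move\<close>

definition reduced :: "('a, 'b) nanoword" where "reduced = delete_letters w \<B> (concat xs)"

lemma nanoword_reduced: "nanoword \<alpha> reduced"
proof -
  have cx: "concat xs = filter (\<lambda>D. D \<notin> \<B>) u"
    unfolding factor(3) by (rule interleave_filter[OF factor(2), symmetric]) (use factor(4,5) in blast)+
  have "count_list (concat xs) A = 2" if "A \<in> L - \<B>" for A
    unfolding cx using first_last_pos_filter(3)[of u A "\<lambda>D. D \<notin> \<B>"] count2 that by auto
  moreover have "set (concat xs) \<subseteq> L - \<B>" using factor(5) by auto
  moreover have "restrict (proj w) (L - \<B>) \<in> L - \<B> \<rightarrow>\<^sub>E \<alpha>" using nanowordD(2)[OF w] by auto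
  ultimately show ?thesis by (simp add: reduced_def delete_letters_def nanoword_def)
qed

text \<open>Expresses the form of the shorter word through the positions of the longer one, so that
  both forms become values of the same crossing form.\<close>

lemma phi_form_reduced:
  assumes "Poly_Mapping.keys x \<subseteq> insert None (Some ` (L - \<B>))" "Poly_Mapping.keys y \<subseteq> insert None (Some ` (L - \<B>))"
  shows "phi_form reduced x y = 2 * crossing f L u (rest (arc_vec L u x)) (rest (arc_vec L u y))"
proof -
  have cx: "concat xs = filter (\<lambda>D. D \<notin> \<B>) u"
    unfolding factor(3) by (rule interleave_filter[OF factor(2), symmetric]) (use factor(4,5) in blast)+
  have red: "letters reduced = L - \<B>" "word reduced = filter (\<lambda>D. D \<notin> \<B>) u"
    "\<And>D. D \<in> L - \<B> \<Longrightarrow> proj reduced D = proj w D"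
    by (simp_all add: reduced_def delete_letters_def cx)
  have v: "arc_vec (L - \<B>) u z = arc_vec L u z" if z: "Poly_Mapping.keys z \<subseteq> insert None (Some ` (L - \<B>))" for z
  proof
    fix p
    show "arc_vec (L - \<B>) u z p = arc_vec L u z p"
      unfolding arc_vec_def
    proof (rule sum.mono_neutral_left)
      show "finite (insert None (Some ` L))" using finL by simp
      show "\<forall>a\<in>insert None (Some ` L) - insert None (Some ` (L - \<B>)). of_int (Poly_Mapping.lookup z a) * arc u a p = 0"
        using z by (auto simp: in_keys_iff subset_iff)
    qed auto
  qed
  have "phi_form reduced x y = 2 * crossing (\<lambda>D. wt (proj reduced D)) (L - \<B>) (filter (\<lambda>D. D \<notin> \<B>) u)
    (arc_vec (L - \<B>) (filter (\<lambda>D. D \<notin> \<B>) u) x) (arc_vec (L - \<B>) (filter (\<lambda>D. D \<notin> \<B>) u) y)"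
    unfolding phi_form_eq[OF nanoword_reduced] red(1,2) ..
  also have "crossing (\<lambda>D. wt (proj reduced D)) (L - \<B>) (filter (\<lambda>D. D \<notin> \<B>) u)
    (arc_vec (L - \<B>) (filter (\<lambda>D. D \<notin> \<B>) u) x) (arc_vec (L - \<B>) (filter (\<lambda>D. D \<notin> \<B>) u) y)
    = crossing (\<lambda>D. wt (proj reduced D)) (L - \<B>) u (arc_vec (L - \<B>) u x) (arc_vec (L - \<B>) u y)"
    by (rule crossing_arc_vec_filter) (use count2 in auto)
  also have "\<dots> = crossing f (L - \<B>) u (arc_vec L u x) (arc_vec L u y)"
    unfolding v[OF assms(1)] v[OF assms(2)] by (rule crossing_cong) (use red(3) in auto)
  finally show ?thesis unfolding crossing_rest .
qed

lemma rank_le_perturb_crossing: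
  assumes "rank_le (\<lambda>x y. 2 * crossing f L u (a x) (a y)) I R"
    and "\<And>x. x \<in> I \<Longrightarrow> b x = (\<lambda>p. a x p + (\<Sum>e\<in>arch_ix. c e x * arch_fun e p))"
  shows "rank_le (\<lambda>x y. 2 * crossing f L u (b x) (b y)) I (R + 4 * arches k \<kappa>)"
proof -
  have "rank_le (\<lambda>x y. 2 * crossing f L u (b x) (b y)) I (R + 2 * card arch_ix)"
    by (rule rank_le_perturb[where b = "\<lambda>x y. 2 * crossing f L u x y" and \<alpha> = a and \<beta> = b and g = arch_fun and c = c,
          OF _ _ _ _ finite_arch_ix assms])
      (simp_all add: crossing_add crossing_scale)
  then show ?thesis by (simp add: card_arch_ix)
qed

lemma near_isotropic_decompose:
  assumes "\<And>x. x \<in> I \<Longrightarrow> g x \<in> near_isotropic"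
  obtains z c where "\<And>x. x \<in> I \<Longrightarrow> z x \<in> isotropic"
    "\<And>x. x \<in> I \<Longrightarrow> g x = (\<lambda>p. z x p + (\<Sum>e\<in>arch_ix. c e x * arch_fun e p))"
proof -
  have "\<forall>x\<in>I. \<exists>zc. fst zc \<in> isotropic \<and> g x = (\<lambda>p. fst zc p + (\<Sum>e\<in>arch_ix. snd zc e * arch_fun e p))"
    using assms unfolding near_isotropic_def by fastforce
  from bchoice[OF this] obtain h where
    "\<forall>x\<in>I. fst (h x) \<in> isotropic \<and> g x = (\<lambda>p. fst (h x) p + (\<Sum>e\<in>arch_ix. snd (h x) e * arch_fun e p))" by blast
  then show thesis using that[of "\<lambda>x. fst (h x)" "\<lambda>e x. snd (h x) e"] by blast
qed

lemma labelled: "labelled_set \<alpha> \<tau> (\<lambda>a. proj w (the a)) (Some ` L)"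
  using tau_tau nanowordD(2)[OF w] by (auto simp: labelled_set_def)

text \<open>The projection of \<open>reduced\<close> is \<open>undefined\<close> on \<B>, so
  shortness can be compared only for vectors whose supports avoid \<B>.\<close>

lemma partial_filling_reduced:
  "partial_filling \<tau> (\<lambda>a. proj reduced (the a)) (Some ` letters reduced) F \<longleftrightarrow>
   partial_filling \<tau> (\<lambda>a. proj w (the a)) (Some ` (L - \<B>)) F"
proof -
  have lr: "letters reduced = L - \<B>" by (simp add: reduced_def delete_letters_def)
  have "short \<tau> (\<lambda>a. proj reduced (the a)) x \<longleftrightarrow> short \<tau> (\<lambda>a. proj w (the a)) x"
    if "Poly_Mapping.keys x \<subseteq> Some ` (L - \<B>)" for x
  proof -
    have "tau_rel \<tau> c (proj reduced (the A)) (proj reduced (the B)) \<longleftrightarrow> tau_rel \<tau> c (proj w (the A)) (proj w (the B))"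
      if "x = frag_of A + frag_cmul c (frag_of B)" "A \<noteq> B" "c \<noteq> 0" for A B c
    proof -
      have "{A, B} \<subseteq> Some ` (L - \<B>)"
        using keys_frag_pair[OF that(2,3)] that(1) \<open>Poly_Mapping.keys x \<subseteq> _\<close> by simp
      then show ?thesis by (auto simp: reduced_def delete_letters_def)
    qed
    then show ?thesis unfolding short_def using tau_rel_nonzero by metis
  qed
  then have "(\<forall>x\<in>F. short \<tau> (\<lambda>a. proj reduced (the a)) x) \<longleftrightarrow> (\<forall>x\<in>F. short \<tau> (\<lambda>a. proj w (the a)) x)"
    if "\<Union> (Poly_Mapping.keys ` F) = Some ` (L - \<B>)"
    using that by (intro ball_cong refl) blast
  then show ?thesis unfolding partial_filling_def lr by metis
qed

text \<open>A vector x obtained by elimination is l + m with l from the old filling and m from the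
  bridge. The function of l differs from the truncated function of x by an isotropic part, which the
  form does not see, and by arch functions, which cost rank 4 for each arch.\<close>

lemma has_fill_reduced:
  assumes "has_fill w R"
  shows "has_fill reduced (R + 4 * arches k \<kappa>)"
proof -
  obtain F where F: "partial_filling \<tau> (\<lambda>a. proj w (the a)) (Some ` L) F"
      "rank_le (phi_form w) (insert (frag_of None) F) R"
    using assms unfolding has_fill_def by blast
  obtain F' where F': "partial_filling \<tau> (\<lambda>a. proj w (the a)) (Some ` L - Some ` \<B>) F'" "F' \<subseteq> zspan (F \<union> bridge_filling)"
    using eliminate_filling[OF labelled F(1) bridge_filling] factor(1) by blast
  have LB: "Some ` L - Some ` \<B> = Some ` (L - \<B>)" by auto
  let ?I = "insert (frag_of None) F'" and ?J = "insert (frag_of None) F"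
  have finF: "finite F" "finite ?J" "finite bridge_filling" using F(1) bridge_filling by (auto simp: partial_filling_def)
  \<comment> \<open>The vector of \<open>s\<close> is left untouched by the elimination, hence it is
    its own first part.\<close>
  have "\<exists>lm. fst lm \<in> zspan ?J \<and> snd lm \<in> zspan bridge_filling \<and> x = fst lm + snd lm" if "x \<in> ?I" for x
  proof (cases "x = frag_of None")
    case True
    then show ?thesis using zspan_base[OF finF(2)] zspan_0 by (intro exI[of _ "(x, 0)"]) auto
  next
    case False
    then have "x \<in> zspan (F \<union> bridge_filling)" using that F'(2) by blast
    then obtain l m where lm: "l \<in> zspan F" "m \<in> zspan bridge_filling" "x = l + m" using zspan_Un finF by blast
    moreover have "l \<in> zspan ?J" by (rule zspan_subset[OF finF(2) _ lm(1)]) (use zspan_base[OF finF(2)] in blast)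
    ultimately show ?thesis by (intro exI[of _ "(l, m)"]) auto
  qed
  then obtain h where h: "\<And>x. x \<in> ?I \<Longrightarrow> fst (h x) \<in> zspan ?J \<and> snd (h x) \<in> zspan bridge_filling \<and> x = fst (h x) + snd (h x)"
    by metis
  have keys: "Poly_Mapping.keys x \<subseteq> insert None (Some ` (L - \<B>))" if "x \<in> ?I" for x
    using that F'(1) unfolding LB partial_filling_def by auto
  let ?\<chi> = "arc_vec L u"
  \<comment> \<open>Both errors are collected in one function: the contribution of m, and the part
    of x that truncation removes.\<close>
  have "(\<lambda>p. ?\<chi> (snd (h x)) p - (?\<chi> x p - rest (?\<chi> x) p)) \<in> near_isotropic" if "x \<in> ?I" for x
    using that h by (intro near_isotropic_diff arc_vec_zspan_near_isotropic arc_vec_rest_near_isotropic keys) auto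
  then obtain z c where z: "\<And>x. x \<in> ?I \<Longrightarrow> z x \<in> isotropic" "\<And>x. x \<in> ?I \<Longrightarrow>
      (\<lambda>p. ?\<chi> (snd (h x)) p - (?\<chi> x p - rest (?\<chi> x) p)) = (\<lambda>p. z x p + (\<Sum>e\<in>arch_ix. c e x * arch_fun e p))"
    using near_isotropic_decompose[of ?I "\<lambda>x p. ?\<chi> (snd (h x)) p - (?\<chi> x p - rest (?\<chi> x) p)"] by blast
  \<comment> \<open>In \<open>b\<close> only the isotropic error is subtracted. It thus has the form
    values of \<open>reduced\<close>, and it differs from the function of l by arch functions
    alone.\<close>
  define b where "b x = (\<lambda>p. rest (?\<chi> x) p + - 1 * z x p)" for x
  have be: "b x = (\<lambda>p. ?\<chi> (fst (h x)) p + (\<Sum>e\<in>arch_ix. c e x * arch_fun e p))" if "x \<in> ?I" for x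
  proof
    fix p
    have "?\<chi> x p = ?\<chi> (fst (h x)) p + ?\<chi> (snd (h x)) p"
      using h[OF that] arc_vec_add[of L u "fst (h x)" "snd (h x)"] by metis
    then show "b x p = ?\<chi> (fst (h x)) p + (\<Sum>e\<in>arch_ix. c e x * arch_fun e p)"
      using fun_cong[OF z(2)[OF that], of p] by (simp add: b_def)
  qed
  have "rank_le (phi_form w) ((\<lambda>x. fst (h x)) ` ?I) R"
    by (rule rank_le_zspan[OF phi_form_add[OF w] phi_form_cmul[OF w] finF(2) _ F(2)]) (use h in auto)
  then have "rank_le (\<lambda>x y. phi_form w (fst (h x)) (fst (h y))) ?I R"
    by (rule rank_le_pullback) auto
  then have "rank_le (\<lambda>x y. 2 * crossing f L u (?\<chi> (fst (h x))) (?\<chi> (fst (h y)))) ?I R"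
    unfolding phi_form_eq[OF w] .
  from rank_le_perturb_crossing[OF this be]
  have "rank_le (\<lambda>x y. 2 * crossing f L u (b x) (b y)) ?I (R + 4 * arches k \<kappa>)" by blast
  then have "rank_le (phi_form reduced) ?I (R + 4 * arches k \<kappa>)"
  proof (rule rank_le_cong)
    fix x y assume xy: "x \<in> ?I" "y \<in> ?I"
    show "phi_form reduced x y = 2 * crossing f L u (b x) (b y)"
      unfolding phi_form_reduced[OF keys[OF xy(1)] keys[OF xy(2)]] b_def
      using crossing_rest_isotropic[OF isotropic_scale[OF z(1)[OF xy(1)], of "-1"] isotropic_scale[OF z(1)[OF xy(2)], of "-1"]] by simp
  qed
  then show ?thesis using F'(1) unfolding has_fill_def partial_filling_reduced LB by blast
qed

text \<open>The vectors attached to the bridge are added to the filling. Up to arch functions they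
  are isotropic, so the matrix is the old one bordered by zeros.\<close>

lemma has_fill_unreduced:
  assumes "has_fill reduced R"
  shows "has_fill w (R + 4 * arches k \<kappa>)"
proof -
  obtain F' where F': "partial_filling \<tau> (\<lambda>a. proj w (the a)) (Some ` (L - \<B>)) F'"
      "rank_le (phi_form reduced) (insert (frag_of None) F') R"
    using assms unfolding has_fill_def partial_filling_reduced by blast
  let ?M = bridge_filling
  let ?J = "insert (frag_of None) F'" and ?I = "insert (frag_of None) (F' \<union> ?M)"
  let ?\<chi> = "arc_vec L u"
  have dis: "Poly_Mapping.keys x \<inter> Poly_Mapping.keys y = {}" if "x \<in> F'" "y \<in> ?M" for x y
  proof -
    have "Poly_Mapping.keys x \<subseteq> Some ` (L - \<B>)" "Poly_Mapping.keys y \<subseteq> Some ` \<B>"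
      using F'(1) bridge_filling that by (auto simp: partial_filling_def)
    then show ?thesis by auto
  qed
  have pf: "partial_filling \<tau> (\<lambda>a. proj w (the a)) (Some ` L) (F' \<union> ?M)"
    unfolding partial_filling_def
  proof (intro conjI)
    have "\<Union> (Poly_Mapping.keys ` (F' \<union> ?M)) = Some ` (L - \<B>) \<union> Some ` \<B>"
      using F'(1) bridge_filling unfolding partial_filling_def by (simp add: image_Un)
    then show "\<Union> (Poly_Mapping.keys ` (F' \<union> ?M)) = Some ` L" using factor(1) by auto
    show "disjoint_family_on Poly_Mapping.keys (F' \<union> ?M)"
    proof -
      have "Poly_Mapping.keys x \<inter> Poly_Mapping.keys y = {}" if "x \<in> F'" "y \<in> F'" "x \<noteq> y" for x y
        using F'(1) that by (simp add: partial_filling_def disjoint_family_on_def)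
      moreover have "Poly_Mapping.keys x \<inter> Poly_Mapping.keys y = {}" if "x \<in> ?M" "y \<in> ?M" "x \<noteq> y" for x y
        using bridge_filling that by (simp add: partial_filling_def disjoint_family_on_def)
      ultimately show ?thesis unfolding disjoint_family_on_def using dis by (metis Int_commute Un_iff)
    qed
  qed (use F'(1) bridge_filling in \<open>auto simp: partial_filling_def\<close>)
  have keys: "Poly_Mapping.keys x \<subseteq> insert None (Some ` (L - \<B>))" if "x \<in> ?J" for x
    using that F'(1) by (auto simp: partial_filling_def)
  have finM: "finite ?M" using bridge_filling by (simp add: partial_filling_def)
  \<comment> \<open>The value 0 on the new vectors reflects that their functions are near isotropic
    without any truncation.\<close>
  define a where "a x = rest (if x \<in> ?J then ?\<chi> x else (\<lambda>p. 0))" for x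
  have "(\<lambda>p. ?\<chi> x p - a x p) \<in> near_isotropic" if "x \<in> ?I" for x
  proof (cases "x \<in> ?J")
    case True
    then show ?thesis unfolding a_def using arc_vec_rest_near_isotropic[OF keys] by simp
  next
    case False
    then have "?\<chi> x \<in> near_isotropic" using that zspan_base[OF finM] arc_vec_zspan_near_isotropic by blast
    moreover have "a x = (\<lambda>p. 0)" using False by (simp add: a_def rest_def fun_eq_iff)
    ultimately show ?thesis by simp
  qed
  then obtain z c where z: "\<And>x. x \<in> ?I \<Longrightarrow> z x \<in> isotropic" "\<And>x. x \<in> ?I \<Longrightarrow>
      (\<lambda>p. ?\<chi> x p - a x p) = (\<lambda>p. z x p + (\<Sum>e\<in>arch_ix. c e x * arch_fun e p))"
    using near_isotropic_decompose[of ?I "\<lambda>x p. ?\<chi> x p - a x p"] by blast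
  have be: "?\<chi> x = (\<lambda>p. (a x p + z x p) + (\<Sum>e\<in>arch_ix. c e x * arch_fun e p))" if "x \<in> ?I" for x
  proof
    fix p
    show "?\<chi> x p = (a x p + z x p) + (\<Sum>e\<in>arch_ix. c e x * arch_fun e p)"
      using fun_cong[OF z(2)[OF that], of p] by simp
  qed
  obtain X Y where XY: "\<forall>x\<in>?J. \<forall>y\<in>?J. phi_form reduced x y = (\<Sum>k<R. X k x * Y k y)"
    using F'(2) unfolding rank_le_def by blast
  \<comment> \<open>Extending a factorisation by 0 to the new vectors realises the border of zeros
    without raising the rank.\<close>
  have "rank_le (\<lambda>x y. 2 * crossing f L u (\<lambda>p. a x p + z x p) (\<lambda>p. a y p + z y p)) ?I R"
    unfolding rank_le_def
  proof (rule exI[of _ "\<lambda>k x. if x \<in> ?J then X k x else 0"], rule exI[of _ "\<lambda>k x. if x \<in> ?J then Y k x else 0"], intro ballI)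
    fix x y assume xy: "x \<in> ?I" "y \<in> ?I"
    have e: "2 * crossing f L u (\<lambda>p. a x p + z x p) (\<lambda>p. a y p + z y p) = 2 * crossing f L u (a x) (a y)"
      unfolding a_def using crossing_rest_isotropic[OF z(1)[OF xy(1)] z(1)[OF xy(2)]] by simp
    show "2 * crossing f L u (\<lambda>p. a x p + z x p) (\<lambda>p. a y p + z y p) =
        (\<Sum>k<R. (if x \<in> ?J then X k x else 0) * (if y \<in> ?J then Y k y else 0))"
    proof (cases "x \<in> ?J \<and> y \<in> ?J")
      case True
      then have "2 * crossing f L u (a x) (a y) = phi_form reduced x y"
        using phi_form_reduced[OF keys keys] by (simp add: a_def)
      moreover have "phi_form reduced x y = (\<Sum>k<R. X k x * Y k y)" using True XY by blast
      ultimately show ?thesis unfolding e using True by simp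
    next
      case False
      then have "a x = (\<lambda>p. 0) \<or> a y = (\<lambda>p. 0)" by (auto simp: a_def rest_def fun_eq_iff)
      then show ?thesis unfolding e using False by (auto simp: crossing_zero)
    qed
  qed
  from rank_le_perturb_crossing[OF this be]
  have "rank_le (\<lambda>x y. 2 * crossing f L u (?\<chi> x) (?\<chi> y)) ?I (R + 4 * arches k \<kappa>)" by blast
  then have "rank_le (phi_form w) ?I (R + 4 * arches k \<kappa>)"
    by (rule rank_le_cong) (rule phi_form_eq[OF w])
  then show ?thesis using pf unfolding has_fill_def by blast
qed

end

section \<open>Metamorphoses\<close>

context weight_hom
begin

lemma has_fill_bridge_move:
  assumes w: "nanoword \<alpha> w" and b: "bridge_move \<tau> w w' g"
  shows "has_fill w R \<Longrightarrow> has_fill w' (R + 4 * g)" "has_fill w' R \<Longrightarrow> has_fill w (R + 4 * g)"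
proof -
  obtain \<B> xs vs \<kappa> \<iota> where *: "bridge \<tau> w \<B> xs vs \<kappa> \<iota>" "w' = delete_letters w \<B> (concat xs)"
    "g = arches (length vs) \<kappa>"
    using b by (auto elim: bridge_move.cases)
  interpret bridge_data \<alpha> \<tau> \<phi> w \<B> xs vs \<kappa> \<iota> by unfold_locales (rule w, rule *(1))
  show "has_fill w R \<Longrightarrow> has_fill w' (R + 4 * g)" "has_fill w' R \<Longrightarrow> has_fill w (R + 4 * g)"
    using has_fill_reduced has_fill_unreduced by (simp_all add: reduced_def *)
qed

end

section \<open>The first two homotopy moves as bridges without arches\<close>

lemma arches_id: "arches n id = 0"
  by (simp add: arches_def)

text \<open>The factor is (AA), with \<iota> and \<kappa> the identity. Reflection exchanges the two
  occurrences of A, so \<epsilon> is 0 and the label condition is trivial.\<close>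

lemma first_homotopy_bridge_move:
  assumes v: "nanoword \<alpha> v" and u: "word v = x @ [A, A] @ y"
  shows "bridge_move \<tau> v (delete_letters v {A} (x @ y)) 0"
proof -
  have "A \<in> letters v" using nanowordD(4)[OF v] u by simp
  then have A: "A \<in> letters v" "count_list (word v) A = 2" using nanowordD(1)[OF v] by auto
  have "count_list x A = 0" "count_list y A = 0" using A(2) by (simp_all add: u)
  then have nin: "A \<notin> set x" "A \<notin> set y" by (simp_all add: count_list_0_iff)
  have eps: "bridge_eps [x, y] [[A, A]] id id A = 0"
    by (auto simp: bridge_eps_def factor_pos_def less_Suc_eq)
  have "bridge \<tau> v {A} [x, y] [[A, A]] id id"
    using A nin u nanowordD(4)[OF v] eps
    by (auto simp: bridge_def quasi_bridge_def is_factor_def interleave_def permutes_id)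
  from bridge_move.intros[OF this] show ?thesis by (simp add: arches_id)
qed

text \<open>The factor is (AB|BA), with \<kappa> the identity and \<iota> exchanging A and B. Then
  \<epsilon> is 1, and the label condition is exactly the hypothesis of the move.\<close>

lemma second_homotopy_bridge_move:
  assumes v: "nanoword \<alpha> v" and u: "word v = x @ [A, B] @ y @ [B, A] @ z"
    and pr: "proj v B = \<tau> (proj v A)" and inv: "\<And>a. a \<in> \<alpha> \<Longrightarrow> \<tau> (\<tau> a) = a"
  shows "bridge_move \<tau> v (delete_letters v {A, B} (x @ y @ z)) 0"
proof -
  have "A \<in> letters v" "B \<in> letters v" using nanowordD(4)[OF v] u by simp_all
  then have A: "A \<in> letters v" "count_list (word v) A = 2" and B: "B \<in> letters v" "count_list (word v) B = 2"
    using nanowordD(1)[OF v] by auto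
  have AB: "A \<noteq> B" using A(2) u by auto
  have nin: "A \<notin> set x" "A \<notin> set y" "A \<notin> set z" "B \<notin> set x" "B \<notin> set y" "B \<notin> set z"
  proof -
    have "count_list x A = 0 \<and> count_list y A = 0 \<and> count_list z A = 0"
      "count_list x B = 0 \<and> count_list y B = 0 \<and> count_list z B = 0"
      using A(2) B(2) AB by (simp_all add: u)
    then show "A \<notin> set x" "A \<notin> set y" "A \<notin> set z" "B \<notin> set x" "B \<notin> set y" "B \<notin> set z"
      by (simp_all add: count_list_0_iff)
  qed
  define \<iota> where "\<iota> = (\<lambda>D. if D = A then B else A)"
  let ?xs = "[x, y, z]" and ?vs = "[[A, B], [B, A]]"
  have int: "interleave ?xs ?vs = word v" by (simp add: interleave_def u)
  have n: "word v ! length x = A" "word v ! Suc (length x) = B"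
    "word v ! (length x + 2 + length y) = B" "word v ! (length x + 3 + length y) = A"
    by (simp_all add: u nth_append)
  have l: "length x + 3 + length y < length (word v)" by (simp add: u)
  have fp: "first_pos (word v) A = length x" "first_pos (word v) B = Suc (length x)"
    using first_last_posI[OF A(2), of "length x" "length x + 3 + length y"]
      first_last_posI[OF B(2), of "Suc (length x)" "length x + 2 + length y"] n l by auto
  have eps: "bridge_eps ?xs ?vs id \<iota> A = 1" "bridge_eps ?xs ?vs id \<iota> B = 1"
  proof -
    \<comment> \<open>Both letters occur first in block 0, at the offsets 0 and 1, which reflection
      exchanges.\<close>
    have "\<exists>r j. r < length ?vs \<and> j < length (?vs ! r) \<and> factor_pos ?xs ?vs r j = first_pos (word v) A \<and>
       factor_pos ?xs ?vs (id r) (length (?vs ! r) - 1 - j) = first_pos (word v) (\<iota> A)"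
      by (rule exI[of _ 0], rule exI[of _ 0]) (simp add: factor_pos_def fp \<iota>_def)
    then show "bridge_eps ?xs ?vs id \<iota> A = 1" unfolding bridge_eps_def int by simp
    have "\<exists>r j. r < length ?vs \<and> j < length (?vs ! r) \<and> factor_pos ?xs ?vs r j = first_pos (word v) B \<and>
       factor_pos ?xs ?vs (id r) (length (?vs ! r) - 1 - j) = first_pos (word v) (\<iota> B)"
      by (rule exI[of _ 0], rule exI[of _ 1]) (use AB in \<open>simp add: factor_pos_def fp \<iota>_def\<close>)
    then show "bridge_eps ?xs ?vs id \<iota> B = 1" unfolding bridge_eps_def int by simp
  qed
  have "is_factor v {A, B} ?xs ?vs"
    using A B AB nin nanowordD(4)[OF v] int u by (auto simp: is_factor_def)
  moreover have "map \<iota> (?vs ! r) = rev (?vs ! id r)" if "r < length ?vs" for r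
    using that AB by (cases r) (auto simp: \<iota>_def)
  moreover have "even (length (?vs ! r))" if "r < length ?vs" for r using that by (cases r) auto
  ultimately have "quasi_bridge v {A, B} ?xs ?vs id \<iota>"
    unfolding quasi_bridge_def by (auto simp: \<iota>_def permutes_id)
  moreover have "proj v (\<iota> D) = (\<tau> ^^ bridge_eps ?xs ?vs id \<iota> D) (proj v D)" if "D \<in> {A, B}" for D
    using that pr inv[OF nanowordD(2)[OF v A(1)]] eps AB by (auto simp: \<iota>_def)
  ultimately have "bridge \<tau> v {A, B} ?xs ?vs id \<iota>" unfolding bridge_def by blast
  from bridge_move.intros[OF this] show ?thesis by (simp add: arches_id)
qed

context weight_hom
begin

lemma has_fill_elementary_move:
  assumes "elementary_move \<alpha> \<tau> v w g"
  shows "(has_fill v R \<longrightarrow> has_fill w (R + 4 * g)) \<and> (has_fill w R \<longrightarrow> has_fill v (R + 4 * g))"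
  using assms
proof cases
  case isomorphism
  then show ?thesis
    using has_fill_isomorphic[of v w R] has_fill_isomorphic[of w v R] isomorphism_move_sym[of \<alpha> v w] by auto
next
  case homotopy
  from homotopy(4) show ?thesis
  proof cases
    case (first x A y)
    have "bridge_move \<tau> v w 0" unfolding first(1) by (rule first_homotopy_bridge_move[OF homotopy(2) first(2)])
    then show ?thesis using has_fill_bridge_move[OF homotopy(2), of w 0 R] homotopy(1) by simp
  next
    case (second x A B y z)
    have "bridge_move \<tau> v w 0"
      unfolding second(1) by (rule second_homotopy_bridge_move[OF homotopy(2) second(2,3) tau_tau])
    then show ?thesis using has_fill_bridge_move[OF homotopy(2), of w 0 R] homotopy(1) by simp
  next
    case (third x A B y C z t)
    have "phi_form w = phi_form v"
      by (rule phi_form_third_move[OF homotopy(2,3) third(2,3,4,5) third(1)])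
    then show ?thesis using homotopy(1) by (simp add: has_fill_def third(1))
  qed
next
  case bridge
  then show ?thesis using has_fill_bridge_move[of v w g R] by blast
qed

text \<open>The bound passes from the target back to the source, since the known filling is that of
  the empty nanoword at the end.\<close>

lemma has_fill_metamorphosis:
  "metamorphosis \<alpha> \<tau> v w g \<Longrightarrow> has_fill w R \<Longrightarrow> has_fill v (R + 4 * g)"
proof (induction rule: metamorphosis.induct)
  case (move u v g w h)
  then show ?case using has_fill_elementary_move[OF move(1), of "R + 4 * h"] by (simp add: algebra_simps)
next
  case (inverse_move v u g w h)
  then show ?case using has_fill_elementary_move[OF inverse_move(1), of "R + 4 * h"] by (simp add: algebra_simps)
qed simp

end

text \<open>Cutting the word into single letters, with \<open>\<iota>\<close> the identity and \<open>\<kappa>\<close> exchanging the two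
  occurrences of each letter, gives a bridge that removes all letters at once.\<close>

lemma metamorphosis_to_empty:
  assumes w: "nanoword \<alpha> w"
  shows "\<exists>g. metamorphosis \<alpha> \<tau> w empty_nanoword g"
proof -
  let ?u = "word w" and ?L = "letters w"
  have e: "nanoword \<alpha> empty_nanoword" by (simp add: nanoword_def empty_nanoword_def)
  show ?thesis
  \<comment> \<open>A bridge needs at least one block, so the empty word is treated apart;
    extensionality of the projection identifies it with \<open>empty_nanoword\<close>.\<close>
  proof (cases "?u = []")
    case True
    then have "?L = {}" using nanowordD(4)[OF w] by simp
    then have "w = empty_nanoword"
      using nanowordD(5)[OF w] True by (cases w) (auto simp: empty_nanoword_def extensional_def)
    then show ?thesis using metamorphosis.nil[OF e] by blast
  next
    case False
    define n where "n = length ?u"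
    define vs where "vs = map (\<lambda>a. [a]) ?u"
    define xs where "xs = replicate (Suc n) ([] :: 'b list)"
    define \<kappa> where "\<kappa> p = (if p < n then if p = first_pos ?u (?u ! p) then last_pos ?u (?u ! p) else first_pos ?u (?u ! p) else p)" for p
    have c: "count_list ?u A = 2" if "A \<in> set ?u" for A using nanowordD(1,4)[OF w] that by auto
    have vsn: "length vs = n" "\<And>p. p < n \<Longrightarrow> vs ! p = [?u ! p]" by (simp_all add: vs_def n_def)
    have int: "interleave (replicate (Suc (length t)) []) (map (\<lambda>a. [a]) t) = t" for t :: "'b list"
      by (induction t) (simp_all add: interleave_def)
    have cat: "concat (map (\<lambda>a. [a]) t) = t" for t :: "'b list" by (induction t) auto
    have K: "\<kappa> p < n \<and> ?u ! \<kappa> p = ?u ! p \<and> \<kappa> p \<noteq> p \<and> \<kappa> (\<kappa> p) = p" if "p < n" for p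
    proof -
      have A: "?u ! p \<in> set ?u" using that by (simp add: n_def)
      note facts = position_cases[OF c[OF A], of p] positions_eq(2)[OF c[OF A]] last_pos_less[OF c[OF A]]
        nth_first_pos[OF c[OF A]] nth_last_pos[OF c[OF A]]
      show ?thesis
        using facts that by (auto simp: \<kappa>_def n_def)
    qed
    have "is_factor w ?L xs vs"
      unfolding is_factor_def
      using nanowordD[OF w] int[of ?u] by (auto simp: xs_def vs_def n_def cat)
    moreover have "\<kappa> permutes {..<length vs}"
    proof -
      have "bij_betw \<kappa> {..<n} {..<n}"
        by (rule bij_betw_byWitness[of _ \<kappa>]) (use K in auto)
      then show ?thesis unfolding vsn(1)
        by (rule bij_imp_permutes) (simp add: \<kappa>_def)
    qed
    ultimately have qb: "quasi_bridge w ?L xs vs \<kappa> id"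
      unfolding quasi_bridge_def using K False by (auto simp: vsn n_def Suc_le_eq)
    \<comment> \<open>The first occurrence of a letter is symmetric to the second one, so \<epsilon>
      is 0 and the label condition for the identity is trivial.\<close>
    have eps: "bridge_eps xs vs \<kappa> id B = 0" if "B \<in> ?L" for B
    proof -
      have "factor_pos xs vs r j = r + j" if "r < n" for r j
      proof -
        have "concat (map2 (@) (replicate m []) (map (\<lambda>a. [a]) t)) = t" if "m = length t" for m and t :: "'b list"
          using that by (induction t arbitrary: m) auto
        from this[of r "take r ?u"] that show ?thesis
          by (simp add: factor_pos_def xs_def vs_def take_map n_def min_def del: replicate.simps)
      qed
      then have "factor_pos xs vs r 0 \<noteq> factor_pos xs vs (\<kappa> r) 0" if "r < n" for r using that K[OF that] by auto
      then show ?thesis by (auto simp: bridge_eps_def vsn) metis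
    qed
    have "bridge \<tau> w ?L xs vs \<kappa> id" unfolding bridge_def using qb eps by simp
    from bridge_move.intros[OF this]
    have "bridge_move \<tau> w (delete_letters w ?L (concat xs)) (arches (length vs) \<kappa>)" .
    moreover have "delete_letters w ?L (concat xs) = empty_nanoword"
      by (simp add: delete_letters_def empty_nanoword_def xs_def fun_eq_iff)
    ultimately have "elementary_move \<alpha> \<tau> w empty_nanoword (arches (length vs) \<kappa>)"
      using elementary_move.bridge[OF w e] by simp
    from metamorphosis.move[OF this metamorphosis.nil[OF e]] show ?thesis by blast
  qed
qed

theorem theorem9p4p2:
  fixes \<alpha> :: "'a set" and \<tau> :: "'a \<Rightarrow> 'a"
    and \<phi> :: "('a \<Rightarrow>\<^sub>0 int) set \<Rightarrow> int"
    and w :: "('a, 'b :: infinite) nanoword"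
  assumes "\<tau> \<in> \<alpha> \<rightarrow> \<alpha>" and "\<And>a. a \<in> \<alpha> \<Longrightarrow> \<tau> (\<tau> a) = a"
    and "\<phi> \<in> hom (pi_group \<alpha> \<tau>) integer_group"
    and "\<And>a. a \<in> \<alpha> \<Longrightarrow> \<phi> (pi_gen \<alpha> \<tau> a) \<in> {1, -1}"
    and "nanoword \<alpha> w"
  shows "real (bridge_norm \<alpha> \<tau> w) \<ge> 1/2 * phi_genus \<alpha> \<tau> \<phi> (nanoword_pairing \<alpha> \<tau> w)"
proof -
  interpret weight_hom \<alpha> \<tau> \<phi> by unfold_locales (use assms in auto)
  have "metamorphosis \<alpha> \<tau> w empty_nanoword (bridge_norm \<alpha> \<tau> w)"
    unfolding bridge_norm_def by (rule LeastI_ex[OF metamorphosis_to_empty[OF assms(5)]])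
  \<comment> \<open>A filling of rank at most 4 times the norm bounds the genus, which is half a
    rank, by twice the norm.\<close>
  from has_fill_metamorphosis[OF this has_fill_empty]
  have "phi_genus \<alpha> \<tau> \<phi> (nanoword_pairing \<alpha> \<tau> w) \<le> (0 + 4 * bridge_norm \<alpha> \<tau> w) / 2"
    using phi_genus_le_if_has_fill[OF assms(5)] by (metis of_nat_add of_nat_0)
  then show ?thesis by simp
qed

end
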